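(* Let $n,q$ be positive integers. The singular locus $\mathcal{S}ing^n_q$ is $\mathfrak{Mod}^{[n-1]}_{\tilde{\mathbf{A}}_n}(q^n)$, regarded as an algebraic subvariety of $\mathfrak{Mod}_{\tilde{\mathbf{A}}_n}(q^n)\simeq V^*$. The irreducible components of $\mathcal{S}ing^n_q$ are in one-to-one correspondence with the set of $\leq_{rk}$-maximal (and equivalently $\leq_{ad}$-maximal, and equivalently $\leq_{deg}$-maximal) elements in the set of $(n-1)$-nilpotent representations of $\tilde{\mathbf{A}}_n$ of dimension vector $(q^n)$, up to isomorphism. More precisely, if $M$ is a maximal element, then the orbit closure $\overline{\mathscr{O}}_M$ is an irreducible component of $\mathcal{S}ing^n_q$; all irreducible components arise in this way; and if $M,N$ are maximal elements that are not isomorphic, then $\overline{\mathscr{O}}_M\neq\overline{\mathscr{O}}_N$.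
   Context: **Polynomial and singular locus.** $V^*=Mat_q(\mathbb{C})^{\oplus n}$ is the space of $n$-tuples $(X_1,\dots,X_n)$ of complex $q\times q$ matrices, and $IMM_q^n(X_1,\dots,X_n)=\mathrm{trace}(X_n\cdots X_1)$, a homogeneous polynomial of degree $n$ on $V^*$. $\mathcal{I}mm^n_q\subseteq V^*$ is the affine hypersurface $IMM_q^n=0$, and $\mathcal{S}ing^n_q\subseteq V^*$ is its singular locus, namely the common zero locus of all first-order partial derivatives of $IMM^n_q$. **Quiver representations.** $\tilde{\mathbf{A}}_n$ is the equioriented cyclic quiver with vertices $1,\dots,n$ (indices modulo $n$) and one arrow $\alpha\to\alpha+1$ for each $\alpha\in\mathbb{Z}_n$. A representation of dimension vector $(q^n)=(q,\dots,q)$ is a tuple of linear maps $X_\alpha:\mathbb{C}^q\to\mathbb{C}^q$ from the space at vertex $\alpha$ to the space at vertex $\alpha+1$; the variety of these is $\mathfrak{Mod}_{\tilde{\mathbf{A}}_n}(q^n)\simeq V^*$. For a path $w$ in the quiver and a representation $M$, $\phi^M_w$ denotes the composition of the maps of $M$ along $w$. $M$ is $k$-nilpotent if $\phi^M_w=0$ for every path $w$ of length $\geq k$; $\mathfrak{Mod}^{[k]}_{\tilde{\mathbf{A}}_n}(q^n)$ is the set of $k$-nilpotent representations of dimension vector $(q^n)$. The group $GL_q^{\times n}$ acts on $V^*$ by change of basis, $(g_\alpha)\cdot(X_\alpha)=(g_{\alpha+1}X_\alpha g_\alpha^{-1})$; its orbits are the isomorphism classes, and $\mathscr{O}_M$ denotes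 the orbit of $M$, $\overline{\mathscr{O}}_M$ its closure. **Orders** (on isomorphism classes of $(n-1)$-nilpotent representations of dimension vector $(q^n)$). - $N\leq_{deg}M$ if $N\in\overline{\mathscr{O}}_M$. - $N\leq_{rk}M$ if $\mathrm{rk}\,\phi^N_w\leq\mathrm{rk}\,\phi^M_w$ for every path $w$. - $\leq_{ad}$: the indecomposable $(n-1)$-nilpotent representations are $E_{\alpha\beta}$ for $\alpha,\beta\in\mathbb{Z}_n$, $\alpha\neq\beta+1$, where $E_{\alpha\beta}$ has $\mathbb{C}$ at each vertex $\gamma$ of the cyclic interval $[\alpha,\beta]=\{\alpha,\alpha+1,\dots,\beta\}$ and $0$ elsewhere, with identity maps $(E_{\alpha\beta})_\gamma\to(E_{\alpha\beta})_{\gamma+1}$ if $\gamma,\gamma+1\in[\alpha,\beta]$ and zero maps otherwise. For vertices $\alpha_1,\dots,\alpha_m$, write $[\alpha_1,\dots,\alpha_m]$ to mean that they lie in this order (not necessarily consecutively) when traveling along a single cycle starting from $\alpha_1$; the vertices are distinct unless it is explicitly stated that some may be equal. Then $M\leq_{ad}N$ if there is a finite sequence $M=M_0,\dots,M_u=N$ of $(n-1)$-nilpotent representations of dimension vector $(q^n)$ such that each $M_{j+1}$ can be obtained from $M_j$ by one of the following: *gluing*: for vertices $[\alpha,\beta,\gamma]$ (with $\beta$ possibly equal to $\alpha$), substitute $E_{\alpha,\beta}\oplus E_{\beta+1,\gamma}$ with $E_{\alpha,\gamma}$; *shift*: for vertices $[\alpha,\gamma,\beta,\delta]$, substitute $E_{\alpha,\beta}\oplus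 E_{\gamma,\delta}$ with $E_{\alpha,\delta}\oplus E_{\gamma,\beta}$. An element is maximal for one of these orders if no non-isomorphic element is larger.
   Formalization: In the shift move the vertices β and γ are allowed to be equal (intervals overlapping in one vertex); with all four distinct, E12+E23+E34+E41 for n=4, q=2 would be ≤_ad-maximal but not ≤_rk-maximal, so the stated equivalence would fail. *)

theory Defs
  imports
    "HOL-Analysis.Abstract_Topology"
    "HOL-Analysis.Derivative"
    "Jordan_Normal_Form.Gauss_Jordan_Elimination"
    "Jordan_Normal_Form.DL_Rank"
begin

section \<open>Representations of the equioriented cyclic quiver\<close>

text \<open>
  The vertices are the residues \<open>0, \<dots>, n - 1\<close> modulo \<open>n\<close>; arrow \<open>\<alpha>\<close> goes from \<open>\<alpha>\<close> to
  \<open>Suc \<alpha> mod n\<close>. Every vertex has an outgoing arrow, so the dimension at \<open>\<alpha>\<close> is the column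
  dimension of the matrix at \<open>\<alpha>\<close>.
\<close>

type_synonym rep = "nat \<Rightarrow> complex mat"

definition reps :: "nat \<Rightarrow> (nat \<Rightarrow> nat) \<Rightarrow> rep set" where
  "reps n d = (\<Pi>\<^sub>E \<alpha>\<in>{..<n}. carrier_mat (d (Suc \<alpha> mod n)) (d \<alpha>))"

definition mat_tuples :: "nat \<Rightarrow> nat \<Rightarrow> rep set" where
  "mat_tuples n q = reps n (\<lambda>_. q)"

text \<open>A path of the cyclic quiver is determined by its source \<open>\<alpha>\<close> and its length.\<close>

fun path_map :: "nat \<Rightarrow> rep \<Rightarrow> nat \<Rightarrow> nat \<Rightarrow> complex mat" where
  "path_map n M \<alpha> 0 = 1\<^sub>m (dim_col (M \<alpha>))"
| "path_map n M \<alpha> (Suc l) = M ((\<alpha> + l) mod n) * path_map n M \<alpha> l"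

definition nilpotent_rep :: "nat \<Rightarrow> nat \<Rightarrow> rep \<Rightarrow> bool" where
  "nilpotent_rep n k M \<longleftrightarrow>
    (\<forall>\<alpha><n. \<forall>l\<ge>k. path_map n M \<alpha> l = 0\<^sub>m (dim_col (M ((\<alpha> + l) mod n))) (dim_col (M \<alpha>)))"

definition nil_reps :: "nat \<Rightarrow> nat \<Rightarrow> nat \<Rightarrow> rep set" where
  "nil_reps n q k = {M \<in> mat_tuples n q. nilpotent_rep n k M}"

definition rep_iso :: "nat \<Rightarrow> rep \<Rightarrow> rep \<Rightarrow> bool" where
  "rep_iso n M N \<longleftrightarrow>
    (\<exists>g. (\<forall>\<alpha><n. g \<alpha> \<in> carrier_mat (dim_col (N \<alpha>)) (dim_col (M \<alpha>)) \<and> invertible_mat (g \<alpha>)) \<and>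
         (\<forall>\<alpha><n. g (Suc \<alpha> mod n) * M \<alpha> = N \<alpha> * g \<alpha>))"

definition rep_sum :: "nat \<Rightarrow> rep \<Rightarrow> rep \<Rightarrow> rep" where
  "rep_sum n M N = (\<lambda>\<alpha>\<in>{..<n}.
     four_block_mat (M \<alpha>) (0\<^sub>m (dim_row (M \<alpha>)) (dim_col (N \<alpha>)))
                    (0\<^sub>m (dim_row (N \<alpha>)) (dim_col (M \<alpha>))) (N \<alpha>))"

definition GL_tuples :: "nat \<Rightarrow> nat \<Rightarrow> rep set" where
  "GL_tuples n q = (\<Pi>\<^sub>E \<alpha>\<in>{..<n}. {g \<in> carrier_mat q q. invertible_mat g})"

definition GL_act :: "nat \<Rightarrow> rep \<Rightarrow> rep \<Rightarrow> rep" where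
  "GL_act n g M = (\<lambda>\<alpha>\<in>{..<n}. g (Suc \<alpha> mod n) * M \<alpha> * the (mat_inverse (g \<alpha>)))"

definition GL_orbit :: "nat \<Rightarrow> nat \<Rightarrow> rep \<Rightarrow> rep set" where
  "GL_orbit n q M = (\<lambda>g. GL_act n g M) ` GL_tuples n q"


section \<open>The polynomial and its singular locus\<close>

definition mat_trace :: "complex mat \<Rightarrow> complex" where
  "mat_trace A = (\<Sum>i<dim_row A. A $$ (i, i))"

text \<open>The fold computes \<open>X (n - 1) * \<dots> * X 0\<close>.\<close>

definition IMM :: "nat \<Rightarrow> nat \<Rightarrow> rep \<Rightarrow> complex" where
  "IMM n q X = mat_trace (fold (\<lambda>\<alpha> A. X \<alpha> * A) [0..<n] (1\<^sub>m q))"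

definition partial_deriv :: "nat \<Rightarrow> nat \<Rightarrow> nat \<Rightarrow> (rep \<Rightarrow> complex) \<Rightarrow> rep \<Rightarrow> complex" where
  "partial_deriv \<alpha> i j f X =
     deriv (\<lambda>t. f (X(\<alpha> := update_mat (X \<alpha>) (i, j) t))) (X \<alpha> $$ (i, j))"

definition Sing :: "nat \<Rightarrow> nat \<Rightarrow> rep set" where
  "Sing n q = {X \<in> mat_tuples n q. \<forall>\<alpha><n. \<forall>i<q. \<forall>j<q. partial_deriv \<alpha> i j (IMM n q) X = 0}"


section \<open>The Zariski topology\<close>

inductive_set poly_funs :: "nat \<Rightarrow> nat \<Rightarrow> (rep \<Rightarrow> complex) set" for n q where
  const: "(\<lambda>_. c) \<in> poly_funs n q"
| coord: "\<alpha> < n \<Longrightarrow> i < q \<Longrightarrow> j < q \<Longrightarrow> (\<lambda>X. X \<alpha> $$ (i, j)) \<in> poly_funs n q"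
| add: "f \<in> poly_funs n q \<Longrightarrow> g \<in> poly_funs n q \<Longrightarrow> (\<lambda>X. f X + g X) \<in> poly_funs n q"
| mult: "f \<in> poly_funs n q \<Longrightarrow> g \<in> poly_funs n q \<Longrightarrow> (\<lambda>X. f X * g X) \<in> poly_funs n q"

definition zero_locus :: "nat \<Rightarrow> nat \<Rightarrow> (rep \<Rightarrow> complex) set \<Rightarrow> rep set" where
  "zero_locus n q F = {X \<in> mat_tuples n q. \<forall>f\<in>F. f X = 0}"

definition zariski :: "nat \<Rightarrow> nat \<Rightarrow> rep topology" where
  "zariski n q = topology (\<lambda>U. \<exists>F\<subseteq>poly_funs n q. U = mat_tuples n q - zero_locus n q F)"

lemma istopology_zariski:
  "istopology (\<lambda>U. \<exists>F\<subseteq>poly_funs n q. U = mat_tuples n q - zero_locus n q F)"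
  unfolding istopology_def
proof (intro conjI allI impI)
  fix S T
  assume "\<exists>F\<subseteq>poly_funs n q. S = mat_tuples n q - zero_locus n q F"
    and "\<exists>F\<subseteq>poly_funs n q. T = mat_tuples n q - zero_locus n q F"
  then obtain F G where F: "F \<subseteq> poly_funs n q" "S = mat_tuples n q - zero_locus n q F"
    and G: "G \<subseteq> poly_funs n q" "T = mat_tuples n q - zero_locus n q G"
    by blast
  let ?H = "{\<lambda>X. f X * g X | f g. f \<in> F \<and> g \<in> G}"
  have "?H \<subseteq> poly_funs n q"
    using F(1) G(1) by (auto intro: poly_funs.mult)
  moreover have "S \<inter> T = mat_tuples n q - zero_locus n q ?H"
    unfolding F(2) G(2) zero_locus_def by fastforce
  ultimately show "\<exists>H\<subseteq>poly_funs n q. S \<inter> T = mat_tuples n q - zero_locus n q H"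
    by blast
next
  fix K
  assume "\<forall>U\<in>K. \<exists>F\<subseteq>poly_funs n q. U = mat_tuples n q - zero_locus n q F"
  then obtain F where F: "\<And>U. U \<in> K \<Longrightarrow> F U \<subseteq> poly_funs n q"
    "\<And>U. U \<in> K \<Longrightarrow> U = mat_tuples n q - zero_locus n q (F U)"
    by metis
  have "X \<in> \<Union>K \<longleftrightarrow> X \<in> mat_tuples n q - zero_locus n q (\<Union>(F ` K))" for X
  proof -
    have "X \<in> \<Union>K \<longleftrightarrow> (\<exists>U\<in>K. X \<in> mat_tuples n q - zero_locus n q (F U))"
      using F(2) by blast
    also have "\<dots> \<longleftrightarrow> X \<in> mat_tuples n q - zero_locus n q (\<Union>(F ` K))"
      by (auto simp: zero_locus_def)
    finally show ?thesis .
  qed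
  then have "\<Union>K = mat_tuples n q - zero_locus n q (\<Union>(F ` K))"
    by blast
  moreover have "\<Union>(F ` K) \<subseteq> poly_funs n q"
    using F(1) by blast
  ultimately show "\<exists>H\<subseteq>poly_funs n q. \<Union>K = mat_tuples n q - zero_locus n q H"
    by blast
qed

lemma openin_zariski:
  "openin (zariski n q) U \<longleftrightarrow> (\<exists>F\<subseteq>poly_funs n q. U = mat_tuples n q - zero_locus n q F)"
  unfolding zariski_def by (simp add: topology_inverse'[OF istopology_zariski])

lemma topspace_zariski: "topspace (zariski n q) = mat_tuples n q"
proof
  show "topspace (zariski n q) \<subseteq> mat_tuples n q"
    unfolding topspace_def openin_zariski by blast
  have "mat_tuples n q = mat_tuples n q - zero_locus n q {\<lambda>_. 1}"
    by (auto simp: zero_locus_def)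
  then have "openin (zariski n q) (mat_tuples n q)"
    unfolding openin_zariski using poly_funs.const[of 1 n q] by blast
  then show "mat_tuples n q \<subseteq> topspace (zariski n q)"
    by (rule openin_subset)
qed

lemma closedin_zariski:
  "closedin (zariski n q) Z \<longleftrightarrow> (\<exists>F\<subseteq>poly_funs n q. Z = zero_locus n q F)"
proof -
  have sub: "zero_locus n q F \<subseteq> mat_tuples n q" for F
    by (auto simp: zero_locus_def)
  show ?thesis
    unfolding closedin_def openin_zariski topspace_zariski
    using sub by (metis double_diff order_refl)
qed

definition irreducible_in :: "'a topology \<Rightarrow> 'a set \<Rightarrow> bool" where
  "irreducible_in T S \<longleftrightarrow> S \<subseteq> topspace T \<and> S \<noteq> {} \<and>
    (\<forall>A B. closedin T A \<and> closedin T B \<and> S \<subseteq> A \<union> B \<longrightarrow> S \<subseteq> A \<or> S \<subseteq> B)"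

definition irreducible_components :: "'a topology \<Rightarrow> 'a set \<Rightarrow> 'a set set" where
  "irreducible_components T Z =
    {C. C \<subseteq> Z \<and> irreducible_in T C \<and>
        (\<forall>D. D \<subseteq> Z \<and> irreducible_in T D \<and> C \<subseteq> D \<longrightarrow> D = C)}"

definition orbit_closure :: "nat \<Rightarrow> nat \<Rightarrow> rep \<Rightarrow> rep set" where
  "orbit_closure n q M = zariski n q closure_of GL_orbit n q M"


section \<open>The three orders\<close>

definition deg_le :: "nat \<Rightarrow> nat \<Rightarrow> rep \<Rightarrow> rep \<Rightarrow> bool" where
  "deg_le n q N M \<longleftrightarrow> N \<in> orbit_closure n q M"

definition rk_le :: "nat \<Rightarrow> rep \<Rightarrow> rep \<Rightarrow> bool" where
  "rk_le n N M \<longleftrightarrow> (\<forall>\<alpha><n. \<forall>l.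
     vec_space.rank (dim_row (path_map n N \<alpha> l)) (path_map n N \<alpha> l)
       \<le> vec_space.rank (dim_row (path_map n M \<alpha> l)) (path_map n M \<alpha> l))"

definition cyc_interval :: "nat \<Rightarrow> nat \<Rightarrow> nat \<Rightarrow> nat set" where
  "cyc_interval n \<alpha> \<beta> = {(\<alpha> + i) mod n | i. i \<le> (\<beta> + n - \<alpha>) mod n}"

text \<open>
  Only meant for vertices \<open>\<alpha>\<close>, \<open>\<beta>\<close> with \<open>\<alpha> \<noteq> Suc \<beta> mod n\<close>. All entries are 1: the matrix at
  \<open>\<gamma>\<close> has an entry only if both \<open>\<gamma>\<close> and its successor lie in the interval.
\<close>

definition interval_rep :: "nat \<Rightarrow> nat \<Rightarrow> nat \<Rightarrow> rep" where
  "interval_rep n \<alpha> \<beta> =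
    (let d = (\<lambda>\<gamma>. if \<gamma> \<in> cyc_interval n \<alpha> \<beta> then 1 else 0)
     in (\<lambda>\<gamma>\<in>{..<n}. mat (d (Suc \<gamma> mod n)) (d \<gamma>) (\<lambda>_. 1)))"

text \<open>
  Distinct vertices met in the order of the list when travelling once around the cycle from the
  first one.
\<close>

definition cyc_ordered :: "nat \<Rightarrow> nat list \<Rightarrow> bool" where
  "cyc_ordered n vs \<longleftrightarrow> set vs \<subseteq> {..<n} \<and>
     sorted_wrt (<) (map (\<lambda>v. (v + n - hd vs) mod n) vs)"

definition gluing_step :: "nat \<Rightarrow> rep \<Rightarrow> rep \<Rightarrow> bool" where
  "gluing_step n M N \<longleftrightarrow> (\<exists>\<alpha> \<beta> \<gamma> d. \<exists>R\<in>reps n d.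
     (cyc_ordered n [\<alpha>, \<beta>, \<gamma>] \<or> \<beta> = \<alpha> \<and> cyc_ordered n [\<alpha>, \<gamma>]) \<and> \<alpha> \<noteq> Suc \<gamma> mod n \<and>
     rep_iso n M
       (rep_sum n (rep_sum n (interval_rep n \<alpha> \<beta>) (interval_rep n (Suc \<beta> mod n) \<gamma>)) R) \<and>
     rep_iso n N (rep_sum n (interval_rep n \<alpha> \<gamma>) R))"

text \<open>
  In a shift \<open>\<beta>\<close> may equal \<open>\<gamma>\<close>, i.e. the two intervals may overlap in a single vertex. If
  it were excluded, the order generated by gluings and shifts would have fewer relations
  than the rank order and more maximal elements: for \<open>n = 4\<close> and \<open>q = 2\<close>, the sum of the four intervals
  \<open>[\<alpha>, \<alpha> + 1]\<close> would then be maximal, although replacing \<open>[1, 2]\<close> and \<open>[2, 3]\<close> by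
  \<open>[1, 3]\<close> and \<open>[2, 2]\<close> strictly increases the ranks.
\<close>

definition shift_step :: "nat \<Rightarrow> rep \<Rightarrow> rep \<Rightarrow> bool" where
  "shift_step n M N \<longleftrightarrow> (\<exists>\<alpha> \<beta> \<gamma> \<delta> d. \<exists>R\<in>reps n d.
     (cyc_ordered n [\<alpha>, \<gamma>, \<beta>, \<delta>] \<or> \<beta> = \<gamma> \<and> cyc_ordered n [\<alpha>, \<gamma>, \<delta>]) \<and> \<alpha> \<noteq> Suc \<delta> mod n \<and>
     rep_iso n M (rep_sum n (rep_sum n (interval_rep n \<alpha> \<beta>) (interval_rep n \<gamma> \<delta>)) R) \<and>
     rep_iso n N (rep_sum n (rep_sum n (interval_rep n \<alpha> \<delta>) (interval_rep n \<gamma> \<beta>)) R))"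

definition ad_le :: "nat \<Rightarrow> nat \<Rightarrow> rep \<Rightarrow> rep \<Rightarrow> bool" where
  "ad_le n q M N \<longleftrightarrow> (\<exists>u (L :: nat \<Rightarrow> rep).
     rep_iso n M (L 0) \<and> rep_iso n (L u) N \<and>
     (\<forall>j\<le>u. L j \<in> nil_reps n q (n - 1)) \<and>
     (\<forall>j<u. gluing_step n (L j) (L (Suc j)) \<or> shift_step n (L j) (L (Suc j))))"

text \<open>The maximal \<open>(n - 1)\<close>-nilpotent representations; \<open>r M N\<close> says that \<open>N\<close> is the larger one.\<close>

definition maximal_reps :: "nat \<Rightarrow> nat \<Rightarrow> (rep \<Rightarrow> rep \<Rightarrow> bool) \<Rightarrow> rep set" where
  "maximal_reps n q r =
    {M \<in> nil_reps n q (n - 1). \<forall>N\<in>nil_reps n q (n - 1). r M N \<longrightarrow> rep_iso n M N}"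

end

theory Submission
  imports Defs
begin

text \<open>
  By cyclicity of the trace, the partial derivatives of \<open>IMM\<close> are the entries of the compositions
  along the paths of length \<open>n - 1\<close>, so the singular locus consists of the \<open>(n - 1)\<close>-nilpotent
  representations. Such a representation is a direct sum of intervals (split off a longest nonzero
  path), and the ranks of the path maps determine the multiplicities of the intervals by taking
  second differences. Hence there are finitely many orbits, all irreducible, and the components are
  the maximal orbit closures.

  A gluing or shift is a degeneration, since the intervals involved sit in a short exact sequence
  that can be scaled to a split one, and ranks are semicontinuous; so rank-maximal implies
  degeneration-maximal, which implies maximal for gluings and shifts. For the way back let \<open>D\<close> be
  the difference of the ranks of two representations \<open>M \<le> N\<close>, and let \<open>[i, j]\<close> be a shortest path
  with \<open>D(i, j) > 0\<close>. Then \<open>M\<close> contains intervals \<open>[a, j - 1]\<close> and \<open>[i + 1, b]\<close>; take \<open>a\<close> maximal and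
  \<open>b\<close> minimal. If these two cannot be moved because their union is too long, then with
  \<open>b' = a + n - 1\<close> either \<open>M\<close> contains an interval that can be moved together with \<open>[a, j - 1]\<close>, or
  inclusion-exclusion on the rectangle with corners \<open>(i, j)\<close> and \<open>(a, b')\<close> gives
  \<open>D(i, j) \<ge> D(a, j) + D(i, b') \<ge> 2 D(i, j)\<close>, which is absurd.
\<close>

section \<open>Rank as the size of a factorisation\<close>

text \<open>The obstacle is the length bound. On a linear quiver the pair [a, j - 1], [i + 1, b]
  could always be moved; on the cycle the new interval [a, b] must have fewer than n vertices, since
  otherwise nilpotency is lost. What helps in the bad case is that every path of length at least n -
  1 has rank zero in both representations, so D vanishes at the far corner (a, b') of the rectangle.
  The two bounds behind the factor 2 come from the choice of the path and of a and b. Since D(i, j -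
  1) = 0, the positive value D(i, j) is due to the intervals ending at j - 1. All those of M start
  at or before a, so moving the start of the path from i back to a keeps all of them in M, while N
  may lose some; therefore D(a, j) >= D(i, j). The bound D(i, b') >= D(i, j) is the mirror image,
  with the intervals starting at i + 1. Natural numbers do not subtract well, so both bounds appear
  as inequalities between sums.

  Irreducibility of orbits comes from joining two group elements by a line, and antisymmetry of the
  degeneration order from that of the rank order.\<close>

lemma mult_mat_assoc_dims:
  fixes A B C :: "'a :: semiring_0 mat"
  assumes "dim_col A = dim_row B" "dim_col B = dim_row C"
  shows "A * B * C = A * (B * C)"
  using assms by (intro assoc_mult_mat) auto

lemma mult_mat_assoc4:
  fixes A B C D :: "'a :: semiring_0 mat"
  assumes "A \<in> carrier_mat a b" "B \<in> carrier_mat b c" "C \<in> carrier_mat c d" "D \<in> carrier_mat d e"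
  shows "(A * B) * (C * D) = A * (B * C) * D"
  using assms by (auto simp: mult_mat_assoc_dims)

text \<open>Zero rows are appended to make \<open>C\<close> square. The transpose of the result
  kills the unit vector at index \<open>r\<close>, so the determinant is zero and a kernel vector
  exists.\<close>

lemma exists_kernel_vec:
  fixes C :: "'a :: field mat"
  assumes C: "C \<in> carrier_mat r k" and rk: "r < k"
  shows "\<exists>v\<in>carrier_vec k. v \<noteq> 0\<^sub>v k \<and> C *\<^sub>v v = 0\<^sub>v r"
proof -
  define C' where "C' = mat k k (\<lambda>(i,j). if i < r then C $$ (i,j) else 0)"
  have C': "C' \<in> carrier_mat k k" by (simp add: C'_def)
  have "transpose_mat C' *\<^sub>v unit_vec k r = 0\<^sub>v k"
    using rk by (intro eq_vecI) (auto simp: C'_def)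
  moreover have "unit_vec k r \<noteq> (0\<^sub>v k :: 'a vec)"
    using rk by (metis index_unit_vec(2) index_zero_vec(1) zero_neq_one)
  ultimately have "det (transpose_mat C') = 0"
    using det_0_iff_vec_prod_zero_field[of "transpose_mat C'" k] C'
    by (meson transpose_carrier_mat unit_vec_carrier)
  then have "det C' = 0" using det_transpose[OF C'] by simp
  then obtain v where v: "v \<in> carrier_vec k" "v \<noteq> 0\<^sub>v k" "C' *\<^sub>v v = 0\<^sub>v k"
    using det_0_iff_vec_prod_zero_field[OF C'] by auto
  have "(C *\<^sub>v v) $ i = 0" if "i < r" for i
  proof -
    have "row C' i = row C i" using that rk C by (intro eq_vecI) (auto simp: C'_def)
    then have "(C *\<^sub>v v) $ i = (C' *\<^sub>v v) $ i" using that rk C C' by simp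
    then show ?thesis using v(3) that rk by simp
  qed
  then have "C *\<^sub>v v = 0\<^sub>v r" using C by (intro eq_vecI) auto
  then show ?thesis using v by blast
qed

lemma det_mult_low_rank:
  fixes B C :: "'a :: field mat"
  assumes B: "B \<in> carrier_mat k r" and C: "C \<in> carrier_mat r k" and "r < k"
  shows "det (B * C) = 0"
proof -
  obtain v where v: "v \<in> carrier_vec k" "v \<noteq> 0\<^sub>v k" "C *\<^sub>v v = 0\<^sub>v r"
    using exists_kernel_vec[OF C \<open>r < k\<close>] by blast
  have "(B * C) *\<^sub>v v = B *\<^sub>v (C *\<^sub>v v)" using B C v(1) by simp
  also have "\<dots> = 0\<^sub>v k" using B v(3) by auto
  finally have "(B * C) *\<^sub>v v = 0\<^sub>v k" .
  then show ?thesis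
    using det_0_iff_vec_prod_zero_field[of "B * C" k] B C v by auto
qed

text \<open>Each column of \<open>B * C\<close> is \<open>B\<close> applied to a coefficient vector
  of length \<open>r\<close>. More than \<open>r\<close> such vectors satisfy a linear relation, and
  \<open>B\<close> carries it over to the columns, which therefore cannot be independent.\<close>

lemma rank_le_factor:
  fixes B C :: "'a :: field mat"
  assumes B: "B \<in> carrier_mat m r" and C: "C \<in> carrier_mat r k"
  shows "vec_space.rank m (B * C) \<le> r"
proof (rule ccontr)
  interpret vec_space "TYPE('a)" m .
  let ?A = "B * C"
  have A: "?A \<in> carrier_mat m k" using B C by simp
  assume "\<not> ?thesis"
  then have r: "r < rank ?A" by simp
  obtain S where S: "maximal S (\<lambda>T. T \<subseteq> set (cols ?A) \<and> lin_indpt T)"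
    using maximal_exists[of "(\<lambda>T. T \<subseteq> set (cols ?A) \<and> lin_indpt T)" "card (set (cols ?A))" "{}"]
    by (meson List.finite_set card_mono empty_iff empty_subsetI finite_lin_indpt2 rev_finite_subset)
  then have Ssub: "S \<subseteq> set (cols ?A)" and indpt: "lin_indpt S" by (auto simp: maximal_def)
  have cS: "rank ?A = card S" using rank_card_indpt[OF A S] .
  obtain ws where ws: "set ws = S" "distinct ws"
    using finite_distinct_list[of S] finite_subset[OF Ssub] by blast
  have "\<exists>c\<in>carrier_vec r. w = B *\<^sub>v c" if "w \<in> S" for w
  proof -
    obtain j where j: "j < k" "w = col ?A j"
      using Ssub \<open>w \<in> S\<close> C by (auto simp: cols_def)
    then show ?thesis using B C by (auto intro!: bexI[of _ "col C j"])
  qed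
  then obtain c where c: "\<And>w. w \<in> S \<Longrightarrow> c w \<in> carrier_vec r" "\<And>w. w \<in> S \<Longrightarrow> w = B *\<^sub>v c w"
    by metis
  define C' where "C' = mat_of_cols r (map c ws)"
  have lw: "length ws = rank ?A" using ws cS distinct_card by metis
  have C': "C' \<in> carrier_mat r (length ws)" unfolding C'_def carrier_mat_def by simp
  obtain v where v: "v \<in> carrier_vec (length ws)" "v \<noteq> 0\<^sub>v (length ws)" "C' *\<^sub>v v = 0\<^sub>v r"
    using exists_kernel_vec[OF C'] r lw by auto
  have "mat_of_cols m ws = B * C'"
  proof (rule mat_col_eqI)
    fix j assume "j < dim_col (B * C')"
    then have j: "j < length ws" using C' by simp
    then have "ws ! j \<in> S" using ws by auto
    then have "ws ! j = B *\<^sub>v c (ws ! j)" "c (ws ! j) \<in> carrier_vec r" using c by blast+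
    moreover have "ws ! j \<in> carrier_vec m"
      using \<open>ws ! j \<in> S\<close> Ssub A cols_dim by fastforce
    moreover have "col C' j = c (ws ! j)" using j calculation(2) by (simp add: C'_def)
    moreover have "col (B * C') j = B *\<^sub>v col C' j" by (rule col_mult2[OF B C' j])
    ultimately show "col (mat_of_cols m ws) j = col (B * C') j"
      using j by (metis col_mat_of_cols)
  qed (use B C' in auto)
  then have "mat_of_cols m ws *\<^sub>v v = B *\<^sub>v (C' *\<^sub>v v)" using B C' v by simp
  also have "\<dots> = 0\<^sub>v m" using B v by auto
  finally have 0: "mat_of_cols m ws *\<^sub>v v = 0\<^sub>v m" .
  have "set ws \<subseteq> carrier_vec m" using ws Ssub A cols_dim by fastforce
  then have cols: "cols (mat_of_cols m ws) = ws" by simp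
  have "lin_dep (set (cols (mat_of_cols m ws)))"
    by (rule lin_depI[OF _ v(1,2) 0]) (use cols ws in auto)
  then show False using cols ws indpt by simp
qed

text \<open>The columns of \<open>B\<close> form a maximal independent set of columns of
  \<open>A\<close>; the columns of \<open>C\<close> hold the coefficients of all columns of
  \<open>A\<close> in this basis of the column space.\<close>

lemma rank_factorisation:
  fixes A :: "'a :: field mat"
  assumes A: "A \<in> carrier_mat m k"
  shows "\<exists>B C. B \<in> carrier_mat m (vec_space.rank m A) \<and> C \<in> carrier_mat (vec_space.rank m A) k
    \<and> A = B * C"
proof -
  interpret vec_space "TYPE('a)" m .
  obtain S where S: "maximal S (\<lambda>T. T \<subseteq> set (cols A) \<and> lin_indpt T)"
    using maximal_exists[of "(\<lambda>T. T \<subseteq> set (cols A) \<and> lin_indpt T)" "card (set (cols A))" "{}"]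
    by (meson List.finite_set card_mono empty_iff empty_subsetI finite_lin_indpt2 rev_finite_subset)
  then have Ssub: "S \<subseteq> set (cols A)" and indpt: "lin_indpt S" by (auto simp: maximal_def)
  have finS: "finite S" using Ssub finite_subset by blast
  have cA: "set (cols A) \<subseteq> carrier_vec m" using A cols_dim by blast
  obtain ws where ws: "set ws = S" "distinct ws"
    using finite_distinct_list[OF finS] by blast
  have lw: "length ws = rank A" using ws rank_card_indpt[OF A S] distinct_card by metis
  define B where "B = mat_of_cols m ws"
  have B: "B \<in> carrier_mat m (rank A)" by (simp add: B_def lw[symmetric])
  have colsB: "cols B = ws" using ws cA Ssub by (auto simp: B_def)
  have "\<exists>c\<in>carrier_vec (rank A). a = B *\<^sub>v c" if a: "a \<in> set (cols A)" for a
  proof -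
    have "a \<in> span S"
    proof (cases "a \<in> S")
      case True
      then show ?thesis using Ssub cA in_own_span by blast
    next
      case False
      then have "lin_dep (S \<union> {a})"
        using S a Ssub unfolding maximal_def by (metis Un_insert_right insert_subset subset_insertI
            sup_bot.right_neutral insertI1)
      then show ?thesis
        using lin_dep_iff_in_span[of S a] indpt Ssub cA a False by (metis subset_iff subset_trans)
    qed
    then obtain f where "a = lincomb f S"
      using finite_in_span[OF finS, of a] Ssub cA by auto
    moreover have "B *\<^sub>v vec (rank A) (\<lambda>i. f (col B i)) = lincomb f S"
      using mat_mult_eq_lincomb[OF B, of f] colsB ws by simp
    ultimately show ?thesis by (metis vec_carrier)
  qed
  then obtain c where c: "\<And>a. a \<in> set (cols A) \<Longrightarrow> c a \<in> carrier_vec (rank A)"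
    "\<And>a. a \<in> set (cols A) \<Longrightarrow> a = B *\<^sub>v c a"
    by metis
  define C where "C = mat_of_cols (rank A) (map c (cols A))"
  have C: "C \<in> carrier_mat (rank A) k" using A unfolding C_def by auto
  have "A = B * C"
  proof (rule mat_col_eqI)
    fix j assume "j < dim_col (B * C)"
    then have j: "j < k" using C by simp
    then have "col A j \<in> set (cols A)" using A by (auto simp: cols_def)
    moreover from this have "col C j = c (col A j)" using c(1) j A by (simp add: C_def)
    moreover have "col (B * C) j = B *\<^sub>v col C j" by (rule col_mult2[OF B C j])
    ultimately show "col A j = col (B * C) j"
      using c(2) by metis
  qed (use A B C in auto)
  then show ?thesis using B C by blast
qed

text \<open>The factorisation bounds the rank from above, the one-sided compression to an identity
  matrix bounds it from below. In this form ranks pass to isomorphic representations and to direct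
  sums by multiplying or stacking the witnesses, and the second half turns a lower bound into a
  nonvanishing determinant, which is a polynomial condition.\<close>

definition has_rank :: "'a :: field mat \<Rightarrow> nat \<Rightarrow> bool" where
  "has_rank A r \<longleftrightarrow>
    (\<exists>B C. B \<in> carrier_mat (dim_row A) r \<and> C \<in> carrier_mat r (dim_col A) \<and> A = B * C) \<and>
    (\<exists>P Q. P \<in> carrier_mat r (dim_row A) \<and> Q \<in> carrier_mat (dim_col A) r \<and> P * A * Q = 1\<^sub>m r)"

lemma has_rank_rank:
  fixes A :: "'a :: field mat"
  assumes "has_rank A r"
  shows "vec_space.rank (dim_row A) A = r"
proof (rule antisym)
  let ?k = "vec_space.rank (dim_row A) A"
  show "?k \<le> r" using assms rank_le_factor unfolding has_rank_def by metis
  obtain P Q where PQ: "P \<in> carrier_mat r (dim_row A)" "Q \<in> carrier_mat (dim_col A) r" "P * A * Q = 1\<^sub>m r"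
    using assms unfolding has_rank_def by blast
  obtain B C where BC: "B \<in> carrier_mat (dim_row A) ?k" "C \<in> carrier_mat ?k (dim_col A)" "A = B * C"
    using rank_factorisation[OF carrier_matI[OF refl refl], of A] by blast
  have "(P * B) * (C * Q) = P * (B * C) * Q"
    by (rule mult_mat_assoc4[OF PQ(1) BC(1,2) PQ(2)])
  also have "\<dots> = 1\<^sub>m r" using BC(3) PQ(3) by simp
  finally have "det ((P * B) * (C * Q)) = 1" by simp
  then show "r \<le> ?k"
    using det_mult_low_rank[of "P * B" r ?k "C * Q"] PQ(1,2) BC(1,2)
    by (metis mult_carrier_mat not_le_imp_less zero_neq_one)
qed

text \<open>If \<open>k\<close> exceeded \<open>r\<close>, then \<open>P * A * Q\<close> would
  factor through a space of dimension less than \<open>k\<close> and be singular. This is the half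
  of semicontinuity that is applied at a point of the orbit.\<close>

lemma has_rank_det_bound:
  fixes A :: "'a :: field mat"
  assumes "has_rank A r" and P: "P \<in> carrier_mat k (dim_row A)" and Q: "Q \<in> carrier_mat (dim_col A) k"
    and "det (P * A * Q) \<noteq> 0"
  shows "k \<le> r"
proof (rule ccontr)
  obtain B C where BC: "B \<in> carrier_mat (dim_row A) r" "C \<in> carrier_mat r (dim_col A)" "A = B * C"
    using assms(1) unfolding has_rank_def by blast
  have eq: "(P * B) * (C * Q) = P * (B * C) * Q"
    by (rule mult_mat_assoc4[OF P BC(1,2) Q])
  assume "\<not> k \<le> r"
  then have "det ((P * B) * (C * Q)) = 0"
    using det_mult_low_rank[of "P * B" k r "C * Q"] P Q BC(1,2) by (metis mult_carrier_mat not_le_imp_less)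
  then show False using assms(4) eq BC(3) by simp
qed

text \<open>The factorisation of \<open>A\<close> is multiplied by \<open>U\<close> and
  \<open>V\<close>; the compressing pair is multiplied by \<open>U'\<close> and \<open>V'\<close>,
  which undo the change of bases.\<close>

lemma has_rank_equiv:
  fixes A :: "'a :: field mat"
  assumes h: "has_rank A r" and A: "A \<in> carrier_mat m k" and B: "B \<in> carrier_mat m' k'"
    and U: "U \<in> carrier_mat m' m" "U' \<in> carrier_mat m m'" "U' * U = 1\<^sub>m m"
    and V: "V \<in> carrier_mat k k'" "V' \<in> carrier_mat k' k" "V * V' = 1\<^sub>m k"
    and eq: "B = U * A * V"
  shows "has_rank B r"
proof -
  obtain P Q where PQ: "P \<in> carrier_mat r m" "Q \<in> carrier_mat k r" "P * A * Q = 1\<^sub>m r"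
    using h unfolding has_rank_def carrier_matD[OF A] by blast
  obtain C D where CD: "C \<in> carrier_mat m r" "D \<in> carrier_mat r k" "A = C * D"
    using h unfolding has_rank_def carrier_matD[OF A] by blast
  have "B = (U * C) * (D * V)"
    unfolding eq CD(3) using CD(1,2) U(1) V(1) by (auto simp: mult_mat_assoc_dims)
  moreover have "(P * U') * B * (V' * Q) = 1\<^sub>m r"
  proof -
    have "(P * U') * B * (V' * Q) = P * (U' * U) * A * (V * V') * Q"
      unfolding eq using PQ(1,2) U(1,2) V(1,2) A by (auto simp: mult_mat_assoc_dims)
    also have "\<dots> = 1\<^sub>m r" unfolding U(3) V(3) right_mult_one_mat[OF PQ(1)] using PQ A by (metis mult_carrier_mat right_mult_one_mat)
    finally show ?thesis .
  qed
  moreover have "U * C \<in> carrier_mat m' r" "D * V \<in> carrier_mat r k'"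
    "P * U' \<in> carrier_mat r m'" "V' * Q \<in> carrier_mat k' r"
    using U(1,2) V(1,2) PQ(1,2) CD(1,2) by auto
  ultimately show ?thesis unfolding has_rank_def carrier_matD[OF B] by blast
qed

section \<open>Block diagonal matrices\<close>

abbreviation block_diag :: "'a :: zero mat \<Rightarrow> 'a mat \<Rightarrow> 'a mat" where
  "block_diag A D \<equiv> four_block_mat A (0\<^sub>m (dim_row A) (dim_col D)) (0\<^sub>m (dim_row D) (dim_col A)) D"

lemma block_diag_mult:
  fixes A D A' D' :: "'a :: semiring_1 mat"
  assumes "A \<in> carrier_mat a b" "D \<in> carrier_mat c d" "A' \<in> carrier_mat b e" "D' \<in> carrier_mat d f"
  shows "block_diag A D * block_diag A' D' = block_diag (A * A') (D * D')"
  using assms by (subst mult_four_block_mat[of _ a b _ d _ c _ _ e _ f]) auto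

lemma has_rank_block_diag:
  fixes A D :: "'a :: field mat"
  assumes "has_rank A r" "has_rank D s"
  shows "has_rank (block_diag A D) (r + s)"
proof -
  obtain B C P Q where A: "B \<in> carrier_mat (dim_row A) r" "C \<in> carrier_mat r (dim_col A)" "A = B * C"
    "P \<in> carrier_mat r (dim_row A)" "Q \<in> carrier_mat (dim_col A) r" "P * A * Q = 1\<^sub>m r"
    using assms unfolding has_rank_def by blast
  obtain B' C' P' Q' where D: "B' \<in> carrier_mat (dim_row D) s" "C' \<in> carrier_mat s (dim_col D)" "D = B' * C'"
    "P' \<in> carrier_mat s (dim_row D)" "Q' \<in> carrier_mat (dim_col D) s" "P' * D * Q' = 1\<^sub>m s"
    using assms unfolding has_rank_def by blast
  have "block_diag A D = block_diag B B' * block_diag C C'"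
    using block_diag_mult[OF A(1) D(1) A(2) D(2)] A(3) D(3) by simp
  moreover have "block_diag P P' * block_diag A D * block_diag Q Q' = 1\<^sub>m (r + s)"
  proof -
    have "block_diag P P' * block_diag A D = block_diag (P * A) (P' * D)"
      by (rule block_diag_mult[OF A(4) D(4)]) auto
    moreover have "block_diag (P * A) (P' * D) * block_diag Q Q' = block_diag (P * A * Q) (P' * D * Q')"
      using A(4,5) D(4,5) by (intro block_diag_mult) auto
    ultimately show ?thesis using A(6) D(6) by simp
  qed
  moreover have "block_diag B B' \<in> carrier_mat (dim_row A + dim_row D) (r + s)"
    "block_diag C C' \<in> carrier_mat (r + s) (dim_col A + dim_col D)"
    "block_diag P P' \<in> carrier_mat (r + s) (dim_row A + dim_row D)"
    "block_diag Q Q' \<in> carrier_mat (dim_col A + dim_col D) (r + s)"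
    using A(1,2,4,5) D(1,2,4,5) by auto
  ultimately show ?thesis unfolding has_rank_def index_mat_four_block(2,3) by blast
qed

section \<open>Isomorphisms and direct sums\<close>

text \<open>Unlike \<open>reps\<close>, this says nothing about values outside the vertex set and
  fixes no dimension vector in advance, so it also applies to summands that are not extensional
  functions, such as the complement of a split interval.\<close>

definition wf_rep :: "nat \<Rightarrow> rep \<Rightarrow> bool" where
  "wf_rep n M \<longleftrightarrow> (\<forall>\<gamma><n. dim_row (M \<gamma>) = dim_col (M (Suc \<gamma> mod n)))"

lemma wf_rep_carrier:
  "wf_rep n M \<Longrightarrow> \<gamma> < n \<Longrightarrow> M \<gamma> \<in> carrier_mat (dim_col (M (Suc \<gamma> mod n))) (dim_col (M \<gamma>))"
  by (intro carrier_matI) (auto simp: wf_rep_def)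

lemma Suc_mod_less: "\<gamma> < n \<Longrightarrow> Suc \<gamma> mod n < n"
  by simp

lemma mat_inverse_pair_dim_eq:
  fixes A B :: "'a :: field mat"
  assumes "A \<in> carrier_mat a b" "B \<in> carrier_mat b a" "A * B = 1\<^sub>m a" "B * A = 1\<^sub>m b"
  shows "a = b"
proof -
  have "a \<le> b" using det_mult_low_rank[OF assms(1,2)] assms(3) by (metis det_one not_le_imp_less zero_neq_one)
  moreover have "b \<le> a" using det_mult_low_rank[OF assms(2,1)] assms(4) by (metis det_one not_le_imp_less zero_neq_one)
  ultimately show ?thesis by simp
qed

text \<open>\<open>invertible_mat\<close> speaks of square matrices and hides the inverse. Here the
  inverse is part of the data, and equality of dimensions is a consequence of having it on both
  sides.\<close>

definition iso_pair :: "nat \<Rightarrow> rep \<Rightarrow> rep \<Rightarrow> rep \<Rightarrow> rep \<Rightarrow> bool" where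
  "iso_pair n M N g h \<longleftrightarrow> (\<forall>\<gamma><n.
     g \<gamma> \<in> carrier_mat (dim_col (N \<gamma>)) (dim_col (M \<gamma>)) \<and>
     h \<gamma> \<in> carrier_mat (dim_col (M \<gamma>)) (dim_col (N \<gamma>)) \<and>
     g \<gamma> * h \<gamma> = 1\<^sub>m (dim_col (N \<gamma>)) \<and> h \<gamma> * g \<gamma> = 1\<^sub>m (dim_col (M \<gamma>)) \<and>
     g (Suc \<gamma> mod n) * M \<gamma> = N \<gamma> * g \<gamma>)"

lemma iso_pairD:
  assumes "iso_pair n M N g h" "\<gamma> < n"
  shows "g \<gamma> \<in> carrier_mat (dim_col (N \<gamma>)) (dim_col (M \<gamma>))"
    and "h \<gamma> \<in> carrier_mat (dim_col (M \<gamma>)) (dim_col (N \<gamma>))"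
    and "g \<gamma> * h \<gamma> = 1\<^sub>m (dim_col (N \<gamma>))"
    and "h \<gamma> * g \<gamma> = 1\<^sub>m (dim_col (M \<gamma>))"
    and "g (Suc \<gamma> mod n) * M \<gamma> = N \<gamma> * g \<gamma>"
  using assms unfolding iso_pair_def by blast+

lemma iso_pairI:
  assumes "\<And>\<gamma>. \<gamma> < n \<Longrightarrow> g \<gamma> \<in> carrier_mat (dim_col (N \<gamma>)) (dim_col (M \<gamma>))"
    and "\<And>\<gamma>. \<gamma> < n \<Longrightarrow> h \<gamma> \<in> carrier_mat (dim_col (M \<gamma>)) (dim_col (N \<gamma>))"
    and "\<And>\<gamma>. \<gamma> < n \<Longrightarrow> g \<gamma> * h \<gamma> = 1\<^sub>m (dim_col (N \<gamma>))"
    and "\<And>\<gamma>. \<gamma> < n \<Longrightarrow> h \<gamma> * g \<gamma> = 1\<^sub>m (dim_col (M \<gamma>))"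
    and "\<And>\<gamma>. \<gamma> < n \<Longrightarrow> g (Suc \<gamma> mod n) * M \<gamma> = N \<gamma> * g \<gamma>"
  shows "iso_pair n M N g h"
  using assms unfolding iso_pair_def by blast

lemma rep_iso_iff: "rep_iso n M N \<longleftrightarrow> (\<exists>g h. iso_pair n M N g h)"
proof
  assume "\<exists>g h. iso_pair n M N g h"
  then obtain g h where gh: "iso_pair n M N g h" by blast
  show "rep_iso n M N"
    unfolding rep_iso_def
  proof (intro exI[of _ g] conjI allI impI)
    fix \<gamma> assume \<gamma>: "\<gamma> < n"
    note gh = iso_pairD[OF gh \<gamma>]
    have "dim_col (N \<gamma>) = dim_col (M \<gamma>)" by (rule mat_inverse_pair_dim_eq[OF gh(1-4)])
    then show "invertible_mat (g \<gamma>)"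
      using gh unfolding invertible_mat_def inverts_mat_def by auto
    show "g \<gamma> \<in> carrier_mat (dim_col (N \<gamma>)) (dim_col (M \<gamma>))"
      "g (Suc \<gamma> mod n) * M \<gamma> = N \<gamma> * g \<gamma>" by (fact gh)+
  qed
next
  assume "rep_iso n M N"
  then obtain g where g: "\<And>\<gamma>. \<gamma> < n \<Longrightarrow> g \<gamma> \<in> carrier_mat (dim_col (N \<gamma>)) (dim_col (M \<gamma>))"
    "\<And>\<gamma>. \<gamma> < n \<Longrightarrow> invertible_mat (g \<gamma>)"
    "\<And>\<gamma>. \<gamma> < n \<Longrightarrow> g (Suc \<gamma> mod n) * M \<gamma> = N \<gamma> * g \<gamma>"
    unfolding rep_iso_def by metis
  have "\<exists>h. h \<in> carrier_mat (dim_col (M \<gamma>)) (dim_col (N \<gamma>)) \<and> g \<gamma> * h = 1\<^sub>m (dim_col (N \<gamma>))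
    \<and> h * g \<gamma> = 1\<^sub>m (dim_col (M \<gamma>))" if \<gamma>: "\<gamma> < n" for \<gamma>
  proof -
    obtain h where h: "g \<gamma> * h = 1\<^sub>m (dim_row (g \<gamma>))" "h * g \<gamma> = 1\<^sub>m (dim_row h)"
      using g(2)[OF \<gamma>] unfolding invertible_mat_def inverts_mat_def by blast
    have "dim_row h = dim_col (M \<gamma>)" using arg_cong[OF h(2), of dim_col] g(1)[OF \<gamma>] by auto
    moreover have "dim_col h = dim_col (N \<gamma>)" using arg_cong[OF h(1), of dim_col] g(1)[OF \<gamma>] by auto
    ultimately show ?thesis using h g(1)[OF \<gamma>] by (intro exI[of _ h]) auto
  qed
  then obtain h where "\<And>\<gamma>. \<gamma> < n \<Longrightarrow> h \<gamma> \<in> carrier_mat (dim_col (M \<gamma>)) (dim_col (N \<gamma>)) \<and>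
    g \<gamma> * h \<gamma> = 1\<^sub>m (dim_col (N \<gamma>)) \<and> h \<gamma> * g \<gamma> = 1\<^sub>m (dim_col (M \<gamma>))"
    by metis
  then have "iso_pair n M N g h" using g(1,3) unfolding iso_pair_def by blast
  then show "\<exists>g h. iso_pair n M N g h" by blast
qed

lemma rep_isoI: "iso_pair n M N g h \<Longrightarrow> rep_iso n M N"
  using rep_iso_iff by blast

lemma rep_iso_dim:
  assumes "rep_iso n M N" "\<gamma> < n" shows "dim_col (N \<gamma>) = dim_col (M \<gamma>)"
proof -
  obtain g h where "iso_pair n M N g h" using assms rep_iso_iff by blast
  from iso_pairD(1-4)[OF this assms(2)] show ?thesis by (rule mat_inverse_pair_dim_eq)
qed

lemma rep_iso_refl:
  assumes "wf_rep n M" shows "rep_iso n M M"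
proof (rule rep_isoI[OF iso_pairI[of n "\<lambda>\<gamma>. 1\<^sub>m (dim_col (M \<gamma>))" M M "\<lambda>\<gamma>. 1\<^sub>m (dim_col (M \<gamma>))"]])
  fix \<gamma> assume "\<gamma> < n"
  from wf_rep_carrier[OF assms this]
  show "1\<^sub>m (dim_col (M (Suc \<gamma> mod n))) * M \<gamma> = M \<gamma> * 1\<^sub>m (dim_col (M \<gamma>))"
    by (metis left_mult_one_mat right_mult_one_mat)
qed auto

lemma rep_iso_sym:
  assumes iso: "rep_iso n M N" and wf: "wf_rep n M" "wf_rep n N"
  shows "rep_iso n N M"
proof -
  obtain g h where gh_pair: "iso_pair n M N g h" using iso rep_iso_iff by blast
  note gh = iso_pairD[OF gh_pair]
  have "h (Suc \<gamma> mod n) * N \<gamma> = M \<gamma> * h \<gamma>" if \<gamma>: "\<gamma> < n" for \<gamma>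
  proof -
    let ?s = "Suc \<gamma> mod n"
    note c = gh(1,2)[OF \<gamma>] gh(1,2)[OF Suc_mod_less[OF \<gamma>]] wf_rep_carrier[OF wf(1) \<gamma>] wf_rep_carrier[OF wf(2) \<gamma>]
    have "h ?s * N \<gamma> = h ?s * (N \<gamma> * (g \<gamma> * h \<gamma>))"
      using c gh(3)[OF \<gamma>] by (metis right_mult_one_mat)
    also have "\<dots> = h ?s * ((N \<gamma> * g \<gamma>) * h \<gamma>)"
      by (simp only: assoc_mult_mat[OF c(6) c(1) c(2)])
    also have "\<dots> = h ?s * ((g ?s * M \<gamma>) * h \<gamma>)" using gh(5)[OF \<gamma>] by simp
    also have "\<dots> = (h ?s * g ?s) * (M \<gamma> * h \<gamma>)"
      using mult_mat_assoc4[OF c(4,3,5,2)] assoc_mult_mat[OF c(4) mult_carrier_mat[OF c(3,5)] c(2)] by simp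
    also have "\<dots> = M \<gamma> * h \<gamma>"
      using gh(4)[OF Suc_mod_less[OF \<gamma>]] c by (metis left_mult_one_mat mult_carrier_mat)
    finally show ?thesis .
  qed
  then show ?thesis by (intro rep_isoI[OF iso_pairI[of n h M N g]]) (use gh in auto)
qed

lemma rep_iso_trans:
  assumes MN: "rep_iso n M N" and NK: "rep_iso n N K" and wf: "wf_rep n M" "wf_rep n N" "wf_rep n K"
  shows "rep_iso n M K"
proof -
  obtain g h where gh_pair: "iso_pair n M N g h" using MN rep_iso_iff by blast
  note gh = iso_pairD[OF gh_pair]
  obtain g' h' where gh'_pair: "iso_pair n N K g' h'" using NK rep_iso_iff by blast
  note gh' = iso_pairD[OF gh'_pair]
  show ?thesis
  proof (rule rep_isoI[OF iso_pairI[of n "\<lambda>\<gamma>. g' \<gamma> * g \<gamma>" K M "\<lambda>\<gamma>. h \<gamma> * h' \<gamma>"]])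
    fix \<gamma> assume \<gamma>: "\<gamma> < n"
    let ?s = "Suc \<gamma> mod n"
    note c = gh(1,2)[OF \<gamma>] gh'(1,2)[OF \<gamma>]
    note d = gh(1,2)[OF Suc_mod_less[OF \<gamma>]] gh'(1,2)[OF Suc_mod_less[OF \<gamma>]]
    note e = wf_rep_carrier[OF wf(1) \<gamma>] wf_rep_carrier[OF wf(2) \<gamma>] wf_rep_carrier[OF wf(3) \<gamma>]
    show "g' \<gamma> * g \<gamma> \<in> carrier_mat (dim_col (K \<gamma>)) (dim_col (M \<gamma>))"
      "h \<gamma> * h' \<gamma> \<in> carrier_mat (dim_col (M \<gamma>)) (dim_col (K \<gamma>))"
      using c by auto
    show "g' \<gamma> * g \<gamma> * (h \<gamma> * h' \<gamma>) = 1\<^sub>m (dim_col (K \<gamma>))"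
      using mult_mat_assoc4[OF c(3,1,2,4)] gh(3)[OF \<gamma>] gh'(3)[OF \<gamma>] right_mult_one_mat[OF c(3)] by simp
    show "h \<gamma> * h' \<gamma> * (g' \<gamma> * g \<gamma>) = 1\<^sub>m (dim_col (M \<gamma>))"
      using mult_mat_assoc4[OF c(2,4,3,1)] gh(4)[OF \<gamma>] gh'(4)[OF \<gamma>] right_mult_one_mat[OF c(2)] by simp
    have "g' ?s * g ?s * M \<gamma> = g' ?s * (N \<gamma> * g \<gamma>)"
      using assoc_mult_mat[OF d(3,1) e(1)] gh(5)[OF \<gamma>] by simp
    also have "\<dots> = K \<gamma> * g' \<gamma> * g \<gamma>"
      using assoc_mult_mat[OF d(3) e(2) c(1)] gh'(5)[OF \<gamma>] by simp
    also have "\<dots> = K \<gamma> * (g' \<gamma> * g \<gamma>)" by (rule assoc_mult_mat[OF e(3) c(3,1)])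
    finally show "g' ?s * g ?s * M \<gamma> = K \<gamma> * (g' \<gamma> * g \<gamma>)" .
  qed
qed

section \<open>Direct sums of representations\<close>

lemma rep_sum_apply:
  "\<gamma> < n \<Longrightarrow> rep_sum n M N \<gamma> = block_diag (M \<gamma>) (N \<gamma>)"
  by (simp add: rep_sum_def)

lemma dim_col_rep_sum [simp]:
  "\<gamma> < n \<Longrightarrow> dim_col (rep_sum n M N \<gamma>) = dim_col (M \<gamma>) + dim_col (N \<gamma>)"
  by (simp add: rep_sum_apply)

lemma dim_row_rep_sum [simp]:
  "\<gamma> < n \<Longrightarrow> dim_row (rep_sum n M N \<gamma>) = dim_row (M \<gamma>) + dim_row (N \<gamma>)"
  by (simp add: rep_sum_apply)

lemma wf_rep_sum:
  assumes "wf_rep n M" "wf_rep n N"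
  shows "wf_rep n (rep_sum n M N)"
  using assms by (auto simp: wf_rep_def)

lemma rep_sum_cong:
  assumes M: "rep_iso n M M'" and N: "rep_iso n N N'"
    and wf: "wf_rep n M" "wf_rep n M'" "wf_rep n N" "wf_rep n N'"
  shows "rep_iso n (rep_sum n M N) (rep_sum n M' N')"
proof -
  obtain g h where gh_pair: "iso_pair n M M' g h" using M rep_iso_iff by blast
  note gh = iso_pairD[OF gh_pair]
  obtain g' h' where gh'_pair: "iso_pair n N N' g' h'" using N rep_iso_iff by blast
  note gh' = iso_pairD[OF gh'_pair]
  show ?thesis
  proof (rule rep_isoI[OF iso_pairI[of n "\<lambda>\<gamma>. block_diag (g \<gamma>) (g' \<gamma>)" _ _ "\<lambda>\<gamma>. block_diag (h \<gamma>) (h' \<gamma>)"]])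
    fix \<gamma> assume \<gamma>: "\<gamma> < n"
    let ?s = "Suc \<gamma> mod n"
    note c = gh(1,2)[OF \<gamma>] gh'(1,2)[OF \<gamma>]
    note d = gh(1,2)[OF Suc_mod_less[OF \<gamma>]] gh'(1,2)[OF Suc_mod_less[OF \<gamma>]]
    note e = wf[THEN wf_rep_carrier, OF \<gamma>]
    show "block_diag (g \<gamma>) (g' \<gamma>) \<in> carrier_mat (dim_col (rep_sum n M' N' \<gamma>)) (dim_col (rep_sum n M N \<gamma>))"
      "block_diag (h \<gamma>) (h' \<gamma>) \<in> carrier_mat (dim_col (rep_sum n M N \<gamma>)) (dim_col (rep_sum n M' N' \<gamma>))"
      using c \<gamma> by auto
    show "block_diag (g \<gamma>) (g' \<gamma>) * block_diag (h \<gamma>) (h' \<gamma>) = 1\<^sub>m (dim_col (rep_sum n M' N' \<gamma>))"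
      using block_diag_mult[OF c(1,3,2,4)] gh(3)[OF \<gamma>] gh'(3)[OF \<gamma>] \<gamma> by simp
    show "block_diag (h \<gamma>) (h' \<gamma>) * block_diag (g \<gamma>) (g' \<gamma>) = 1\<^sub>m (dim_col (rep_sum n M N \<gamma>))"
      using block_diag_mult[OF c(2,4,1,3)] gh(4)[OF \<gamma>] gh'(4)[OF \<gamma>] \<gamma> by simp
    show "block_diag (g ?s) (g' ?s) * rep_sum n M N \<gamma> = rep_sum n M' N' \<gamma> * block_diag (g \<gamma>) (g' \<gamma>)"
      unfolding rep_sum_apply[OF \<gamma>] block_diag_mult[OF d(1,3) e(1,3)] block_diag_mult[OF e(2,4) c(1,3)]
        gh(5)[OF \<gamma>] gh'(5)[OF \<gamma>] ..
  qed
qed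

lemma rep_sum_assoc: "rep_sum n (rep_sum n M N) K = rep_sum n M (rep_sum n N K)"
proof
  fix \<gamma>
  show "rep_sum n (rep_sum n M N) K \<gamma> = rep_sum n M (rep_sum n N K) \<gamma>"
  proof (cases "\<gamma> < n")
    case True
    then show ?thesis
      using assoc_four_block_mat[of "M \<gamma>" "N \<gamma>" "K \<gamma>"] by (simp add: rep_sum_apply)
  qed (simp add: rep_sum_def)
qed

lemma block_diag_swap:
  fixes A D :: "'a :: comm_semiring_1 mat"
  assumes A: "A \<in> carrier_mat a b" and D: "D \<in> carrier_mat c d"
  shows "four_block_mat (0\<^sub>m c a) (1\<^sub>m c) (1\<^sub>m a) (0\<^sub>m a c) * block_diag A D
    = block_diag D A * four_block_mat (0\<^sub>m d b) (1\<^sub>m d) (1\<^sub>m b) (0\<^sub>m b d)"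
proof -
  have "four_block_mat (0\<^sub>m c a) (1\<^sub>m c) (1\<^sub>m a) (0\<^sub>m a c) * block_diag A D
    = four_block_mat (0\<^sub>m c b) D A (0\<^sub>m a d)"
    using assms by (subst mult_four_block_mat[of _ c a _ c _ a _ _ b _ d]) auto
  moreover have "block_diag D A * four_block_mat (0\<^sub>m d b) (1\<^sub>m d) (1\<^sub>m b) (0\<^sub>m b d)
    = four_block_mat (0\<^sub>m c b) D A (0\<^sub>m a d)"
    using assms by (subst mult_four_block_mat[of _ c d _ b _ a _ _ b _ d]) auto
  ultimately show ?thesis by simp
qed

lemma rep_sum_comm:
  assumes wf: "wf_rep n M" "wf_rep n N"
  shows "rep_iso n (rep_sum n M N) (rep_sum n N M)"
proof -
  define g where "g M N \<gamma> = four_block_mat (0\<^sub>m (dim_col (N \<gamma>)) (dim_col (M \<gamma>))) (1\<^sub>m (dim_col (N \<gamma>)))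
     (1\<^sub>m (dim_col (M \<gamma>))) (0\<^sub>m (dim_col (M \<gamma>)) (dim_col (N \<gamma>)) :: complex mat)" for M N :: rep and \<gamma>
  have inv: "g M N \<gamma> * g N M \<gamma> = 1\<^sub>m (dim_col (N \<gamma>) + dim_col (M \<gamma>))" for M N \<gamma>
    unfolding g_def
    by (subst mult_four_block_mat[of _ "dim_col (N \<gamma>)" "dim_col (M \<gamma>)" _ "dim_col (N \<gamma>)" _ "dim_col (M \<gamma>)" _ _
        "dim_col (N \<gamma>)" _ "dim_col (M \<gamma>)"]) auto
  show ?thesis
  proof (rule rep_isoI[OF iso_pairI[of n "g M N" _ _ "g N M"]])
    fix \<gamma> assume \<gamma>: "\<gamma> < n"
    let ?s = "Suc \<gamma> mod n"
    note e = wf[THEN wf_rep_carrier, OF \<gamma>]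
    show "g M N \<gamma> \<in> carrier_mat (dim_col (rep_sum n N M \<gamma>)) (dim_col (rep_sum n M N \<gamma>))"
      "g N M \<gamma> \<in> carrier_mat (dim_col (rep_sum n M N \<gamma>)) (dim_col (rep_sum n N M \<gamma>))"
      using \<gamma> by (auto simp: g_def intro!: carrier_matI)
    show "g M N \<gamma> * g N M \<gamma> = 1\<^sub>m (dim_col (rep_sum n N M \<gamma>))"
      "g N M \<gamma> * g M N \<gamma> = 1\<^sub>m (dim_col (rep_sum n M N \<gamma>))"
      using inv \<gamma> by auto
    have "g M N ?s * rep_sum n M N \<gamma> = rep_sum n N M \<gamma> * g M N \<gamma>"
      unfolding g_def rep_sum_apply[OF \<gamma>] by (rule block_diag_swap[OF e])
    then show "g M N ?s * rep_sum n M N \<gamma> = rep_sum n N M \<gamma> * g M N \<gamma>" by simp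
  qed
qed

section \<open>Compositions along paths\<close>

lemma path_map_carrier:
  assumes "wf_rep n M" "\<alpha> < n"
  shows "path_map n M \<alpha> l \<in> carrier_mat (dim_col (M ((\<alpha> + l) mod n))) (dim_col (M \<alpha>))"
proof (induction l)
  case (Suc l)
  have b: "(\<alpha> + l) mod n < n" using assms(2) by simp
  have s: "(\<alpha> + Suc l) mod n = Suc ((\<alpha> + l) mod n) mod n" by (simp add: mod_Suc_eq)
  show ?case unfolding s path_map.simps by (rule mult_carrier_mat[OF wf_rep_carrier[OF assms(1) b] Suc])
qed (use assms in \<open>simp add: one_carrier_mat\<close>)

lemma path_map_add:
  assumes wf: "wf_rep n M" and \<alpha>: "\<alpha> < n"
  shows "path_map n M \<alpha> (k + l) = path_map n M ((\<alpha> + k) mod n) l * path_map n M \<alpha> k"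
proof (induction l)
  case 0
  then show ?case using path_map_carrier[OF assms, of k] by auto
next
  case (Suc l)
  let ?b = "(\<alpha> + k) mod n"
  have n: "(\<alpha> + l) mod n < n" "?b < n" for l using \<alpha> by auto
  have "M ((?b + l) mod n) * (path_map n M ?b l * path_map n M \<alpha> k)
    = M ((?b + l) mod n) * path_map n M ?b l * path_map n M \<alpha> k"
    by (rule assoc_mult_mat[symmetric, OF wf_rep_carrier[OF wf] path_map_carrier[OF wf n(2)] path_map_carrier[OF assms]])
      (use \<alpha> in simp)
  moreover have "(\<alpha> + (k + l)) mod n = (?b + l) mod n" by (metis add.assoc mod_add_left_eq)
  ultimately show ?case using Suc by simp
qed

lemma path_map_intertwine:
  assumes wf: "wf_rep n M" "wf_rep n N" and \<alpha>: "\<alpha> < n"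
    and g: "\<And>\<gamma>. \<gamma> < n \<Longrightarrow> g \<gamma> \<in> carrier_mat (dim_col (N \<gamma>)) (dim_col (M \<gamma>))"
    "\<And>\<gamma>. \<gamma> < n \<Longrightarrow> g (Suc \<gamma> mod n) * M \<gamma> = N \<gamma> * g \<gamma>"
  shows "g ((\<alpha> + l) mod n) * path_map n M \<alpha> l = path_map n N \<alpha> l * g \<alpha>"
proof (induction l)
  case 0
  then show ?case using g(1)[OF \<alpha>] \<alpha> by auto
next
  case (Suc l)
  let ?b = "(\<alpha> + l) mod n"
  have b: "?b < n" "Suc ?b mod n < n" using \<alpha> by auto
  have s: "(\<alpha> + Suc l) mod n = Suc ?b mod n" by (simp add: mod_Suc_eq)
  have "g (Suc ?b mod n) * (M ?b * path_map n M \<alpha> l) = g (Suc ?b mod n) * M ?b * path_map n M \<alpha> l"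
    by (rule assoc_mult_mat[symmetric, OF g(1)[OF b(2)] wf_rep_carrier[OF wf(1) b(1)] path_map_carrier[OF wf(1) \<alpha>]])
  also have "\<dots> = N ?b * g ?b * path_map n M \<alpha> l" using g(2)[OF b(1)] by simp
  also have "\<dots> = N ?b * (g ?b * path_map n M \<alpha> l)"
    by (rule assoc_mult_mat[OF wf_rep_carrier[OF wf(2) b(1)] g(1)[OF b(1)] path_map_carrier[OF wf(1) \<alpha>]])
  also have "\<dots> = N ?b * (path_map n N \<alpha> l * g \<alpha>)" using Suc by simp
  also have "\<dots> = N ?b * path_map n N \<alpha> l * g \<alpha>"
    by (rule assoc_mult_mat[symmetric, OF wf_rep_carrier[OF wf(2) b(1)] path_map_carrier[OF wf(2) \<alpha>] g(1)[OF \<alpha>]])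
  finally show ?case unfolding s by simp
qed

lemma path_map_conj:
  assumes wf: "wf_rep n M" "wf_rep n N" and \<alpha>: "\<alpha> < n" and iso: "rep_iso n M N"
  obtains U U' V V' where
    "U \<in> carrier_mat (dim_col (N ((\<alpha> + l) mod n))) (dim_col (M ((\<alpha> + l) mod n)))"
    "U' \<in> carrier_mat (dim_col (M ((\<alpha> + l) mod n))) (dim_col (N ((\<alpha> + l) mod n)))"
    "U' * U = 1\<^sub>m (dim_col (M ((\<alpha> + l) mod n)))"
    "V \<in> carrier_mat (dim_col (M \<alpha>)) (dim_col (N \<alpha>))" "V' \<in> carrier_mat (dim_col (N \<alpha>)) (dim_col (M \<alpha>))"
    "V * V' = 1\<^sub>m (dim_col (M \<alpha>))"
    "path_map n N \<alpha> l = U * path_map n M \<alpha> l * V"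
proof -
  obtain g h where gh_pair: "iso_pair n M N g h" using iso rep_iso_iff by blast
  note gh = iso_pairD[OF gh_pair]
  have b: "(\<alpha> + l) mod n < n" using \<alpha> by auto
  have "g ((\<alpha> + l) mod n) * path_map n M \<alpha> l * h \<alpha> = path_map n N \<alpha> l * g \<alpha> * h \<alpha>"
    using path_map_intertwine[OF wf \<alpha> gh(1,5), of l] by simp
  also have "\<dots> = path_map n N \<alpha> l * (g \<alpha> * h \<alpha>)"
    by (rule assoc_mult_mat[OF path_map_carrier[OF wf(2) \<alpha>] gh(1,2)[OF \<alpha>]])
  also have "\<dots> = path_map n N \<alpha> l"
    unfolding gh(3)[OF \<alpha>] by (rule right_mult_one_mat[OF path_map_carrier[OF wf(2) \<alpha>]])
  finally show thesis
    using that[OF gh(1,2,4)[OF b] gh(2,1)[OF \<alpha>] gh(4)[OF \<alpha>]] by simp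
qed

lemma has_rank_path_map_iso:
  assumes wf: "wf_rep n M" "wf_rep n N" and \<alpha>: "\<alpha> < n" and iso: "rep_iso n M N"
    and r: "has_rank (path_map n M \<alpha> l) r"
  shows "has_rank (path_map n N \<alpha> l) r"
  using path_map_conj[OF assms(1-4), of l]
    has_rank_equiv[OF r path_map_carrier[OF wf(1) \<alpha>] path_map_carrier[OF wf(2) \<alpha>]] by metis

lemma path_map_rep_sum:
  assumes wf: "wf_rep n M" "wf_rep n N" and \<alpha>: "\<alpha> < n"
  shows "path_map n (rep_sum n M N) \<alpha> l = block_diag (path_map n M \<alpha> l) (path_map n N \<alpha> l)"
proof (induction l)
  case 0
  then show ?case using \<alpha> by simp
next
  case (Suc l)
  have b: "(\<alpha> + l) mod n < n" using \<alpha> by auto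
  show ?case
    using block_diag_mult[OF wf[THEN wf_rep_carrier, OF b] path_map_carrier[OF wf(1) \<alpha>, of l] path_map_carrier[OF wf(2) \<alpha>, of l]]
    by (simp add: Suc rep_sum_apply[OF b])
qed

lemma nilpotent_rep_iso:
  assumes wf: "wf_rep n M" "wf_rep n N" and iso: "rep_iso n M N" and nil: "nilpotent_rep n k M"
  shows "nilpotent_rep n k N"
  unfolding nilpotent_rep_def
proof (intro allI impI)
  fix \<alpha> l assume \<alpha>: "\<alpha> < n" and "k \<le> l"
  then have 0: "path_map n M \<alpha> l = 0\<^sub>m (dim_col (M ((\<alpha> + l) mod n))) (dim_col (M \<alpha>))"
    using nil unfolding nilpotent_rep_def by blast
  show "path_map n N \<alpha> l = 0\<^sub>m (dim_col (N ((\<alpha> + l) mod n))) (dim_col (N \<alpha>))"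
    by (rule path_map_conj[OF wf \<alpha> iso, of l]) (simp add: 0)
qed

lemma block_diag_eq_zero:
  assumes "block_diag A D = 0\<^sub>m (dim_row A + dim_row D) (dim_col A + dim_col D)"
  shows "A = 0\<^sub>m (dim_row A) (dim_col A)" "D = 0\<^sub>m (dim_row D) (dim_col D)"
proof -
  show "A = 0\<^sub>m (dim_row A) (dim_col A)"
  proof (rule eq_matI)
    fix i j assume "i < dim_row (0\<^sub>m (dim_row A) (dim_col A))" "j < dim_col (0\<^sub>m (dim_row A) (dim_col A))"
    then show "A $$ (i, j) = 0\<^sub>m (dim_row A) (dim_col A) $$ (i, j)"
      using arg_cong[OF assms, of "\<lambda>X. X $$ (i, j)"] by simp
  qed auto
  show "D = 0\<^sub>m (dim_row D) (dim_col D)"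
  proof (rule eq_matI)
    fix i j assume "i < dim_row (0\<^sub>m (dim_row D) (dim_col D))" "j < dim_col (0\<^sub>m (dim_row D) (dim_col D))"
    then show "D $$ (i, j) = 0\<^sub>m (dim_row D) (dim_col D) $$ (i, j)"
      using arg_cong[OF assms, of "\<lambda>X. X $$ (dim_row A + i, dim_col A + j)"] by simp
  qed auto
qed

lemma nilpotent_rep_summand:
  assumes wf: "wf_rep n M" "wf_rep n N" and nil: "nilpotent_rep n k (rep_sum n M N)"
  shows "nilpotent_rep n k N"
  unfolding nilpotent_rep_def
proof (intro allI impI)
  fix \<alpha> l assume \<alpha>: "\<alpha> < n" and "k \<le> l"
  then have "path_map n (rep_sum n M N) \<alpha> l =
      0\<^sub>m (dim_col (rep_sum n M N ((\<alpha> + l) mod n))) (dim_col (rep_sum n M N \<alpha>))"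
    using nil unfolding nilpotent_rep_def by blast
  then show "path_map n N \<alpha> l = 0\<^sub>m (dim_col (N ((\<alpha> + l) mod n))) (dim_col (N \<alpha>))"
    using block_diag_eq_zero(2)[of "path_map n M \<alpha> l" "path_map n N \<alpha> l"]
      path_map_carrier[OF wf(1) \<alpha>, of l] path_map_carrier[OF wf(2) \<alpha>, of l] \<alpha>
    unfolding path_map_rep_sum[OF wf \<alpha>] by auto
qed

section \<open>Interval representations\<close>

text \<open>The coordinate of \<open>\<gamma>\<close> on the cycle cut open at \<open>s\<close>: the
  number of arrows walked from \<open>s\<close> to \<open>\<gamma>\<close>. It is the expression
  that occurs in \<open>cyc_interval\<close> and \<open>cyc_ordered\<close>; adding \<open>n\<close>
  before subtracting prevents truncation for a vertex \<open>s\<close>.\<close>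

definition offset :: "nat \<Rightarrow> nat \<Rightarrow> nat \<Rightarrow> nat" where
  "offset n s \<gamma> = (\<gamma> + n - s) mod n"

lemma offset_add:
  assumes "s < n"
  shows "offset n s ((\<gamma> + l) mod n) = (offset n s \<gamma> + l) mod n"
proof -
  have "offset n s ((\<gamma> + l) mod n) = ((\<gamma> + l) mod n + (n - s)) mod n"
    using assms by (simp add: offset_def)
  also have "\<dots> = (\<gamma> + l + (n - s)) mod n" by (rule mod_add_left_eq)
  also have "\<dots> = (\<gamma> + n - s + l) mod n" using assms by (simp add: add_ac)
  also have "\<dots> = (offset n s \<gamma> + l) mod n" unfolding offset_def by (rule mod_add_left_eq[symmetric])
  finally show ?thesis .
qed

lemma offset_Suc:
  assumes "s < n"
  shows "offset n s (Suc \<gamma> mod n) = Suc (offset n s \<gamma>) mod n"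
  using offset_add[OF assms, of \<gamma> 1] by simp

lemma offset_less: "0 < n \<Longrightarrow> offset n s \<gamma> < n"
  by (simp add: offset_def)

lemma offset_self: "offset n s s = 0"
  by (simp add: offset_def)

lemma start_plus_offset:
  assumes "s < n" "\<gamma> < n" shows "(s + offset n s \<gamma>) mod n = \<gamma>"
proof -
  have "(s + offset n s \<gamma>) mod n = (s + (\<gamma> + n - s)) mod n" unfolding offset_def by (rule mod_add_right_eq)
  then show ?thesis using assms by simp
qed

lemma offset_eq_iff:
  assumes "s < n" "\<gamma> < n" "k < n"
  shows "offset n s \<gamma> = k \<longleftrightarrow> \<gamma> = (s + k) mod n"
proof
  assume "\<gamma> = (s + k) mod n"
  then show "offset n s \<gamma> = k" using offset_add[OF assms(1), of s k] assms by (simp add: offset_self)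
qed (use start_plus_offset[OF assms(1,2)] in auto)

abbreviation cmat :: "nat \<Rightarrow> nat \<Rightarrow> 'a \<Rightarrow> 'a mat" where
  "cmat p q c \<equiv> mat p q (\<lambda>_. c)"

lemma cmat_mult: "cmat p q c * cmat q r d = cmat p r (of_nat q * c * d :: 'a :: comm_semiring_1)"
  by (intro eq_matI) (auto simp: scalar_prod_def mult_ac)

text \<open>The representation supported on the \<open>e\<close> vertices \<open>s, s + 1, \<dots>\<close>; it is zero for \<open>e = 0\<close>.\<close>

definition ivl :: "nat \<Rightarrow> nat \<Rightarrow> nat \<Rightarrow> rep" where
  "ivl n s e = (\<lambda>\<gamma>\<in>{..<n}.
     cmat (of_bool (offset n s (Suc \<gamma> mod n) < e)) (of_bool (offset n s \<gamma> < e)) 1)"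

lemma ivl_apply: "\<gamma> < n \<Longrightarrow>
  ivl n s e \<gamma> = cmat (of_bool (offset n s (Suc \<gamma> mod n) < e)) (of_bool (offset n s \<gamma> < e)) 1"
  by (simp add: ivl_def)

lemma dim_col_ivl [simp]: "\<gamma> < n \<Longrightarrow> dim_col (ivl n s e \<gamma>) = of_bool (offset n s \<gamma> < e)"
  by (simp add: ivl_def)

lemma dim_row_ivl [simp]: "\<gamma> < n \<Longrightarrow> dim_row (ivl n s e \<gamma>) = of_bool (offset n s (Suc \<gamma> mod n) < e)"
  by (simp add: ivl_def)

lemma wf_ivl: "wf_rep n (ivl n s e)"
  by (auto simp: wf_rep_def)

lemma cyc_interval_eq:
  assumes "\<alpha> < n" "\<beta> < n"
  shows "cyc_interval n \<alpha> \<beta> = {\<gamma>. \<gamma> < n \<and> offset n \<alpha> \<gamma> < Suc (offset n \<alpha> \<beta>)}"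
proof -
  have "\<gamma> \<in> cyc_interval n \<alpha> \<beta> \<longleftrightarrow> \<gamma> < n \<and> offset n \<alpha> \<gamma> < Suc (offset n \<alpha> \<beta>)" for \<gamma>
  proof
    assume "\<gamma> \<in> cyc_interval n \<alpha> \<beta>"
    then obtain i where i: "i \<le> offset n \<alpha> \<beta>" "\<gamma> = (\<alpha> + i) mod n"
      by (auto simp: cyc_interval_def offset_def)
    moreover have "i < n" using i(1) offset_less[of n \<alpha> \<beta>] assms by linarith
    ultimately show "\<gamma> < n \<and> offset n \<alpha> \<gamma> < Suc (offset n \<alpha> \<beta>)"
      using offset_eq_iff[OF assms(1), of \<gamma> i] assms by simp
  next
    assume "\<gamma> < n \<and> offset n \<alpha> \<gamma> < Suc (offset n \<alpha> \<beta>)"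
    then show "\<gamma> \<in> cyc_interval n \<alpha> \<beta>"
      using start_plus_offset[OF assms(1), of \<gamma>]
      by (auto simp: cyc_interval_def offset_def[symmetric] intro!: exI[of _ "offset n \<alpha> \<gamma>"])
  qed
  then show ?thesis by blast
qed

lemma interval_rep_eq_ivl:
  assumes "\<alpha> < n" "\<beta> < n"
  shows "interval_rep n \<alpha> \<beta> = ivl n \<alpha> (Suc (offset n \<alpha> \<beta>))"
  unfolding interval_rep_def ivl_def Let_def cyc_interval_eq[OF assms]
  by (intro restrict_ext) (auto simp: of_bool_def intro!: cong_mat)

text \<open>Because \<open>e < n\<close>, some vertex lies outside the interval. A path that leaves
  the interval and comes back passes through a zero space, so it acts as zero although the spaces at
  its source and its target are nonzero; hence the test on \<open>offset n s \<gamma> + l\<close>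
  without reduction modulo \<open>n\<close>.\<close>

lemma path_map_ivl:
  assumes s: "s < n" and e: "e < n" and \<gamma>: "\<gamma> < n"
  shows "path_map n (ivl n s e) \<gamma> l =
    cmat (of_bool (offset n s ((\<gamma> + l) mod n) < e)) (of_bool (offset n s \<gamma> < e))
      (of_bool (offset n s \<gamma> + l < e))"
proof (induction l)
  case 0
  show ?case using \<gamma> by (intro eq_matI) (auto simp: of_bool_def split: if_splits)
next
  case (Suc l)
  let ?u = "offset n s \<gamma>"
  have b: "(\<gamma> + l) mod n < n" using \<gamma> by auto
  have s1: "Suc ((\<gamma> + l) mod n) mod n = (\<gamma> + Suc l) mod n" by (simp add: mod_Suc_eq)
  have "path_map n (ivl n s e) \<gamma> (Suc l) =
     cmat (of_bool (offset n s ((\<gamma> + Suc l) mod n) < e)) (of_bool (?u < e))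
       (of_bool (offset n s ((\<gamma> + l) mod n) < e) * of_bool (?u + l < e))"
    unfolding path_map.simps Suc ivl_apply[OF b] cmat_mult s1 by simp
  also have "\<dots> = cmat (of_bool (offset n s ((\<gamma> + Suc l) mod n) < e)) (of_bool (?u < e)) (of_bool (?u + Suc l < e))"
  proof (intro cong_mat refl)
    fix i :: nat assume "i < of_bool (offset n s ((\<gamma> + Suc l) mod n) < e)"
    then have c: "(?u + Suc l) mod n < e" using offset_add[OF s, of \<gamma> "Suc l"] by (simp split: if_splits add: of_bool_def)
    have o: "offset n s ((\<gamma> + l) mod n) = (?u + l) mod n" using offset_add[OF s] by blast
    show "of_bool (offset n s ((\<gamma> + l) mod n) < e) * of_bool (?u + l < e) = (of_bool (?u + Suc l < e) :: complex)"
    proof (cases "?u + l < e")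
      case True
      then have "(?u + l) mod n = ?u + l" "(?u + Suc l) mod n = ?u + Suc l" using e by auto
      then show ?thesis using True c o by simp
    qed auto
  qed
  finally show ?case .
qed

lemma has_rank_zero: "has_rank (0\<^sub>m p q :: 'a :: field mat) 0"
  unfolding has_rank_def
  by (intro conjI exI[of _ "0\<^sub>m p 0"] exI[of _ "0\<^sub>m 0 q"] exI[of _ "0\<^sub>m 0 p"] exI[of _ "0\<^sub>m q 0"]) auto

lemma has_rank_one: "has_rank (1\<^sub>m p :: 'a :: field mat) p"
  unfolding has_rank_def
  by (intro conjI exI[of _ "1\<^sub>m p"]) auto

lemma has_rank_path_map_ivl:
  assumes "s < n" "e < n" "\<gamma> < n"
  shows "has_rank (path_map n (ivl n s e) \<gamma> l) (of_bool (offset n s \<gamma> + l < e))"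
proof (cases "offset n s \<gamma> + l < e")
  case True
  then have "offset n s ((\<gamma> + l) mod n) < e" "offset n s \<gamma> < e"
    using offset_add[OF assms(1), of \<gamma> l] assms by auto
  then have "path_map n (ivl n s e) \<gamma> l = 1\<^sub>m 1"
    using path_map_ivl[OF assms, of l] True by (auto intro!: eq_matI)
  then show ?thesis using True has_rank_one[of 1] by simp
next
  case False
  then have "path_map n (ivl n s e) \<gamma> l =
     0\<^sub>m (of_bool (offset n s ((\<gamma> + l) mod n) < e)) (of_bool (offset n s \<gamma> < e))"
    using path_map_ivl[OF assms, of l] by (auto intro!: eq_matI)
  then show ?thesis using False by (simp add: has_rank_zero)
qed

section \<open>Direct sums of interval representations\<close>

definition zero_rep :: "nat \<Rightarrow> rep" where
  "zero_rep n = (\<lambda>\<gamma>\<in>{..<n}. 0\<^sub>m 0 0)"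

lemma wf_zero_rep: "wf_rep n (zero_rep n)"
  by (auto simp: wf_rep_def zero_rep_def)

lemma rep_iso_zero:
  assumes wf: "wf_rep n M" and 0: "\<And>\<gamma>. \<gamma> < n \<Longrightarrow> dim_col (M \<gamma>) = 0"
  shows "rep_iso n M (zero_rep n)"
  by (rule rep_isoI[OF iso_pairI[of n "\<lambda>_. 0\<^sub>m 0 0" _ _ "\<lambda>_. 0\<^sub>m 0 0"]])
    (use wf 0 in \<open>auto simp: zero_rep_def wf_rep_def intro!: eq_matI carrier_matI\<close>)

fun ivl_sum :: "nat \<Rightarrow> (nat \<times> nat) list \<Rightarrow> rep" where
  "ivl_sum n [] = zero_rep n"
| "ivl_sum n ((s, e) # xs) = rep_sum n (ivl n s e) (ivl_sum n xs)"

text \<open>\<open>0 < e\<close> keeps zero summands out, so that the list is determined up to order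
  by the representation; \<open>e < n\<close> is the bound imposed by nilpotency.\<close>

definition valid_ivls :: "nat \<Rightarrow> (nat \<times> nat) list \<Rightarrow> bool" where
  "valid_ivls n xs \<longleftrightarrow> (\<forall>(s, e)\<in>set xs. s < n \<and> 0 < e \<and> e < n)"

text \<open>The number of intervals that contain the path of length \<open>l\<close> starting at \<open>\<gamma>\<close>.\<close>

definition path_count :: "nat \<Rightarrow> (nat \<times> nat) list \<Rightarrow> nat \<Rightarrow> nat \<Rightarrow> nat" where
  "path_count n xs \<gamma> l = length (filter (\<lambda>(s, e). offset n s \<gamma> + l < e) xs)"

lemma wf_ivl_sum: "wf_rep n (ivl_sum n xs)"
  by (induction n xs rule: ivl_sum.induct) (auto intro: wf_zero_rep wf_rep_sum wf_ivl)

lemma has_rank_path_map_ivl_sum: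
  assumes "\<forall>(s, e)\<in>set xs. s < n \<and> e < n" "\<gamma> < n"
  shows "has_rank (path_map n (ivl_sum n xs) \<gamma> l) (path_count n xs \<gamma> l)"
  using assms
proof (induction xs)
  case Nil
  have "path_map n (zero_rep n) \<gamma> l = 0\<^sub>m 0 0"
    using path_map_carrier[OF wf_zero_rep, of \<gamma> n l] Nil(2)
    by (intro eq_matI) (auto simp: zero_rep_def)
  then show ?case by (simp add: path_count_def has_rank_zero)
next
  case (Cons x xs)
  obtain s e where x: "x = (s, e)" by fastforce
  have v: "s < n" "e < n" "\<forall>(s, e)\<in>set xs. s < n \<and> e < n" using Cons.prems by (auto simp: x)
  then show ?case
    using has_rank_block_diag[OF has_rank_path_map_ivl[OF v(1,2) Cons.prems(2), of l] Cons.IH[OF v(3) Cons.prems(2)]]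
    by (auto simp: x path_count_def path_map_rep_sum[OF wf_ivl wf_ivl_sum Cons.prems(2)])
qed

section \<open>Decomposition into intervals\<close>

definition unit_row :: "nat \<Rightarrow> complex mat" where
  "unit_row d = mat 1 d (\<lambda>(i, j). of_bool (j = 0))"

definition unit_col :: "nat \<Rightarrow> complex mat" where
  "unit_col d = mat d 1 (\<lambda>(i, j). of_bool (i = 0))"

lemma unit_row_carrier [simp]: "unit_row d \<in> carrier_mat 1 d"
  and unit_col_carrier [simp]: "unit_col d \<in> carrier_mat d 1"
  by (auto simp: unit_row_def unit_col_def)

lemma unit_row_mult:
  assumes "A \<in> carrier_mat d k" "0 < d" "j < k"
  shows "(unit_row d * A) $$ (0, j) = A $$ (0, j)"
proof -
  have "(unit_row d * A) $$ (0, j) = (\<Sum>i = 0..<d. of_bool (i = 0) * A $$ (i, j))"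
    using assms by (auto simp: unit_row_def scalar_prod_def)
  also have "\<dots> = (\<Sum>i = 0..<d. if i = 0 then A $$ (i, j) else 0)"
    by (intro sum.cong) auto
  finally show ?thesis using assms by simp
qed

lemma mult_unit_col:
  assumes "A \<in> carrier_mat k d" "0 < d" "i < k"
  shows "(A * unit_col d) $$ (i, 0) = A $$ (i, 0)"
proof -
  have "(A * unit_col d) $$ (i, 0) = (\<Sum>j = 0..<d. A $$ (i, j) * of_bool (j = 0))"
    using assms by (auto simp: unit_col_def scalar_prod_def)
  also have "\<dots> = (\<Sum>j = 0..<d. if j = 0 then A $$ (i, j) else 0)"
    by (intro sum.cong) auto
  finally show ?thesis using assms by simp
qed

text \<open>If \<open>\<phi>\<close> takes the value 1 on \<open>v\<close>, the space is the direct
  sum of the line through \<open>v\<close> and the kernel of \<open>\<phi>\<close>. The matrix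
  \<open>g\<close> changes to a basis compatible with this splitting: \<open>v\<close> becomes the
  first basis vector and \<open>\<phi>\<close> the first coordinate.\<close>

lemma adapted_basis:
  fixes \<phi> v :: "complex mat"
  assumes \<phi>: "\<phi> \<in> carrier_mat 1 d" and v: "v \<in> carrier_mat d 1" and "\<phi> * v = 1\<^sub>m 1"
  shows "\<exists>g h. g \<in> carrier_mat d d \<and> h \<in> carrier_mat d d \<and> g * h = 1\<^sub>m d \<and> h * g = 1\<^sub>m d \<and>
    unit_row d * g = \<phi> \<and> h * unit_col d = v"
proof -
  define f where "f i = \<phi> $$ (0, i)" for i
  define w where "w i = v $$ (i, 0)" for i
  have fw: "(\<Sum>m<d. f m * w m) = 1"
  proof -
    have "(\<phi> * v) $$ (0, 0) = (\<Sum>m<d. f m * w m)"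
      using \<phi> v by (auto simp: scalar_prod_def f_def w_def atLeast0LessThan)
    then show ?thesis using assms(3) by simp
  qed
  have "\<exists>k<d. f k \<noteq> 0"
  proof (rule ccontr)
    assume "\<not> ?thesis"
    then have "(\<Sum>m<d. f m * w m) = 0" by (intro sum.neutral) auto
    then show False using fw by simp
  qed
  then obtain k where k: "k < d" "f k \<noteq> 0" by blast
  \<comment> \<open>\<open>\<sigma>\<close> enumerates the indices other than \<open>k\<close>; the functionals other than \<open>\<phi>\<close> are the projections of the coordinates along \<open>v\<close>.\<close>
  define \<sigma> where "\<sigma> i = (if i \<le> k then i - 1 else i)" for i
  have \<sigma>: "\<sigma> i < d" "\<sigma> i \<noteq> k" if "0 < i" "i < d" for i using that k by (auto simp: \<sigma>_def)
  have inj: "\<sigma> i = \<sigma> j \<longleftrightarrow> i = j" if "0 < i" "0 < j" for i j using that by (auto simp: \<sigma>_def)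
  define g where "g = mat d d (\<lambda>(i, j). if i = 0 then f j else of_bool (j = \<sigma> i) - w (\<sigma> i) * f j)"
  \<comment> \<open>The columns are \<open>v\<close> and, for each index other than
    \<open>k\<close>, the unit vector corrected in coordinate \<open>k\<close> so that it lies in
    the kernel of \<open>\<phi>\<close>; this is where \<open>f k \<noteq> 0\<close> enters.\<close>
  define h where "h = mat d d (\<lambda>(i, j). if j = 0 then w i else of_bool (i = \<sigma> j) - of_bool (i = k) * (f (\<sigma> j) / f k))"
  have g: "g \<in> carrier_mat d d" and h: "h \<in> carrier_mat d d" by (auto simp: g_def h_def)
  have fh: "(\<Sum>m<d. f m * h $$ (m, j)) = of_bool (j = 0)" if j: "j < d" for j
  proof (cases "j = 0")
    case True
    then show ?thesis using fw k by (simp add: h_def)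
  next
    case False
    have "(\<Sum>m<d. f m * h $$ (m, j)) =
       (\<Sum>m<d. (if m = \<sigma> j then f m else 0) - (if m = k then f m * (f (\<sigma> j) / f k) else 0))"
      using False j by (intro sum.cong) (auto simp: h_def algebra_simps)
    also have "\<dots> = f (\<sigma> j) - f k * (f (\<sigma> j) / f k)"
      using k \<sigma>[of j] False j by (simp add: sum_subtractf)
    finally show ?thesis using False k by simp
  qed
  have "(g * h) $$ (i, j) = of_bool (i = j)" if i: "i < d" and j: "j < d" for i j
  proof -
    have *: "(g * h) $$ (i, j) = (\<Sum>m<d. g $$ (i, m) * h $$ (m, j))"
      using g h i j by (auto simp: scalar_prod_def atLeast0LessThan)
    show ?thesis
    proof (cases "i = 0")
      case True
      then have "(g * h) $$ (i, j) = (\<Sum>m<d. f m * h $$ (m, j))"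
        unfolding * using i by (intro sum.cong) (auto simp: g_def)
      then show ?thesis using fh[OF j] True by auto
    next
      case False
      then have "(g * h) $$ (i, j) =
         (\<Sum>m<d. (if m = \<sigma> i then h $$ (m, j) else 0) - w (\<sigma> i) * (f m * h $$ (m, j)))"
        unfolding * using i by (intro sum.cong) (auto simp: g_def algebra_simps)
      also have "\<dots> = h $$ (\<sigma> i, j) - w (\<sigma> i) * (\<Sum>m<d. f m * h $$ (m, j))"
        using \<sigma>[of i] False i by (simp add: sum_subtractf sum_distrib_left)
      also have "\<dots> = of_bool (i = j)"
        unfolding fh[OF j] using \<sigma>[of i] inj[of i j] False i j by (auto simp: h_def)
      finally show ?thesis .
    qed
  qed
  then have gh: "g * h = 1\<^sub>m d" using g h by (intro eq_matI) auto
  have "unit_row d * g = \<phi>"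
  proof (rule eq_matI)
    fix i j assume "i < dim_row \<phi>" "j < dim_col \<phi>"
    then have ij: "i = 0" "j < d" using \<phi> by auto
    then show "(unit_row d * g) $$ (i, j) = \<phi> $$ (i, j)"
      using unit_row_mult[OF g, of j] k by (auto simp: g_def f_def)
  qed (use \<phi> g in \<open>auto simp: unit_row_def\<close>)
  moreover have "h * unit_col d = v"
  proof (rule eq_matI)
    fix i j assume "i < dim_row v" "j < dim_col v"
    then have ij: "j = 0" "i < d" using v by auto
    then show "(h * unit_col d) $$ (i, j) = v $$ (i, j)"
      using mult_unit_col[OF h, of i] k by (auto simp: h_def w_def)
  qed (use v h in \<open>auto simp: unit_col_def\<close>)
  ultimately show ?thesis using g h gh mat_mult_left_right_inverse[OF g h gh] by blast
qed

text \<open>\<open>c\<close> and \<open>c'\<close> record whether the source and the target of an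
  arrow lie in the interval to be split off. The first row and the first column, where they belong
  to the interval, vanish off the corner, so the corner separates from the rest.\<close>

lemma split_first_basis_vector:
  fixes N :: "complex mat" and c c' :: bool
  assumes N: "N \<in> carrier_mat a b" and pos: "c \<longrightarrow> 0 < b" "c' \<longrightarrow> 0 < a"
    and row: "c' \<Longrightarrow> unit_row a * N = of_bool c \<cdot>\<^sub>m unit_row b"
    and col: "c \<Longrightarrow> N * unit_col b = of_bool c' \<cdot>\<^sub>m unit_col a"
  shows "N = block_diag (cmat (of_bool c') (of_bool c) 1)
    (mat (a - of_bool c') (b - of_bool c) (\<lambda>(i, j). N $$ (i + of_bool c', j + of_bool c)))"
proof (rule eq_matI)
  have r: "N $$ (0, j) = of_bool (c \<and> j = 0)" if "c'" "j < b" for j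
    using arg_cong[OF row, of "\<lambda>X. X $$ (0, j)"] unit_row_mult[OF N, of j] that pos
    by (auto simp: unit_row_def)
  have s: "N $$ (i, 0) = of_bool (c' \<and> i = 0)" if "c" "i < a" for i
    using arg_cong[OF col, of "\<lambda>X. X $$ (i, 0)"] mult_unit_col[OF N, of i] that pos
    by (auto simp: unit_col_def)
  let ?R = "block_diag (cmat (of_bool c') (of_bool c) 1)
    (mat (a - of_bool c') (b - of_bool c) (\<lambda>(i, j). N $$ (i + of_bool c', j + of_bool c)))"
  fix i j assume "i < dim_row ?R" "j < dim_col ?R"
  then have ij: "i < a" "j < b" using pos by (auto split: if_splits simp: of_bool_def)
  show "N $$ (i, j) = ?R $$ (i, j)"
    using ij r s pos by (cases c; cases c'; cases "i = 0"; cases "j = 0") auto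
qed (use N pos in \<open>auto simp: of_bool_def\<close>)

lemma path_map_Suc_start:
  assumes "wf_rep n M" "\<gamma> < n"
  shows "path_map n M \<gamma> (Suc l) = path_map n M (Suc \<gamma> mod n) l * M \<gamma>"
proof -
  have "path_map n M \<gamma> 1 = M \<gamma>" using assms(2) by (simp add: right_mult_one_mat'[of "M \<gamma>"])
  then show ?thesis using path_map_add[OF assms, of 1 l] by simp
qed

text \<open>
  The longest nonzero path splits off as a direct summand: the images of a vector \<open>v\<close> with
  \<open>T\<^sup>l v \<noteq> 0\<close> span the interval, and pulling back a functional that is nonzero on
  \<open>T\<^sup>l v\<close> gives the complement, which is stable because paths of length \<open>l + 1\<close> vanish.
\<close>

lemma split_interval:
  assumes wf: "wf_rep n M" and \<alpha>: "\<alpha> < n" and l: "Suc l < n"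
    and nz: "path_map n M \<alpha> l \<noteq> 0\<^sub>m (dim_col (M ((\<alpha> + l) mod n))) (dim_col (M \<alpha>))"
    and vanish: "\<And>\<beta>. \<beta> < n \<Longrightarrow>
      path_map n M \<beta> (Suc l) = 0\<^sub>m (dim_col (M ((\<beta> + Suc l) mod n))) (dim_col (M \<beta>))"
  shows "\<exists>N. wf_rep n N \<and> rep_iso n M (rep_sum n (ivl n \<alpha> (Suc l)) N) \<and>
    (\<forall>\<gamma><n. dim_col (M \<gamma>) = of_bool (offset n \<alpha> \<gamma> < Suc l) + dim_col (N \<gamma>))"
proof -
  define d where "d \<gamma> = dim_col (M \<gamma>)" for \<gamma>
  define u where "u = offset n \<alpha>"
  define \<omega> where "\<omega> = (\<alpha> + l) mod n"
  define P where "P \<gamma> = path_map n M \<alpha> (u \<gamma>)" for \<gamma>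
  define Q where "Q \<gamma> = path_map n M \<gamma> (l - u \<gamma>)" for \<gamma>
  have Mc: "M \<gamma> \<in> carrier_mat (d (Suc \<gamma> mod n)) (d \<gamma>)" if "\<gamma> < n" for \<gamma>
    unfolding d_def by (rule wf_rep_carrier[OF wf that])
  have u_start: "(\<alpha> + u \<gamma>) mod n = \<gamma>" if "\<gamma> < n" for \<gamma>
    unfolding u_def by (rule start_plus_offset[OF \<alpha> that])
  have Pc: "P \<gamma> \<in> carrier_mat (d \<gamma>) (d \<alpha>)" if "\<gamma> < n" for \<gamma>
    unfolding P_def d_def using path_map_carrier[OF wf \<alpha>, of "u \<gamma>"] u_start[OF that] by simp
  have end_eq: "(\<gamma> + (l - u \<gamma>)) mod n = \<omega>" if "\<gamma> < n" "u \<gamma> \<le> l" for \<gamma>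
  proof -
    have "(\<gamma> + (l - u \<gamma>)) mod n = ((\<alpha> + u \<gamma>) mod n + (l - u \<gamma>)) mod n" using u_start[OF that(1)] by simp
    also have "\<dots> = (\<alpha> + u \<gamma> + (l - u \<gamma>)) mod n" by (rule mod_add_left_eq)
    also have "\<dots> = \<omega>" using that by (simp add: \<omega>_def)
    finally show ?thesis .
  qed
  have Qc: "Q \<gamma> \<in> carrier_mat (d \<omega>) (d \<gamma>)" if "\<gamma> < n" "u \<gamma> \<le> l" for \<gamma>
    unfolding Q_def d_def using path_map_carrier[OF wf that(1), of "l - u \<gamma>"] end_eq[OF that] by simp
  have QP: "Q \<gamma> * P \<gamma> = path_map n M \<alpha> l" if "\<gamma> < n" "u \<gamma> \<le> l" for \<gamma>
    unfolding Q_def P_def using path_map_add[OF wf \<alpha>, of "u \<gamma>" "l - u \<gamma>"] that u_start[OF that(1)] by simp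
  have Lc: "path_map n M \<alpha> l \<in> carrier_mat (d \<omega>) (d \<alpha>)"
    unfolding d_def \<omega>_def by (rule path_map_carrier[OF wf \<alpha>])
  have "\<exists>i<d \<omega>. \<exists>j<d \<alpha>. path_map n M \<alpha> l $$ (i, j) \<noteq> 0"
  proof (rule ccontr)
    assume "\<not> ?thesis"
    then have "path_map n M \<alpha> l = 0\<^sub>m (d \<omega>) (d \<alpha>)" using Lc by (intro eq_matI) auto
    then show False using nz by (simp add: d_def \<omega>_def)
  qed
  then obtain i j where ij: "i < d \<omega>" "j < d \<alpha>" "path_map n M \<alpha> l $$ (i, j) \<noteq> 0" by blast
  define c where "c = path_map n M \<alpha> l $$ (i, j)"
  \<comment> \<open>\<open>C\<close> is the vector at the source of the path and \<open>R\<close>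
    the functional at its end; both select the nonzero entry \<open>c\<close>, and the factor
    \<open>1 / c\<close> makes the functional take the value 1 on the image of the vector.\<close>
  define R where "R = mat 1 (d \<omega>) (\<lambda>(_, k). if k = i then 1 / c else 0)"
  define C where "C = mat (d \<alpha>) 1 (\<lambda>(k, _). if k = j then 1 else (0 :: complex))"
  have Rc: "R \<in> carrier_mat 1 (d \<omega>)" and Cc: "C \<in> carrier_mat (d \<alpha>) 1" by (auto simp: R_def C_def)
  have RLC: "R * path_map n M \<alpha> l * C = 1\<^sub>m 1"
  proof (rule eq_matI)
    fix a b assume "a < dim_row (1\<^sub>m 1)" "b < dim_col (1\<^sub>m 1)"
    then have ab: "a = 0" "b = 0" by auto
    have RL: "(R * path_map n M \<alpha> l) $$ (0, k) = path_map n M \<alpha> l $$ (i, k) / c" if "k < d \<alpha>" for k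
    proof -
      have "(R * path_map n M \<alpha> l) $$ (0, k) = (\<Sum>m = 0..<d \<omega>. (if m = i then 1 / c else 0) * path_map n M \<alpha> l $$ (m, k))"
        using Rc Lc that by (auto simp: scalar_prod_def R_def)
      also have "\<dots> = (\<Sum>m = 0..<d \<omega>. if m = i then path_map n M \<alpha> l $$ (m, k) / c else 0)"
        by (intro sum.cong) auto
      finally show ?thesis using ij by simp
    qed
    have "(R * path_map n M \<alpha> l * C) $$ (0, 0) =
      (\<Sum>m = 0..<d \<alpha>. (R * path_map n M \<alpha> l) $$ (0, m) * (if m = j then 1 else 0))"
      using Rc Lc Cc by (auto simp: scalar_prod_def C_def)
    also have "\<dots> = (\<Sum>m = 0..<d \<alpha>. if m = j then (R * path_map n M \<alpha> l) $$ (0, m) else 0)"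
      by (intro sum.cong) auto
    also have "\<dots> = 1" using ij RL[of j] by (simp add: c_def)
    finally show "(R * path_map n M \<alpha> l * C) $$ (a, b) = 1\<^sub>m 1 $$ (a, b)" using ab by simp
  qed (use Rc Cc in auto)
  define \<phi> where "\<phi> \<gamma> = R * Q \<gamma>" for \<gamma>
  define v where "v \<gamma> = P \<gamma> * C" for \<gamma>
  have \<phi>c: "\<phi> \<gamma> \<in> carrier_mat 1 (d \<gamma>)" if "\<gamma> < n" "u \<gamma> \<le> l" for \<gamma>
    unfolding \<phi>_def by (rule mult_carrier_mat[OF Rc Qc[OF that]])
  have vc: "v \<gamma> \<in> carrier_mat (d \<gamma>) 1" if "\<gamma> < n" for \<gamma>
    unfolding v_def by (rule mult_carrier_mat[OF Pc[OF that] Cc])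
  have "\<exists>g h. g \<in> carrier_mat (d \<gamma>) (d \<gamma>) \<and> h \<in> carrier_mat (d \<gamma>) (d \<gamma>) \<and> g * h = 1\<^sub>m (d \<gamma>) \<and>
      h * g = 1\<^sub>m (d \<gamma>) \<and> unit_row (d \<gamma>) * g = \<phi> \<gamma> \<and> h * unit_col (d \<gamma>) = v \<gamma>"
    if "\<gamma> < n" "u \<gamma> \<le> l" for \<gamma>
  proof (rule adapted_basis[OF \<phi>c[OF that] vc[OF that(1)]])
    show "\<phi> \<gamma> * v \<gamma> = 1\<^sub>m 1"
      unfolding \<phi>_def v_def mult_mat_assoc4[OF Rc Qc[OF that] Pc[OF that(1)] Cc] QP[OF that] by (rule RLC)
  qed
  then obtain g h where gh: "\<And>\<gamma>. \<gamma> < n \<Longrightarrow> u \<gamma> \<le> l \<Longrightarrow> g \<gamma> \<in> carrier_mat (d \<gamma>) (d \<gamma>) \<and>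
      h \<gamma> \<in> carrier_mat (d \<gamma>) (d \<gamma>) \<and> g \<gamma> * h \<gamma> = 1\<^sub>m (d \<gamma>) \<and>
      h \<gamma> * g \<gamma> = 1\<^sub>m (d \<gamma>) \<and> unit_row (d \<gamma>) * g \<gamma> = \<phi> \<gamma> \<and> h \<gamma> * unit_col (d \<gamma>) = v \<gamma>"
    by metis
  define G where "G \<gamma> = (if u \<gamma> \<le> l then g \<gamma> else 1\<^sub>m (d \<gamma>))" for \<gamma>
  define H where "H \<gamma> = (if u \<gamma> \<le> l then h \<gamma> else 1\<^sub>m (d \<gamma>))" for \<gamma>
  have GH: "G \<gamma> \<in> carrier_mat (d \<gamma>) (d \<gamma>)" "H \<gamma> \<in> carrier_mat (d \<gamma>) (d \<gamma>)"
    "G \<gamma> * H \<gamma> = 1\<^sub>m (d \<gamma>)" "H \<gamma> * G \<gamma> = 1\<^sub>m (d \<gamma>)" if "\<gamma> < n" for \<gamma>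
    using gh[OF that] by (auto simp: G_def H_def)
  have GH': "unit_row (d \<gamma>) * G \<gamma> = \<phi> \<gamma>" "H \<gamma> * unit_col (d \<gamma>) = v \<gamma>" if "\<gamma> < n" "u \<gamma> \<le> l" for \<gamma>
    using gh[OF that] that by (auto simp: G_def H_def)
  define N0 where "N0 \<gamma> = G (Suc \<gamma> mod n) * M \<gamma> * H \<gamma>" for \<gamma>
  have N0c: "N0 \<gamma> \<in> carrier_mat (d (Suc \<gamma> mod n)) (d \<gamma>)" if "\<gamma> < n" for \<gamma>
    unfolding N0_def
    by (rule mult_carrier_mat[OF mult_carrier_mat[OF GH(1)[OF Suc_mod_less[OF that]] Mc[OF that]] GH(2)[OF that]])
  define cov where "cov \<gamma> \<longleftrightarrow> u \<gamma> < Suc l" for \<gamma>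
  \<comment> \<open>The shifts by \<open>of_bool\<close> drop the first basis vector exactly at the
    vertices covered by the interval.\<close>
  define N where "N = (\<lambda>\<gamma>. mat (d (Suc \<gamma> mod n) - of_bool (cov (Suc \<gamma> mod n))) (d \<gamma> - of_bool (cov \<gamma>))
     (\<lambda>(i, j). N0 \<gamma> $$ (i + of_bool (cov (Suc \<gamma> mod n)), j + of_bool (cov \<gamma>))))"
  have pos: "0 < d \<gamma>" if "\<gamma> < n" "cov \<gamma>" for \<gamma>
  proof (rule ccontr)
    assume "\<not> ?thesis"
    then have "d \<gamma> = 0" by simp
    moreover have le: "u \<gamma> \<le> l" using that by (simp add: cov_def)
    ultimately have "\<phi> \<gamma> * v \<gamma> = 0\<^sub>m 1 1"
      using \<phi>c[OF that(1) le] vc[OF that(1)] by (intro eq_matI) (auto simp: scalar_prod_def)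
    moreover have "\<phi> \<gamma> * v \<gamma> = 1\<^sub>m 1"
      unfolding \<phi>_def v_def mult_mat_assoc4[OF Rc Qc[OF that(1) le] Pc[OF that(1)] Cc] QP[OF that(1) le] by (rule RLC)
    ultimately have "(1\<^sub>m 1 :: complex mat) $$ (0, 0) = 0\<^sub>m 1 1 $$ (0, 0)" by simp
    then show False by simp
  qed
  have u_Suc: "u (Suc \<gamma> mod n) = Suc (u \<gamma>) mod n" for \<gamma>
    unfolding u_def by (rule offset_Suc[OF \<alpha>])
  have u_less: "u \<gamma> < n" for \<gamma> unfolding u_def by (rule offset_less) (use \<alpha> in simp)
  have split: "N0 \<gamma> = rep_sum n (ivl n \<alpha> (Suc l)) N \<gamma>" if \<gamma>: "\<gamma> < n" for \<gamma>
  proof -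
    let ?s = "Suc \<gamma> mod n"
    have s: "?s < n" using \<gamma> by simp
    note c1 = GH(1)[OF s] Mc[OF \<gamma>] GH(2)[OF \<gamma>]
    have "N0 \<gamma> = block_diag (cmat (of_bool (cov ?s)) (of_bool (cov \<gamma>)) 1) (N \<gamma>)"
      unfolding N_def
    proof (rule split_first_basis_vector[OF N0c[OF \<gamma>]])
      show "cov \<gamma> \<longrightarrow> 0 < d \<gamma>" "cov ?s \<longrightarrow> 0 < d ?s" using pos \<gamma> s by auto
      show "unit_row (d ?s) * N0 \<gamma> = of_bool (cov \<gamma>) \<cdot>\<^sub>m unit_row (d \<gamma>)" if cs: "cov ?s"
      proof -
        have us: "u ?s \<le> l" using cs by (simp add: cov_def)
        have "unit_row (d ?s) * N0 \<gamma> = unit_row (d ?s) * (G ?s * M \<gamma>) * H \<gamma>"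
          unfolding N0_def by (rule assoc_mult_mat[symmetric, OF unit_row_carrier mult_carrier_mat[OF c1(1,2)] c1(3)])
        also have "unit_row (d ?s) * (G ?s * M \<gamma>) = \<phi> ?s * M \<gamma>"
          using assoc_mult_mat[OF unit_row_carrier c1(1,2)] GH'(1)[OF s us] by simp
        also have "\<phi> ?s * M \<gamma> = R * (Q ?s * M \<gamma>)"
          unfolding \<phi>_def by (rule assoc_mult_mat[OF Rc Qc[OF s us] c1(2)])
        finally have eq: "unit_row (d ?s) * N0 \<gamma> = R * (Q ?s * M \<gamma>) * H \<gamma>" .
        have QM: "Q ?s * M \<gamma> = path_map n M \<gamma> (Suc (l - u ?s))"
          unfolding Q_def by (rule path_map_Suc_start[OF wf \<gamma>, symmetric])
        show ?thesis
        proof (cases "cov \<gamma>")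
          case True
          then have "u ?s = Suc (u \<gamma>)" using u_Suc[of \<gamma>] l by (simp add: cov_def)
          then have "Suc (l - u ?s) = l - u \<gamma>" using us by simp
          then have "Q ?s * M \<gamma> = Q \<gamma>" using QM unfolding Q_def by simp
          then have "unit_row (d ?s) * N0 \<gamma> = \<phi> \<gamma> * H \<gamma>" using eq by (simp add: \<phi>_def)
          also have "\<dots> = unit_row (d \<gamma>) * (G \<gamma> * H \<gamma>)"
            using GH'(1)[OF \<gamma>] True assoc_mult_mat[OF unit_row_carrier GH(1,2)[OF \<gamma>]] by (simp add: cov_def)
          also have "\<dots> = unit_row (d \<gamma>)"
            unfolding GH(3)[OF \<gamma>] by (rule right_mult_one_mat[OF unit_row_carrier])
          finally show ?thesis using True by (auto simp: unit_row_def)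
        next
          case False
          \<comment> \<open>The arrow enters the interval from outside, hence at its start. Pulling
            the functional back once more gives a path of length \<open>Suc l\<close>, which
            vanishes.\<close>
          have "u ?s = 0"
          proof (cases "Suc (u \<gamma>) = n")
            case True
            then show ?thesis using u_Suc[of \<gamma>] by simp
          next
            case False2: False
            then have "u ?s = Suc (u \<gamma>)" using u_Suc[of \<gamma>] u_less[of \<gamma>] by simp
            then show ?thesis using False cs by (simp add: cov_def)
          qed
          then have "Q ?s * M \<gamma> = 0\<^sub>m (dim_col (M ((\<gamma> + Suc l) mod n))) (dim_col (M \<gamma>))"
            using QM vanish[OF \<gamma>] by simp
          moreover have "dim_row (Q ?s * M \<gamma>) = d \<omega>" using Qc[OF s us] by simp
          ultimately have "Q ?s * M \<gamma> = 0\<^sub>m (d \<omega>) (d \<gamma>)" by (simp add: d_def)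
          then show ?thesis using eq Rc c1(3) False by (auto simp: unit_row_def)
        qed
      qed
      show "N0 \<gamma> * unit_col (d \<gamma>) = of_bool (cov ?s) \<cdot>\<^sub>m unit_col (d ?s)" if cg: "cov \<gamma>"
      proof -
        have ug: "u \<gamma> \<le> l" using cg by (simp add: cov_def)
        have us: "u ?s = Suc (u \<gamma>)" using u_Suc[of \<gamma>] ug l by simp
        have "N0 \<gamma> * unit_col (d \<gamma>) = G ?s * M \<gamma> * (H \<gamma> * unit_col (d \<gamma>))"
          unfolding N0_def by (rule assoc_mult_mat[OF mult_carrier_mat[OF c1(1,2)] c1(3) unit_col_carrier])
        also have "\<dots> = G ?s * M \<gamma> * (P \<gamma> * C)" using GH'(2)[OF \<gamma> ug] by (simp add: v_def)
        also have "\<dots> = G ?s * (M \<gamma> * P \<gamma>) * C"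
          by (rule mult_mat_assoc4[OF c1(1,2) Pc[OF \<gamma>] Cc])
        also have "M \<gamma> * P \<gamma> = path_map n M \<alpha> (Suc (u \<gamma>))"
          unfolding P_def using u_start[OF \<gamma>] by simp
        finally have eq: "N0 \<gamma> * unit_col (d \<gamma>) = G ?s * path_map n M \<alpha> (Suc (u \<gamma>)) * C" .
        show ?thesis
        proof (cases "cov ?s")
          case True
          have "path_map n M \<alpha> (Suc (u \<gamma>)) = P ?s" unfolding P_def us ..
          then have "N0 \<gamma> * unit_col (d \<gamma>) = G ?s * v ?s"
            unfolding eq v_def using assoc_mult_mat[OF c1(1) Pc[OF s] Cc] by simp
          also have "\<dots> = G ?s * H ?s * unit_col (d ?s)"
            using GH'(2)[OF s] True assoc_mult_mat[OF GH(1,2)[OF s] unit_col_carrier] by (simp add: cov_def)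
          also have "\<dots> = unit_col (d ?s)"
            unfolding GH(3)[OF s] by (rule left_mult_one_mat[OF unit_col_carrier])
          finally show ?thesis using True by (auto simp: unit_col_def)
        next
          case False
          \<comment> \<open>The arrow leaves the interval, hence from its last vertex, and the image
            of the vector is taken along a path of length \<open>Suc l\<close>, which
            vanishes.\<close>
          then have "u \<gamma> = l" using us ug by (simp add: cov_def)
          then have "path_map n M \<alpha> (Suc (u \<gamma>)) = 0\<^sub>m (dim_col (M ((\<alpha> + Suc l) mod n))) (dim_col (M \<alpha>))"
            using vanish[OF \<alpha>] by simp
          moreover have "(\<alpha> + Suc l) mod n = ?s" using u_start[OF s] us \<open>u \<gamma> = l\<close> by simp
          ultimately have "path_map n M \<alpha> (Suc (u \<gamma>)) = 0\<^sub>m (d ?s) (d \<alpha>)" by (simp add: d_def)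
          then show ?thesis using eq c1(1) Cc False by (auto simp: unit_col_def)
        qed
      qed
    qed
    then show ?thesis
      using \<gamma> by (simp add: rep_sum_apply ivl_apply cov_def u_def)
  qed
  have dimN: "dim_col (M \<gamma>) = of_bool (offset n \<alpha> \<gamma> < Suc l) + dim_col (N \<gamma>)" if "\<gamma> < n" for \<gamma>
    using pos[OF that] by (auto simp: N_def cov_def u_def d_def)
  have wfN: "wf_rep n N" by (simp add: wf_rep_def N_def)
  moreover have "rep_iso n M (rep_sum n (ivl n \<alpha> (Suc l)) N)"
  proof (rule rep_isoI[OF iso_pairI[of n G _ _ H]])
    fix \<gamma> assume \<gamma>: "\<gamma> < n"
    have dim: "dim_col (rep_sum n (ivl n \<alpha> (Suc l)) N \<gamma>) = d \<gamma>" using dimN[OF \<gamma>] \<gamma> by (simp add: d_def)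
    show "G \<gamma> \<in> carrier_mat (dim_col (rep_sum n (ivl n \<alpha> (Suc l)) N \<gamma>)) (dim_col (M \<gamma>))"
      "H \<gamma> \<in> carrier_mat (dim_col (M \<gamma>)) (dim_col (rep_sum n (ivl n \<alpha> (Suc l)) N \<gamma>))"
      "G \<gamma> * H \<gamma> = 1\<^sub>m (dim_col (rep_sum n (ivl n \<alpha> (Suc l)) N \<gamma>))"
      "H \<gamma> * G \<gamma> = 1\<^sub>m (dim_col (M \<gamma>))"
      unfolding dim d_def[symmetric] using GH[OF \<gamma>] by auto
    have "N0 \<gamma> * G \<gamma> = G (Suc \<gamma> mod n) * M \<gamma> * (H \<gamma> * G \<gamma>)"
      unfolding N0_def
      by (rule assoc_mult_mat[OF mult_carrier_mat[OF GH(1)[OF Suc_mod_less[OF \<gamma>]] Mc[OF \<gamma>]] GH(2,1)[OF \<gamma>]])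
    also have "\<dots> = G (Suc \<gamma> mod n) * M \<gamma>"
      unfolding GH(4)[OF \<gamma>]
      by (rule right_mult_one_mat[OF mult_carrier_mat[OF GH(1)[OF Suc_mod_less[OF \<gamma>]] Mc[OF \<gamma>]]])
    finally show "G (Suc \<gamma> mod n) * M \<gamma> = rep_sum n (ivl n \<alpha> (Suc l)) N \<gamma> * G \<gamma>"
      using split[OF \<gamma>] by simp
  qed
  ultimately show ?thesis using dimN by blast
qed

text \<open>Induction on the total dimension. A longest nonzero path exists because the path of
  length 0 at a nonzero space is nonzero and nilpotency bounds the lengths; the same bound leaves
  the split interval with fewer than \<open>n\<close> vertices.\<close>

lemma interval_decomposition:
  assumes "wf_rep n M" "nilpotent_rep n (n - 1) M"
  shows "\<exists>xs. valid_ivls n xs \<and> rep_iso n M (ivl_sum n xs)"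
  using assms
proof (induction "\<Sum>\<gamma><n. dim_col (M \<gamma>)" arbitrary: M rule: less_induct)
  case less
  note wf = less.prems(1) and nil = less.prems(2)
  show ?case
  proof (cases "\<forall>\<gamma><n. dim_col (M \<gamma>) = 0")
    case True
    then have "rep_iso n M (ivl_sum n [])" using rep_iso_zero[OF wf] by simp
    then show ?thesis by (intro exI[of _ "[]"]) (auto simp: valid_ivls_def)
  next
    case False
    define nonzero where "nonzero l \<longleftrightarrow>
      (\<exists>\<alpha><n. path_map n M \<alpha> l \<noteq> 0\<^sub>m (dim_col (M ((\<alpha> + l) mod n))) (dim_col (M \<alpha>)))" for l
    obtain \<gamma> where \<gamma>: "\<gamma> < n" "dim_col (M \<gamma>) \<noteq> 0" using False by blast
    have "path_map n M \<gamma> 0 \<noteq> 0\<^sub>m (dim_col (M \<gamma>)) (dim_col (M \<gamma>))"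
    proof
      assume "path_map n M \<gamma> 0 = 0\<^sub>m (dim_col (M \<gamma>)) (dim_col (M \<gamma>))"
      then have "path_map n M \<gamma> 0 $$ (0, 0) = 0" using \<gamma> by simp
      then show False using \<gamma> by simp
    qed
    then have "nonzero 0" unfolding nonzero_def using \<gamma> by auto
    moreover have bound: "l < n - 1" if "nonzero l" for l
      using nil that unfolding nonzero_def nilpotent_rep_def by (meson not_le_imp_less)
    ultimately obtain l where l: "nonzero l" "\<And>k. nonzero k \<Longrightarrow> k \<le> l"
      using GreatestI_nat[of nonzero 0 "n - 1"] Greatest_le_nat[of nonzero _ "n - 1"]
      by (metis less_imp_le)
    obtain \<alpha> where \<alpha>: "\<alpha> < n" "path_map n M \<alpha> l \<noteq> 0\<^sub>m (dim_col (M ((\<alpha> + l) mod n))) (dim_col (M \<alpha>))"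
      using l(1) unfolding nonzero_def by blast
    have "\<not> nonzero (Suc l)" using l(2)[of "Suc l"] by auto
    then have "path_map n M \<beta> (Suc l) = 0\<^sub>m (dim_col (M ((\<beta> + Suc l) mod n))) (dim_col (M \<beta>))"
      if "\<beta> < n" for \<beta> using that unfolding nonzero_def by blast
    moreover have "Suc l < n" using bound[OF l(1)] by simp
    ultimately obtain N where N: "wf_rep n N" "rep_iso n M (rep_sum n (ivl n \<alpha> (Suc l)) N)"
      "\<And>\<gamma>. \<gamma> < n \<Longrightarrow> dim_col (M \<gamma>) = of_bool (offset n \<alpha> \<gamma> < Suc l) + dim_col (N \<gamma>)"
      using split_interval[OF wf \<alpha>(1) _ \<alpha>(2)] by blast
    let ?I = "ivl n \<alpha> (Suc l)"
    have "(\<Sum>\<gamma><n. dim_col (N \<gamma>)) < (\<Sum>\<gamma><n. dim_col (M \<gamma>))"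
    proof (rule sum_strict_mono_ex1)
      show "\<forall>\<gamma>\<in>{..<n}. dim_col (N \<gamma>) \<le> dim_col (M \<gamma>)" using N(3) by auto
      show "\<exists>\<gamma>\<in>{..<n}. dim_col (N \<gamma>) < dim_col (M \<gamma>)"
        using N(3)[OF \<alpha>(1)] \<alpha>(1) offset_self[of n \<alpha>] by (intro bexI[of _ \<alpha>]) auto
    qed simp
    moreover have "nilpotent_rep n (n - 1) N"
      by (rule nilpotent_rep_summand[OF wf_ivl N(1) nilpotent_rep_iso[OF wf wf_rep_sum[OF wf_ivl N(1)] N(2) nil]])
    ultimately obtain xs where xs: "valid_ivls n xs" "rep_iso n N (ivl_sum n xs)"
      using less.hyps N(1) by blast
    have "rep_iso n (rep_sum n ?I N) (rep_sum n ?I (ivl_sum n xs))"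
      by (rule rep_sum_cong[OF rep_iso_refl[OF wf_ivl] xs(2) wf_ivl wf_ivl N(1) wf_ivl_sum])
    then have "rep_iso n M (ivl_sum n ((\<alpha>, Suc l) # xs))"
      using rep_iso_trans[OF N(2) _ wf wf_rep_sum[OF wf_ivl N(1)] wf_rep_sum[OF wf_ivl wf_ivl_sum]] by simp
    moreover have "valid_ivls n ((\<alpha>, Suc l) # xs)"
      using xs(1) \<alpha>(1) bound[OF l(1)] by (auto simp: valid_ivls_def)
    ultimately show ?thesis by blast
  qed
qed

section \<open>Interval multiplicities and ranks\<close>

lemma length_filter_split:
  assumes "\<And>x. x \<in> set xs \<Longrightarrow> P x \<longleftrightarrow> Q x \<or> R x" "\<And>x. x \<in> set xs \<Longrightarrow> \<not> (Q x \<and> R x)"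
  shows "length (filter P xs) = length (filter Q xs) + length (filter R xs)"
  using assms by (induction xs) auto

lemma offset_pred:
  assumes "s < n" "s' < n"
  shows "offset n s' ((s + (n - 1)) mod n) =
    (if s = s' then n - 1 else offset n s' s - 1)" "offset n s' s = 0 \<longleftrightarrow> s = s'"
proof -
  show *: "offset n s' s = 0 \<longleftrightarrow> s = s'" using offset_eq_iff[OF assms(2,1), of 0] assms by simp
  have "offset n s' ((s + (n - 1)) mod n) = (offset n s' s + (n - 1)) mod n" by (rule offset_add[OF assms(2)])
  moreover have "(u + (n - 1)) mod n = u - 1" if "0 < u" "u < n" for u
  proof -
    have "u + (n - 1) = (u - 1) + n" using that by simp
    then show ?thesis using that by (metis less_imp_diff_less mod_add_self2 mod_less)
  qed
  ultimately show "offset n s' ((s + (n - 1)) mod n) = (if s = s' then n - 1 else offset n s' s - 1)"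
    using * offset_less[of n s' s] assms by auto
qed

lemma path_count_Cons:
  "path_count n ((s, e) # xs) \<gamma> l = of_bool (offset n s \<gamma> + l < e) + path_count n xs \<gamma> l"
  by (simp add: path_count_def)

text \<open>A path with \<open>e\<close> vertices has length \<open>e - 1\<close>. From the
  intervals containing it one removes those that also contain the vertex before it or the vertex
  after it, and adds back those that contain both. The vertex before \<open>s\<close> is
  \<open>(s + (n - 1)) mod n\<close>; relative to an interval starting at \<open>s\<close> it has
  offset \<open>n - 1\<close>, which no valid interval reaches.\<close>

lemma count_eq_path_count:
  assumes "valid_ivls n xs" "s < n" "0 < e"
  shows "int (count (mset xs) (s, e)) =
    int (path_count n xs s (e - 1)) - int (path_count n xs ((s + (n - 1)) mod n) e)
    - int (path_count n xs s e) + int (path_count n xs ((s + (n - 1)) mod n) (Suc e))"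
  using assms(1)
proof (induction xs)
  case Nil
  then show ?case by (simp add: path_count_def)
next
  case (Cons x xs)
  obtain s' e' where x: "x = (s', e')" by fastforce
  have v: "s' < n" "0 < e'" "e' < n" "valid_ivls n xs" using Cons.prems by (auto simp: valid_ivls_def x)
  note IH = Cons.IH[OF v(4)]
  note o = offset_pred[OF assms(2) v(1)]
  have "(of_bool ((s', e') = (s, e)) :: int) = of_bool (offset n s' s + (e - 1) < e')
    - of_bool (offset n s' ((s + (n - 1)) mod n) + e < e') - of_bool (offset n s' s + e < e')
    + of_bool (offset n s' ((s + (n - 1)) mod n) + Suc e < e')"
  proof (cases "s = s'")
    case True
    then show ?thesis using o v assms by auto
  next
    case False
    then show ?thesis using o assms(3) by auto
  qed
  moreover have "int (count (mset (x # xs)) (s, e)) = of_bool ((s', e') = (s, e)) + int (count (mset xs) (s, e))"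
    by (simp add: x)
  ultimately show ?case using IH unfolding x path_count_Cons of_nat_add of_nat_of_bool by linarith
qed

lemma mset_eq_if_path_count_eq:
  assumes "valid_ivls n xs" "valid_ivls n ys" "\<And>\<gamma> l. \<gamma> < n \<Longrightarrow> path_count n xs \<gamma> l = path_count n ys \<gamma> l"
  shows "mset xs = mset ys"
proof (rule multiset_eqI)
  fix x :: "nat \<times> nat"
  obtain s e where x: "x = (s, e)" by fastforce
  show "count (mset xs) x = count (mset ys) x"
  proof (cases "s < n \<and> 0 < e")
    case True
    then have "(s + (n - 1)) mod n < n" by simp
    then have "int (count (mset xs) x) = int (count (mset ys) x)"
      using count_eq_path_count[OF assms(1), of s e] count_eq_path_count[OF assms(2), of s e] True assms(3)
      unfolding x by simp
    then show ?thesis by simp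
  next
    case False
    then have "x \<notin> set xs" "x \<notin> set ys" using assms(1,2) by (auto simp: valid_ivls_def x)
    then show ?thesis by (metis count_mset_0_iff)
  qed
qed

lemma ivl_sum_move_front: "rep_iso n (ivl_sum n (xs @ x # ys)) (ivl_sum n (x # xs @ ys))"
proof (induction xs)
  case Nil
  then show ?case by (simp add: rep_iso_refl[OF wf_ivl_sum])
next
  case (Cons y xs)
  obtain s e where x: "x = (s, e)" by fastforce
  obtain s' e' where y: "y = (s', e')" by fastforce
  let ?X = "ivl n s e" and ?Y = "ivl n s' e'" and ?R = "ivl_sum n (xs @ ys)"
  have "rep_iso n (ivl_sum n (y # xs @ x # ys)) (rep_sum n ?Y (rep_sum n ?X ?R))"
    using rep_sum_cong[OF rep_iso_refl[OF wf_ivl] Cons wf_ivl wf_ivl wf_ivl_sum wf_ivl_sum, of s' e'] by (simp add: x y)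
  moreover have "rep_iso n (rep_sum n (rep_sum n ?Y ?X) ?R) (rep_sum n (rep_sum n ?X ?Y) ?R)"
    by (intro rep_sum_cong rep_sum_comm rep_iso_refl wf_ivl wf_ivl_sum wf_rep_sum)
  ultimately have "rep_iso n (ivl_sum n (y # xs @ x # ys)) (rep_sum n ?X (rep_sum n ?Y ?R))"
    unfolding rep_sum_assoc by (rule rep_iso_trans) (intro wf_ivl wf_ivl_sum wf_rep_sum)+
  then show ?case by (simp add: x y)
qed

lemma ivl_sum_mset_cong:
  assumes "mset xs = mset ys"
  shows "rep_iso n (ivl_sum n xs) (ivl_sum n ys)"
  using assms
proof (induction xs arbitrary: ys)
  case Nil
  then show ?case by (simp add: rep_iso_refl[OF wf_zero_rep])
next
  case (Cons x xs)
  obtain s e where x: "x = (s, e)" by fastforce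
  have "x \<in> set ys" using Cons.prems by (metis list.set_intros(1) mset_eq_setD)
  then obtain as bs where ys: "ys = as @ x # bs" by (meson split_list)
  then have "mset xs = mset (as @ bs)" using Cons.prems by simp
  then have "rep_iso n (ivl_sum n (x # xs)) (ivl_sum n (x # as @ bs))"
    using rep_sum_cong[OF rep_iso_refl[OF wf_ivl] Cons.IH wf_ivl wf_ivl wf_ivl_sum wf_ivl_sum] by (simp add: x)
  then show ?case
    using rep_iso_trans[OF _ rep_iso_sym[OF ivl_sum_move_front wf_ivl_sum wf_ivl_sum] wf_ivl_sum wf_ivl_sum wf_ivl_sum]
    unfolding ys by blast
qed

section \<open>Lifts of intervals from the cycle to the integers\<close>

lemma mod_add_diff_eq: "a \<le> x \<Longrightarrow> (a mod n + (x - a)) mod n = x mod n" for a x n :: nat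
  by (metis le_add_diff_inverse mod_add_left_eq)

lemma mod_add_less_eq:
  "u < n \<Longrightarrow> v < n \<Longrightarrow> (u + v) mod n = (if u + v < n then u + v else u + v - n)" for u v n :: nat
  by (metis add_less_mono le_mod_geq linorder_not_le mod_less nat_add_left_cancel_less less_diff_conv2)

text \<open>Lifting to the universal cover: \<open>i - offset n s (i mod n)\<close> is the start of the last lift
  of the interval that starts at or before \<open>i\<close>.\<close>

lemma lifted_interval_contains:
  assumes v: "s < n" "e < n" and i: "n \<le> i" and a: "a \<le> i" "i < a + n" "i \<le> y"
  shows "offset n s (a mod n) + (y - a) < e \<longleftrightarrow>
    i - offset n s (i mod n) \<le> a \<and> y < i - offset n s (i mod n) + e"
proof -
  define \<sigma> where "\<sigma> = i - offset n s (i mod n)"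
  have o: "offset n s (i mod n) < n" using offset_less v by auto
  then have si: "i = \<sigma> + offset n s (i mod n)" using i by (simp add: \<sigma>_def)
  have "offset n s (i mod n) = offset n s (((a mod n) + (i - a)) mod n)"
    using mod_add_diff_eq[OF a(1), of n] by simp
  then have oi: "offset n s (i mod n) = (offset n s (a mod n) + (i - a)) mod n"
    using offset_add[OF v(1)] by simp
  have oa: "offset n s (a mod n) < n" using offset_less v by auto
  show ?thesis
  \<comment> \<open>The cases decide whether \<open>a\<close> lies at or after the start
    \<open>\<sigma>\<close> of the lift. If it lies before, its cyclic offset belongs to the
    previous turn and, extended to \<open>i\<close>, already exceeds the length of the
    interval.\<close>
  proof (cases "offset n s (a mod n) + (i - a) < n")
    case True
    then have "offset n s (i mod n) = offset n s (a mod n) + (i - a)" using oi by simp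
    then have "\<sigma> \<le> a" "offset n s (a mod n) = a - \<sigma>" using si a by auto
    then show ?thesis unfolding \<sigma>_def[symmetric] using a by auto
  next
    case False
    then have "offset n s (i mod n) = offset n s (a mod n) + (i - a) - n"
      using oi oa a mod_add_less_eq[of "offset n s (a mod n)" n "i - a"] by auto
    then have "a < \<sigma>" "offset n s (a mod n) + (i - a) \<ge> n" using si a oa False by auto
    then show ?thesis unfolding \<sigma>_def[symmetric] using a v by auto
  qed
qed

lemma lifted_start_mod:
  assumes "s < n" "n \<le> i"
  shows "(i - offset n s (i mod n)) mod n = s"
proof -
  have o: "offset n s (i mod n) < n" using offset_less assms by auto
  define \<sigma> where "\<sigma> = i - offset n s (i mod n)"
  have "i = \<sigma> + offset n s (i mod n)" using o assms by (simp add: \<sigma>_def)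
  then have "offset n s (i mod n) = offset n s ((\<sigma> mod n + offset n s (i mod n)) mod n)"
    by (metis mod_add_left_eq)
  also have "\<dots> = (offset n s (\<sigma> mod n) + offset n s (i mod n)) mod n"
    by (rule offset_add[OF assms(1)])
  finally have "offset n s (\<sigma> mod n) = 0"
    using o mod_add_less_eq[OF offset_less o, of s "\<sigma> mod n"] offset_less[of n s "\<sigma> mod n"]
    by (auto split: if_splits)
  then show ?thesis using offset_pred(2)[of "\<sigma> mod n" n s] assms unfolding \<sigma>_def by simp
qed

text \<open>The combinatorial core. \<open>L\<close> and \<open>K\<close> list the intervals of the
  smaller and the larger representation, and equal counts at length 0 express equal dimension
  vectors. In coordinates relative to \<open>s\<close> the two members of \<open>L\<close> found are
  \<open>[0, B]\<close> and \<open>[C, D]\<close>: the second starts inside the first or right after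
  it and ends beyond it, and their union has \<open>Suc D < n\<close> vertices.\<close>

lemma exists_move:
  assumes vL: "valid_ivls n L" and vK: "valid_ivls n K"
    and le: "\<And>\<gamma> l. \<gamma> < n \<Longrightarrow> path_count n L \<gamma> l \<le> path_count n K \<gamma> l"
    and eq0: "\<And>\<gamma>. \<gamma> < n \<Longrightarrow> path_count n L \<gamma> 0 = path_count n K \<gamma> 0"
    and ne: "\<exists>\<gamma><n. \<exists>l. path_count n L \<gamma> l \<noteq> path_count n K \<gamma> l"
  shows "\<exists>s B C D. s < n \<and> 0 < C \<and> C \<le> Suc B \<and> B < D \<and> Suc D < n \<and>
    (s, Suc B) \<in> set L \<and> ((s + C) mod n, Suc D - C) \<in> set L"
proof -
  define differ where "differ l \<longleftrightarrow> (\<exists>\<gamma><n. path_count n L \<gamma> l < path_count n K \<gamma> l)" for l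
  have "\<exists>l. differ l" using ne le unfolding differ_def by (metis le_neq_implies_less)
  then obtain l0 where l0: "differ l0" "\<And>l. l < l0 \<Longrightarrow> \<not> differ l" by (metis exists_least_iff)
  have minimal: "path_count n L \<gamma> l = path_count n K \<gamma> l" if "\<gamma> < n" "l < l0" for \<gamma> l
    using l0(2)[OF that(2)] le[OF that(1), of l] that(1) unfolding differ_def by (metis le_neq_implies_less)
  obtain \<gamma> where \<gamma>: "\<gamma> < n" "path_count n L \<gamma> l0 < path_count n K \<gamma> l0" using l0(1) unfolding differ_def by blast
  have l0_pos: "0 < l0" using \<gamma> eq0[OF \<gamma>(1)] by (cases l0) auto
  have long: "path_count n xs \<beta> l = 0" if "valid_ivls n xs" "n - 1 \<le> l" for xs \<beta> l
    using that by (auto simp: path_count_def valid_ivls_def filter_empty_conv)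
  have l0_less: "Suc l0 < n"
  proof (rule ccontr)
    assume "\<not> ?thesis"
    then have "path_count n K \<gamma> l0 = 0" by (intro long[OF vK]) auto
    then show False using \<gamma>(2) by simp
  qed
  \<comment> \<open>One full turn is added so that the lifts in the window below, which start in the
    last \<open>n\<close> positions up to \<open>i\<close>, have nonnegative coordinates.\<close>
  define i where "i = \<gamma> + n"
  define j where "j = i + l0"
  define r where "r xs x y = path_count n xs (x mod n) (y - x)" for xs x y
  define \<sigma> where "\<sigma> x = i - offset n (fst x) (i mod n)" for x :: "nat \<times> nat"
  \<comment> \<open>\<open>\<tau> x\<close> is the first position after the lift, so
    \<open>\<tau> x = j\<close> means that the interval ends at \<open>j - 1\<close>.\<close>
  define \<tau> where "\<tau> x = \<sigma> x + snd x" for x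
  have n0: "0 < n" using \<gamma> by simp
  have i_ge: "n \<le> i" by (simp add: i_def)
  have im: "i mod n = \<gamma>" using \<gamma>(1) by (simp add: i_def)
  have ij: "i < j" "j < i + n" using l0_pos l0_less by (auto simp: j_def)
  have rle: "r L x y \<le> r K x y" for x y unfolding r_def by (rule le) (use n0 in simp)
  have \<sigma>_bounds: "\<sigma> x \<le> i" "i < \<sigma> x + n" if "x \<in> set xs" "valid_ivls n xs" for x xs
    using offset_less[OF n0, of "fst x" "i mod n"] i_ge by (auto simp: \<sigma>_def)
  have r_window: "r xs a y = length (filter (\<lambda>x. \<sigma> x \<le> a \<and> y < \<tau> x) xs)"
    if "valid_ivls n xs" "a \<le> i" "i < a + n" "i \<le> y" for xs a y
  proof -
    have "filter (\<lambda>(s, e). offset n s (a mod n) + (y - a) < e) xs = filter (\<lambda>x. \<sigma> x \<le> a \<and> y < \<tau> x) xs"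
    proof (intro filter_cong refl)
      fix x assume x: "x \<in> set xs"
      obtain s e where se: "x = (s, e)" by fastforce
      have "s < n" "e < n" using that(1) x by (auto simp: valid_ivls_def se)
      from lifted_interval_contains[OF this i_ge that(2-4)]
      show "(case x of (s, e) \<Rightarrow> offset n s (a mod n) + (y - a) < e) \<longleftrightarrow> \<sigma> x \<le> a \<and> y < \<tau> x"
        by (simp only: se prod.case \<sigma>_def \<tau>_def fst_conv snd_conv)
    qed
    then show ?thesis by (simp add: r_def path_count_def)
  qed
  have Dij: "r L i j < r K i j" using \<gamma>(2) by (simp add: r_def im j_def)

  \<comment> \<open>These intervals are what the rank loses when a path from \<open>a\<close> to
    \<open>j - 1\<close> is extended to \<open>j\<close>.\<close>
  define cnt where "cnt xs a = length (filter (\<lambda>x. \<sigma> x \<le> a \<and> \<tau> x = j) xs)" for xs a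
  have r_step: "r xs a (j - 1) = r xs a j + cnt xs a"
    if "valid_ivls n xs" "a \<le> i" "i < a + n" for xs a
    unfolding cnt_def using that ij
    by (subst (1 2) r_window) (auto intro!: length_filter_split)
  \<comment> \<open>The shortened path is below the minimal length, so the ranks agree on it. As the
    rank of \<open>L\<close> at \<open>(i, j)\<close> is the smaller one, \<open>L\<close> has more
    intervals ending at \<open>j - 1\<close> than \<open>K\<close>, in particular at least
    one.\<close>
  have "r L i (j - 1) = r K i (j - 1)"
    unfolding r_def by (rule minimal) (use n0 ij in \<open>auto simp: j_def l0_pos\<close>)
  then have cnt_i: "r K i j + cnt K i = r L i j + cnt L i"
    using r_step[OF vL, of i] r_step[OF vK, of i] n0 by simp
  then have "cnt L i \<noteq> 0" using Dij by linarith
  then obtain x0 where "x0 \<in> set L \<and> \<tau> x0 = j" by (auto simp: cnt_def filter_empty_conv)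
  moreover have "\<forall>x. x \<in> set L \<and> \<tau> x = j \<longrightarrow> \<sigma> x < Suc i"
    using \<sigma>_bounds(1)[OF _ vL] by (simp add: less_Suc_eq_le)
  ultimately obtain x1 where x1: "x1 \<in> set L" "\<tau> x1 = j" and max: "\<And>x. x \<in> set L \<Longrightarrow> \<tau> x = j \<Longrightarrow> \<sigma> x \<le> \<sigma> x1"
    using Lattices_Big.ex_has_greatest_nat[of "\<lambda>x. x \<in> set L \<and> \<tau> x = j" x0 \<sigma> "Suc i"] by blast
  define a where "a = \<sigma> x1"
  have a: "a \<le> i" "i < a + n" using \<sigma>_bounds[OF x1(1) vL] by (auto simp: a_def)
  \<comment> \<open>With D the rank of \<open>K\<close> minus that of \<open>L\<close>, this reads
    D(a', j) >= D(i, j). By the choice of \<open>a\<close>, every lift of an interval of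
    \<open>L\<close> that ends at \<open>j - 1\<close> starts at or before \<open>a'\<close>,
    whereas \<open>K\<close> may have fewer such intervals for \<open>a'\<close> than for
    \<open>i\<close>; and D(a', j - 1) >= 0 = D(i, j - 1).\<close>
  have D_a: "r K a' j + r L i j \<ge> r L a' j + r K i j" if a': "a \<le> a'" "a' \<le> i" for a'
  proof -
    have "filter (\<lambda>x. \<sigma> x \<le> a' \<and> \<tau> x = j) L = filter (\<lambda>x. \<sigma> x \<le> i \<and> \<tau> x = j) L"
      using max a' unfolding a_def by (intro filter_cong) fastforce+
    then have "cnt L a' = cnt L i" by (simp add: cnt_def)
    moreover have "cnt K a' \<le> cnt K i"
    proof -
      have "cnt K i = cnt K a' + length (filter (\<lambda>x. a' < \<sigma> x \<and> \<sigma> x \<le> i \<and> \<tau> x = j) K)"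
        unfolding cnt_def using a' by (intro length_filter_split) auto
      then show ?thesis by simp
    qed
    ultimately show ?thesis
      using r_step[OF vL, of a'] r_step[OF vK, of a'] rle[of a' "j - 1"] cnt_i a' a by simp
  qed

  \<comment> \<open>The mirror image of \<open>cnt\<close>: the intervals starting at the vertex
    after \<open>i\<close> and reaching \<open>y\<close>, lost when a path is extended to start at
    \<open>i\<close>. The lift with start \<open>\<sigma> x\<close> at or before \<open>i\<close>
    lies one turn back for them, so they are described by start vertex and length instead of
    \<open>\<sigma>\<close> and \<open>\<tau>\<close>.\<close>
  define starts where "starts xs y = length (filter (\<lambda>x. fst x = Suc i mod n \<and> y \<le> i + snd x) xs)" for xs y
  have r_start: "r xs (Suc i) y = r xs i y + starts xs y" if v: "valid_ivls n xs" and y: "Suc i \<le> y" for xs y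
  proof -
    have "r xs (Suc i) y = length (filter (\<lambda>x. offset n (fst x) (Suc i mod n) + (y - Suc i) < snd x) xs)"
      unfolding r_def path_count_def by (intro arg_cong[of _ _ length] filter_cong) auto
    also have "\<dots> = length (filter (\<lambda>x. \<sigma> x \<le> i \<and> y < \<tau> x) xs) + starts xs y"
      unfolding starts_def
    proof (rule length_filter_split)
      fix x assume x: "x \<in> set xs"
      have v: "fst x < n" "snd x < n" using v x by (auto simp: valid_ivls_def)
      have o: "offset n (fst x) (Suc i mod n) = Suc (offset n (fst x) (i mod n)) mod n"
        using offset_Suc[OF v(1), of "i mod n"] by (simp add: mod_Suc_eq)
      have z: "offset n (fst x) (Suc i mod n) = 0 \<longleftrightarrow> fst x = Suc i mod n"
        using offset_pred(2)[of "Suc i mod n" n "fst x"] v by auto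
      have w: "offset n (fst x) (i mod n) < n" by (rule offset_less[OF n0])
      show "offset n (fst x) (Suc i mod n) + (y - Suc i) < snd x \<longleftrightarrow>
        (\<sigma> x \<le> i \<and> y < \<tau> x) \<or> (fst x = Suc i mod n \<and> y \<le> i + snd x)"
      proof (cases "fst x = Suc i mod n")
        case True
        then have "offset n (fst x) (i mod n) = n - 1" using o z w by (auto simp: mod_Suc split: if_splits)
        then have "\<sigma> x = Suc i - n" using i_ge n0 by (simp add: \<sigma>_def)
        then show ?thesis using True z y v i_ge by (auto simp: \<tau>_def)
      next
        case False
        then have "offset n (fst x) (Suc i mod n) = Suc (offset n (fst x) (i mod n))"
          using o z w by (auto simp: mod_Suc split: if_splits)
        then show ?thesis using False y w i_ge by (auto simp: \<sigma>_def \<tau>_def)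
      qed
      show "\<not> ((\<sigma> x \<le> i \<and> y < \<tau> x) \<and> (fst x = Suc i mod n \<and> y \<le> i + snd x))"
      proof
        assume A: "(\<sigma> x \<le> i \<and> y < \<tau> x) \<and> (fst x = Suc i mod n \<and> y \<le> i + snd x)"
        then have "offset n (fst x) (i mod n) = n - 1" using o z w by (auto simp: mod_Suc split: if_splits)
        then have "\<sigma> x = Suc i - n" using i_ge n0 by (simp add: \<sigma>_def)
        then show False using A v y i_ge by (auto simp: \<tau>_def)
      qed
    qed
    also have "length (filter (\<lambda>x. \<sigma> x \<le> i \<and> y < \<tau> x) xs) = r xs i y"
      using r_window[OF that(1), of i y] y n0 by simp
    finally show ?thesis .
  qed
  have "r L (Suc i) j = r K (Suc i) j"
    unfolding r_def by (rule minimal) (use n0 ij in \<open>auto simp: j_def l0_pos\<close>)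
  then have st_j: "r K i j + starts K j = r L i j + starts L j"
    using r_start[OF vL, of j] r_start[OF vK, of j] ij by simp
  then have "starts L j \<noteq> 0" using Dij by linarith
  then obtain x0 where "x0 \<in> set L \<and> fst x0 = Suc i mod n \<and> j \<le> i + snd x0"
    by (auto simp: starts_def filter_empty_conv)
  then obtain x2 where x2: "x2 \<in> set L" "fst x2 = Suc i mod n" "j \<le> i + snd x2"
    and min: "\<And>x. x \<in> set L \<Longrightarrow> fst x = Suc i mod n \<Longrightarrow> j \<le> i + snd x \<Longrightarrow> snd x2 \<le> snd x"
    using ex_has_least_nat[of "\<lambda>x. x \<in> set L \<and> fst x = Suc i mod n \<and> j \<le> i + snd x" x0 snd] by blast
  define b where "b = i + snd x2"
  \<comment> \<open>This reads D(i, b') >= D(i, j): all intervals of \<open>L\<close> that start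
    after \<open>i\<close> and reach \<open>j\<close> also reach \<open>b\<close>, hence
    \<open>b'\<close>, and D vanishes at \<open>(Suc i, j)\<close> by minimality.\<close>
  have D_b: "r K i b' + r L i j \<ge> r L i b' + r K i j" if b': "j \<le> b'" "b' \<le> b" for b'
  proof -
    have "filter (\<lambda>x. fst x = Suc i mod n \<and> b' \<le> i + snd x) L = filter (\<lambda>x. fst x = Suc i mod n \<and> j \<le> i + snd x) L"
      using min b' unfolding b_def by (intro filter_cong refl) fastforce
    then have "starts L b' = starts L j" by (simp add: starts_def)
    moreover have "starts K b' \<le> starts K j"
    proof -
      have "starts K j = starts K b' + length (filter (\<lambda>x. fst x = Suc i mod n \<and> j \<le> i + snd x \<and> \<not> b' \<le> i + snd x) K)"
        unfolding starts_def using b' by (intro length_filter_split) auto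
      then show ?thesis by simp
    qed
    ultimately show ?thesis
      using r_start[OF vL, of b'] r_start[OF vK, of b'] rle[of "Suc i" b'] st_j b' ij by simp
  qed

  have x1_eq: "x1 = (a mod n, Suc (j - 1 - a))"
  proof (rule prod_eqI)
    show "fst x1 = fst (a mod n, Suc (j - 1 - a))"
      using lifted_start_mod[of "fst x1" n i] i_ge vL x1(1) by (auto simp: a_def \<sigma>_def valid_ivls_def)
    show "snd x1 = snd (a mod n, Suc (j - 1 - a))" using x1(2) a ij by (simp add: \<tau>_def a_def)
  qed
  have add_mod: "(a mod n + (x - a)) mod n = x mod n" if "a \<le> x" for x
    by (rule mod_add_diff_eq[OF that])
  show ?thesis
  \<comment> \<open>The union \<open>[a, b]\<close> of the two intervals has
    \<open>b - a + 1\<close> vertices. If these are few enough, the pair itself can be moved, with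
    all coordinates taken relative to \<open>a\<close>.\<close>
  proof (cases "b - a + 1 < n")
    case True
    have "x2 = ((a mod n + (Suc i - a)) mod n, Suc (b - a) - (Suc i - a))"
      using x2(2) add_mod[of "Suc i"] a by (intro prod_eqI) (auto simp: b_def)
    then show ?thesis
      using x1(1) x2(1,3) x1_eq a ij True n0
      by (intro exI[of _ "a mod n"] exI[of _ "j - 1 - a"] exI[of _ "Suc i - a"] exI[of _ "b - a"])
        (auto simp: b_def)
  next
    case ba: False
    show ?thesis
    proof (cases "a + (n - 1) \<le> j")
      case True
      \<comment> \<open>If \<open>[a, j]\<close> alone is too long, the start is advanced to the
        position from which the path to \<open>j\<close> has length exactly \<open>n - 1\<close>.
        Its rank is zero in \<open>K\<close>, against D(a', j) >= D(i, j) > 0.\<close>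
      define a' where "a' = j - (n - 1)"
      have a': "a \<le> a'" "a' \<le> i" "j - a' = n - 1" using True l0_less ij a by (auto simp: a'_def j_def)
      have "r K a' j = 0" unfolding r_def using long[OF vK] a'(3) by simp
      then show ?thesis using D_a[OF a'(1,2)] Dij by simp
    next
      case False
      define b' where "b' = a + (n - 1)"
      have b': "j \<le> b'" "b' \<le> b" using False ba ij a n0 by (auto simp: b'_def)
      \<comment> \<open>The intervals that contain \<open>[i, j]\<close> but neither
        \<open>a\<close> nor \<open>b'\<close>; the bound \<open>\<sigma> x \<le> i\<close> holds
        for every lift and is left implicit. This is the correction term of the inclusion-exclusion
        on the four corners.\<close>
      define rect where "rect xs = length (filter (\<lambda>x. a < \<sigma> x \<and> j < \<tau> x \<and> \<tau> x \<le> b') xs)" for xs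
      have rect: "r xs i j + r xs a b' = r xs a j + r xs i b' + rect xs" if v: "valid_ivls n xs" for xs
      proof -
        let ?c = "\<lambda>P. length (filter P xs)"
        have w: "r xs i j = ?c (\<lambda>x. \<sigma> x \<le> i \<and> j < \<tau> x)" "r xs a b' = ?c (\<lambda>x. \<sigma> x \<le> a \<and> b' < \<tau> x)"
          "r xs a j = ?c (\<lambda>x. \<sigma> x \<le> a \<and> j < \<tau> x)" "r xs i b' = ?c (\<lambda>x. \<sigma> x \<le> i \<and> b' < \<tau> x)"
          using a b' ij n0 by (auto intro!: r_window[OF v])
        have "?c (\<lambda>x. \<sigma> x \<le> i \<and> j < \<tau> x) = ?c (\<lambda>x. \<sigma> x \<le> i \<and> b' < \<tau> x) + ?c (\<lambda>x. \<sigma> x \<le> i \<and> j < \<tau> x \<and> \<tau> x \<le> b')"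
          by (rule length_filter_split) (use b' in auto)
        moreover have "?c (\<lambda>x. \<sigma> x \<le> a \<and> j < \<tau> x) = ?c (\<lambda>x. \<sigma> x \<le> a \<and> b' < \<tau> x) + ?c (\<lambda>x. \<sigma> x \<le> a \<and> j < \<tau> x \<and> \<tau> x \<le> b')"
          by (rule length_filter_split) (use b' in auto)
        moreover have "?c (\<lambda>x. \<sigma> x \<le> i \<and> j < \<tau> x \<and> \<tau> x \<le> b') = ?c (\<lambda>x. \<sigma> x \<le> a \<and> j < \<tau> x \<and> \<tau> x \<le> b') + rect xs"
          unfolding rect_def by (rule length_filter_split) (use a \<sigma>_bounds[OF _ v] in auto)
        ultimately show ?thesis unfolding w by simp
      qed
      have zero: "r xs a b' = 0" if "valid_ivls n xs" for xs
        unfolding r_def using long[OF that] by (simp add: b'_def)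
      have "rect L \<noteq> 0"
      proof
        assume "rect L = 0"
        then have "r L i j = r L a j + r L i b'" using rect[OF vL] zero[OF vL] by simp
        moreover have "r K i j \<ge> r K a j + r K i b'" using rect[OF vK] zero[OF vK] by simp
        ultimately show False using D_a[of a] D_b[OF b'] a Dij by simp
      qed
      then have "{x \<in> set L. a < \<sigma> x \<and> j < \<tau> x \<and> \<tau> x \<le> b'} \<noteq> {}" by (auto simp: rect_def filter_empty_conv)
      \<comment> \<open>This interval starts after \<open>a\<close> and before \<open>j\<close>, and
        ends beyond \<open>j - 1\<close> but before \<open>b'\<close>. So it meets
        \<open>[a, j - 1]\<close>, reaches further, and its union with it has at most
        \<open>n - 1\<close> vertices.\<close>
      then obtain x where x: "x \<in> set L" "a < \<sigma> x" "j < \<tau> x" "\<tau> x \<le> b'" by blast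
      have xs: "\<sigma> x \<le> i" using \<sigma>_bounds[OF x(1) vL] by simp
      have x_eq: "x = ((a mod n + (\<sigma> x - a)) mod n, Suc (\<tau> x - 1 - a) - (\<sigma> x - a))"
      proof (rule prod_eqI)
        show "fst x = fst ((a mod n + (\<sigma> x - a)) mod n, Suc (\<tau> x - 1 - a) - (\<sigma> x - a))"
          using add_mod[of "\<sigma> x"] x(2) lifted_start_mod[of "fst x" n i] i_ge vL x(1)
          by (auto simp: \<sigma>_def valid_ivls_def)
        show "snd x = snd ((a mod n + (\<sigma> x - a)) mod n, Suc (\<tau> x - 1 - a) - (\<sigma> x - a))"
          using x(2,3) ij xs by (auto simp: \<tau>_def)
      qed
      show ?thesis
      proof (intro exI conjI)
        show "((a mod n + (\<sigma> x - a)) mod n, Suc (\<tau> x - 1 - a) - (\<sigma> x - a)) \<in> set L"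
          by (subst x_eq[symmetric]) (rule x(1))
        show "(a mod n, Suc (j - 1 - a)) \<in> set L" using x1(1) unfolding x1_eq .
        show "a mod n < n" "0 < \<sigma> x - a" using n0 x(2) by auto
        show "\<sigma> x - a \<le> Suc (j - 1 - a)" "j - 1 - a < \<tau> x - 1 - a" using x(2,3) xs ij a by arith+
        show "Suc (\<tau> x - 1 - a) < n" using x(3,4) ij a unfolding b'_def by arith
      qed
    qed
  qed
qed

section \<open>Polynomial functions\<close>

definition poly_fun :: "(complex \<Rightarrow> complex) \<Rightarrow> bool" where
  "poly_fun f \<longleftrightarrow> (\<exists>p. \<forall>t. f t = poly p t)"

lemma poly_fun_const [intro]: "poly_fun (\<lambda>_. c)"
  unfolding poly_fun_def by (rule exI[of _ "[:c:]"]) simp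

lemma poly_fun_ident [intro]: "poly_fun (\<lambda>t. t)"
  unfolding poly_fun_def by (rule exI[of _ "[:0, 1:]"]) simp

lemma poly_fun_add [intro]: "poly_fun f \<Longrightarrow> poly_fun g \<Longrightarrow> poly_fun (\<lambda>t. f t + g t)"
  unfolding poly_fun_def by (metis poly_add)

lemma poly_fun_mult [intro]: "poly_fun f \<Longrightarrow> poly_fun g \<Longrightarrow> poly_fun (\<lambda>t. f t * g t)"
  unfolding poly_fun_def by (metis poly_mult)

lemma poly_fun_sum: "(\<And>x. x \<in> S \<Longrightarrow> poly_fun (\<lambda>t. f x t)) \<Longrightarrow> poly_fun (\<lambda>t. \<Sum>x\<in>S. f x t)"
  by (induction S rule: infinite_finite_induct) auto

lemma poly_fun_prod: "(\<And>x. x \<in> S \<Longrightarrow> poly_fun (\<lambda>t. f x t)) \<Longrightarrow> poly_fun (\<lambda>t. \<Prod>x\<in>S. f x t)"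
  by (induction S rule: infinite_finite_induct) auto

lemma poly_fun_power: "poly_fun f \<Longrightarrow> poly_fun (\<lambda>t. f t ^ d)"
  by (induction d) auto

lemma permutes_atLeast0_less: "p permutes {0..<m} \<Longrightarrow> i < m \<Longrightarrow> p i < m" for m :: nat
  by (metis atLeastLessThan_iff permutes_in_image zero_le)

lemma poly_fun_det:
  assumes "\<And>t. A t \<in> carrier_mat m m" "\<And>i j. i < m \<Longrightarrow> j < m \<Longrightarrow> poly_fun (\<lambda>t. A t $$ (i, j))"
  shows "poly_fun (\<lambda>t. det (A t))"
proof -
  have "poly_fun (\<lambda>t. \<Sum>p | p permutes {0..<m}. signof p * (\<Prod>i = 0..<m. A t $$ (i, p i)))"
    by (intro poly_fun_sum poly_fun_mult poly_fun_const poly_fun_prod assms(2))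
      (auto intro: permutes_atLeast0_less)
  then show ?thesis using det_def'[OF assms(1)] by simp
qed

text \<open>A polynomial over an infinite field is determined by its values, and the polynomial ring
  has no zero divisors. Limits of curves and irreducibility of orbits both rest on this.\<close>

lemma poly_fun_zero_prod:
  assumes "poly_fun f" "poly_fun g" "\<And>t. f t * g t = 0"
  shows "(\<forall>t. f t = 0) \<or> (\<forall>t. g t = 0)"
proof -
  obtain p r where p: "\<And>t. f t = poly p t" and r: "\<And>t. g t = poly r t"
    using assms unfolding poly_fun_def by blast
  have "poly (p * r) = poly 0" using assms(3) p r by auto
  then have "p * r = 0" by (simp only: poly_eq_poly_eq_iff)
  then show ?thesis using p r by auto
qed

lemma poly_fun_mult_entries:
  assumes "\<And>t. A t \<in> carrier_mat a b" "\<And>t. B t \<in> carrier_mat b c"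
    and "\<And>i j. i < a \<Longrightarrow> j < b \<Longrightarrow> poly_fun (\<lambda>t. A t $$ (i, j))"
    and "\<And>i j. i < b \<Longrightarrow> j < c \<Longrightarrow> poly_fun (\<lambda>t. B t $$ (i, j))"
    and ij: "i < a" "j < c"
  shows "poly_fun (\<lambda>t. (A t * B t) $$ (i, j))"
proof -
  have "(A t * B t) $$ (i, j) = (\<Sum>k = 0..<b. A t $$ (i, k) * B t $$ (k, j))" for t
    using assms(1)[of t] assms(2)[of t] ij by (auto simp: scalar_prod_def)
  then show ?thesis
    using assms(3,4) ij by (auto intro!: poly_fun_sum)
qed

section \<open>Orbits and the Zariski topology\<close>

lemma mat_tuples_iff:
  "M \<in> mat_tuples n q \<longleftrightarrow> M \<in> extensional {..<n} \<and> (\<forall>\<gamma><n. M \<gamma> \<in> carrier_mat q q)"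
  by (auto simp: mat_tuples_def reps_def PiE_iff)

lemma mat_tuplesD: "M \<in> mat_tuples n q \<Longrightarrow> \<gamma> < n \<Longrightarrow> M \<gamma> \<in> carrier_mat q q"
  by (simp add: mat_tuples_iff)

lemma mat_tuples_dim: "M \<in> mat_tuples n q \<Longrightarrow> \<gamma> < n \<Longrightarrow> dim_col (M \<gamma>) = q"
  using mat_tuplesD by blast

lemma mat_tuples_wf: "M \<in> mat_tuples n q \<Longrightarrow> wf_rep n M"
  unfolding wf_rep_def using mat_tuplesD mat_tuples_dim Suc_mod_less by (metis carrier_matD(1))

lemma nil_reps_mat_tuples: "nil_reps n q k \<subseteq> mat_tuples n q"
  by (auto simp: nil_reps_def)

lemma path_map_square:
  assumes "M \<in> mat_tuples n q" "\<alpha> < n"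
  shows "path_map n M \<alpha> l \<in> carrier_mat q q"
proof -
  have "(\<alpha> + l) mod n < n" using assms(2) by simp
  then show ?thesis
    using path_map_carrier[OF mat_tuples_wf[OF assms(1)] assms(2), of l] mat_tuples_dim[OF assms(1)] assms(2) by simp
qed

lemma mat_inverse_Some:
  fixes g h :: "'a :: field mat"
  assumes g: "g \<in> carrier_mat q q" and h: "h \<in> carrier_mat q q" and gh: "g * h = 1\<^sub>m q"
  shows "mat_inverse g = Some h"
proof -
  have "det g * det h = 1" using det_mult[OF g h] gh by simp
  then have "det g \<noteq> 0" by auto
  then have "mat_inverse g \<noteq> None"
    using mat_inverse(1)[OF g, where b = "()"] det_non_zero_imp_unit[OF g, where b = "()"] by blast
  then obtain k where k: "mat_inverse g = Some k" by blast
  have k': "g * k = 1\<^sub>m q" "k * g = 1\<^sub>m q" "k \<in> carrier_mat q q" using mat_inverse(2)[OF g k] by auto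
  have "h = k * g * h" using k' h by simp
  also have "\<dots> = k * (g * h)" by (rule assoc_mult_mat[OF k'(3) g h])
  also have "\<dots> = k" unfolding gh by (rule right_mult_one_mat[OF k'(3)])
  finally show ?thesis using k by simp
qed

lemma invertible_mat_inverse:
  fixes g :: "'a :: field mat"
  assumes g: "g \<in> carrier_mat q q" and "invertible_mat g"
  obtains h where "h \<in> carrier_mat q q" "g * h = 1\<^sub>m q" "h * g = 1\<^sub>m q" "mat_inverse g = Some h"
proof -
  obtain h where h: "g * h = 1\<^sub>m (dim_row g)" "h * g = 1\<^sub>m (dim_row h)"
    using assms(2) unfolding invertible_mat_def inverts_mat_def by blast
  have "dim_row h = q" using arg_cong[OF h(2), of dim_col] g by auto
  moreover have "dim_col h = q" using arg_cong[OF h(1), of dim_col] g by auto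
  ultimately have "h \<in> carrier_mat q q" by blast
  moreover have "g * h = 1\<^sub>m q" "h * g = 1\<^sub>m q" using h g \<open>dim_row h = q\<close> by auto
  ultimately show thesis using that mat_inverse_Some[OF g] by blast
qed

lemma GL_orbit_eq:
  assumes M: "M \<in> mat_tuples n q"
  shows "GL_orbit n q M = {N \<in> mat_tuples n q. rep_iso n M N}"
proof (intro Set.set_eqI iffI)
  fix N assume "N \<in> GL_orbit n q M"
  then obtain g where g: "g \<in> GL_tuples n q" "N = GL_act n g M" by (auto simp: GL_orbit_def)
  have gc: "g \<gamma> \<in> carrier_mat q q" "invertible_mat (g \<gamma>)" if "\<gamma> < n" for \<gamma>
    using g(1) that by (auto simp: GL_tuples_def PiE_iff)
  define h where "h \<gamma> = the (mat_inverse (g \<gamma>))" for \<gamma>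
  have h: "h \<gamma> \<in> carrier_mat q q" "g \<gamma> * h \<gamma> = 1\<^sub>m q" "h \<gamma> * g \<gamma> = 1\<^sub>m q" if "\<gamma> < n" for \<gamma>
    using invertible_mat_inverse[OF gc[OF that]] unfolding h_def by (metis option.sel)+
  have N: "N \<gamma> = g (Suc \<gamma> mod n) * M \<gamma> * h \<gamma>" if "\<gamma> < n" for \<gamma>
    using that by (simp add: g(2) GL_act_def h_def)
  have gM: "g (Suc \<gamma> mod n) * M \<gamma> \<in> carrier_mat q q" if "\<gamma> < n" for \<gamma>
    by (rule mult_carrier_mat[OF gc(1)[OF Suc_mod_less[OF that]] mat_tuplesD[OF M that]])
  have Nc: "N \<gamma> \<in> carrier_mat q q" if "\<gamma> < n" for \<gamma>
    unfolding N[OF that] by (rule mult_carrier_mat[OF gM[OF that] h(1)[OF that]])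
  then have N_in: "N \<in> mat_tuples n q" by (auto simp: mat_tuples_iff g(2) GL_act_def)
  have "iso_pair n M N g h"
  proof (rule iso_pairI)
    fix \<gamma> assume \<gamma>: "\<gamma> < n"
    show "g \<gamma> \<in> carrier_mat (dim_col (N \<gamma>)) (dim_col (M \<gamma>))" "h \<gamma> \<in> carrier_mat (dim_col (M \<gamma>)) (dim_col (N \<gamma>))"
      "g \<gamma> * h \<gamma> = 1\<^sub>m (dim_col (N \<gamma>))" "h \<gamma> * g \<gamma> = 1\<^sub>m (dim_col (M \<gamma>))"
      unfolding mat_tuples_dim[OF M \<gamma>] mat_tuples_dim[OF N_in \<gamma>] using gc h \<gamma> by auto
    have "N \<gamma> * g \<gamma> = g (Suc \<gamma> mod n) * M \<gamma> * (h \<gamma> * g \<gamma>)"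
      unfolding N[OF \<gamma>] by (rule assoc_mult_mat[OF gM[OF \<gamma>] h(1)[OF \<gamma>] gc(1)[OF \<gamma>]])
    then show "g (Suc \<gamma> mod n) * M \<gamma> = N \<gamma> * g \<gamma>"
      unfolding h(3)[OF \<gamma>] using right_mult_one_mat[OF gM[OF \<gamma>]] by simp
  qed
  then show "N \<in> {N \<in> mat_tuples n q. rep_iso n M N}" using N_in rep_isoI by blast
next
  fix N assume "N \<in> {N \<in> mat_tuples n q. rep_iso n M N}"
  then have N: "N \<in> mat_tuples n q" and "rep_iso n M N" by auto
  then obtain g where g: "\<And>\<gamma>. \<gamma> < n \<Longrightarrow> g \<gamma> \<in> carrier_mat (dim_col (N \<gamma>)) (dim_col (M \<gamma>)) \<and> invertible_mat (g \<gamma>)"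
    "\<And>\<gamma>. \<gamma> < n \<Longrightarrow> g (Suc \<gamma> mod n) * M \<gamma> = N \<gamma> * g \<gamma>"
    unfolding rep_iso_def by blast
  have gc: "g \<gamma> \<in> carrier_mat q q" "invertible_mat (g \<gamma>)" if "\<gamma> < n" for \<gamma>
    using g(1)[OF that] mat_tuples_dim[OF M that] mat_tuples_dim[OF N that] by auto
  define g' where "g' = restrict g {..<n}"
  have "g' \<in> GL_tuples n q" using gc by (auto simp: GL_tuples_def g'_def)
  moreover have "N = GL_act n g' M"
  proof
    fix \<gamma>
    show "N \<gamma> = GL_act n g' M \<gamma>"
    proof (cases "\<gamma> < n")
      case \<gamma>: True
      obtain h where h: "h \<in> carrier_mat q q" "g \<gamma> * h = 1\<^sub>m q" "mat_inverse (g \<gamma>) = Some h"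
        using invertible_mat_inverse[OF gc[OF \<gamma>]] by metis
      have "GL_act n g' M \<gamma> = N \<gamma> * g \<gamma> * h" using \<gamma> h(3) g(2)[OF \<gamma>] by (simp add: GL_act_def g'_def)
      also have "\<dots> = N \<gamma> * (g \<gamma> * h)" by (rule assoc_mult_mat[OF mat_tuplesD[OF N \<gamma>] gc(1)[OF \<gamma>] h(1)])
      also have "\<dots> = N \<gamma>" unfolding h(2) by (rule right_mult_one_mat[OF mat_tuplesD[OF N \<gamma>]])
      finally show ?thesis by simp
    next
      case False
      then show ?thesis using N by (auto simp: mat_tuples_iff GL_act_def extensional_def)
    qed
  qed
  ultimately show "N \<in> GL_orbit n q M" by (auto simp: GL_orbit_def)
qed

section \<open>Zariski closures and polynomial functions on tuples\<close>

lemma closure_of_zariski: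
  assumes S: "S \<subseteq> mat_tuples n q"
  shows "X \<in> zariski n q closure_of S \<longleftrightarrow>
    X \<in> mat_tuples n q \<and> (\<forall>f\<in>poly_funs n q. (\<forall>Y\<in>S. f Y = 0) \<longrightarrow> f X = 0)"
proof
  assume X: "X \<in> zariski n q closure_of S"
  then have "X \<in> mat_tuples n q" using closure_of_subset_topspace[of "zariski n q" S] by (auto simp: topspace_zariski)
  moreover have "f X = 0" if f: "f \<in> poly_funs n q" "\<forall>Y\<in>S. f Y = 0" for f
  proof -
    have "closedin (zariski n q) (zero_locus n q {f})" using f(1) closedin_zariski by blast
    moreover have "S \<subseteq> zero_locus n q {f}" using S f(2) by (auto simp: zero_locus_def)
    ultimately have "zariski n q closure_of S \<subseteq> zero_locus n q {f}" by (rule closure_of_minimal[rotated])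
    then show ?thesis using X by (auto simp: zero_locus_def)
  qed
  ultimately show "X \<in> mat_tuples n q \<and> (\<forall>f\<in>poly_funs n q. (\<forall>Y\<in>S. f Y = 0) \<longrightarrow> f X = 0)" by blast
next
  assume X: "X \<in> mat_tuples n q \<and> (\<forall>f\<in>poly_funs n q. (\<forall>Y\<in>S. f Y = 0) \<longrightarrow> f X = 0)"
  obtain F where F: "F \<subseteq> poly_funs n q" "zariski n q closure_of S = zero_locus n q F"
    using closedin_closure_of[of "zariski n q" S] closedin_zariski by metis
  have "S \<subseteq> zero_locus n q F" using closure_of_subset[of S "zariski n q"] S topspace_zariski F(2) by metis
  then have "f Y = 0" if "f \<in> F" "Y \<in> S" for f Y using that by (auto simp: zero_locus_def)
  then have "f X = 0" if "f \<in> F" for f using X F(1) that by blast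
  then show "X \<in> zariski n q closure_of S" using X by (auto simp: F(2) zero_locus_def)
qed

lemma irreducible_in_closure_of:
  assumes "irreducible_in T S"
  shows "irreducible_in T (T closure_of S)"
  unfolding irreducible_in_def
proof (intro conjI allI impI)
  have S: "S \<subseteq> topspace T" "S \<noteq> {}" using assms by (auto simp: irreducible_in_def)
  show "T closure_of S \<subseteq> topspace T" by (rule closure_of_subset_topspace)
  show "T closure_of S \<noteq> {}" using S closure_of_subset by blast
  fix A B assume AB: "closedin T A \<and> closedin T B \<and> T closure_of S \<subseteq> A \<union> B"
  then have "S \<subseteq> A \<union> B" using closure_of_subset[OF S(1)] by blast
  then have "S \<subseteq> A \<or> S \<subseteq> B" using assms AB unfolding irreducible_in_def by blast
  then show "T closure_of S \<subseteq> A \<or> T closure_of S \<subseteq> B" using AB closure_of_minimal by metis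
qed

text \<open>Elements of \<open>poly_funs\<close> are functions on all tuples of matrices of any size; only their
  values on \<open>mat_tuples n q\<close> matter.\<close>

definition poly_on :: "nat \<Rightarrow> nat \<Rightarrow> (rep \<Rightarrow> complex) \<Rightarrow> bool" where
  "poly_on n q f \<longleftrightarrow> (\<exists>p\<in>poly_funs n q. \<forall>X\<in>mat_tuples n q. f X = p X)"

lemma poly_on_const: "poly_on n q (\<lambda>_. c)"
  unfolding poly_on_def by (auto intro: poly_funs.const)

lemma poly_on_add:
  assumes "poly_on n q f" "poly_on n q g"
  shows "poly_on n q (\<lambda>X. f X + g X)"
proof -
  obtain p r where "p \<in> poly_funs n q" "r \<in> poly_funs n q"
    "\<And>X. X \<in> mat_tuples n q \<Longrightarrow> f X = p X" "\<And>X. X \<in> mat_tuples n q \<Longrightarrow> g X = r X"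
    using assms unfolding poly_on_def by blast
  then show ?thesis
    unfolding poly_on_def by (intro bexI[of _ "\<lambda>X. p X + r X"] poly_funs.add) auto
qed

lemma poly_on_mult:
  assumes "poly_on n q f" "poly_on n q g"
  shows "poly_on n q (\<lambda>X. f X * g X)"
proof -
  obtain p r where "p \<in> poly_funs n q" "r \<in> poly_funs n q"
    "\<And>X. X \<in> mat_tuples n q \<Longrightarrow> f X = p X" "\<And>X. X \<in> mat_tuples n q \<Longrightarrow> g X = r X"
    using assms unfolding poly_on_def by blast
  then show ?thesis
    unfolding poly_on_def by (intro bexI[of _ "\<lambda>X. p X * r X"] poly_funs.mult) auto
qed

lemma poly_on_sum: "(\<And>x. x \<in> S \<Longrightarrow> poly_on n q (f x)) \<Longrightarrow> poly_on n q (\<lambda>X. \<Sum>x\<in>S. f x X)"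
  by (induction S rule: infinite_finite_induct) (auto intro: poly_on_const poly_on_add)

lemma poly_on_prod: "(\<And>x. x \<in> S \<Longrightarrow> poly_on n q (f x)) \<Longrightarrow> poly_on n q (\<lambda>X. \<Prod>x\<in>S. f x X)"
  by (induction S rule: infinite_finite_induct) (auto intro: poly_on_const poly_on_mult)

lemma poly_on_cong: "poly_on n q f \<Longrightarrow> (\<And>X. X \<in> mat_tuples n q \<Longrightarrow> g X = f X) \<Longrightarrow> poly_on n q g"
  unfolding poly_on_def by auto

lemma poly_on_mult_entries:
  assumes "\<And>X. X \<in> mat_tuples n q \<Longrightarrow> A X \<in> carrier_mat a b" "\<And>X. X \<in> mat_tuples n q \<Longrightarrow> B X \<in> carrier_mat b c"
    and "\<And>i j. i < a \<Longrightarrow> j < b \<Longrightarrow> poly_on n q (\<lambda>X. A X $$ (i, j))"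
    and "\<And>i j. i < b \<Longrightarrow> j < c \<Longrightarrow> poly_on n q (\<lambda>X. B X $$ (i, j))"
    and ij: "i < a" "j < c"
  shows "poly_on n q (\<lambda>X. (A X * B X) $$ (i, j))"
proof (rule poly_on_cong)
  show "poly_on n q (\<lambda>X. \<Sum>k = 0..<b. A X $$ (i, k) * B X $$ (k, j))"
    using assms(3,4) ij by (auto intro!: poly_on_sum poly_on_mult)
  show "(A X * B X) $$ (i, j) = (\<Sum>k = 0..<b. A X $$ (i, k) * B X $$ (k, j))" if "X \<in> mat_tuples n q" for X
    using assms(1)[OF that] assms(2)[OF that] ij by (auto simp: scalar_prod_def)
qed

lemma poly_on_path_map:
  assumes "\<alpha> < n" "i < q" "j < q"
  shows "poly_on n q (\<lambda>X. path_map n X \<alpha> l $$ (i, j))"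
  using assms(2,3)
proof (induction l arbitrary: i j)
  case 0
  show ?case
    by (rule poly_on_cong[OF poly_on_const[of n q "of_bool (i = j)"]])
      (use 0 assms in \<open>simp add: mat_tuples_dim\<close>)
next
  case (Suc l)
  have b: "(\<alpha> + l) mod n < n" using assms(1) by simp
  show ?case
    unfolding path_map.simps
  proof (rule poly_on_mult_entries[of n q _ q q _ q])
    show "poly_on n q (\<lambda>X. X ((\<alpha> + l) mod n) $$ (i, j))" if "i < q" "j < q" for i j
      unfolding poly_on_def by (intro bexI[OF _ poly_funs.coord[OF b that]]) simp
  qed (use Suc assms b in \<open>auto intro: mat_tuplesD path_map_square\<close>)
qed

lemma poly_on_det:
  assumes "\<And>X. X \<in> mat_tuples n q \<Longrightarrow> A X \<in> carrier_mat m m"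
    "\<And>i j. i < m \<Longrightarrow> j < m \<Longrightarrow> poly_on n q (\<lambda>X. A X $$ (i, j))"
  shows "poly_on n q (\<lambda>X. det (A X))"
proof (rule poly_on_cong)
  show "poly_on n q (\<lambda>X. \<Sum>p | p permutes {0..<m}. signof p * (\<Prod>i = 0..<m. A X $$ (i, p i)))"
    by (intro poly_on_sum poly_on_mult poly_on_const poly_on_prod assms(2)) (auto intro: permutes_atLeast0_less)
qed (use det_def'[OF assms(1)] in simp)

lemma closedin_nil_reps: "closedin (zariski n q) (nil_reps n q k)"
proof -
  \<comment> \<open>All polynomials vanishing on the set are taken, because the entries of path maps
    agree with members of \<open>poly_funs\<close> only on \<open>mat_tuples n q\<close>, and an
    agreeing polynomial is chosen when needed.\<close>
  define F where "F = {p \<in> poly_funs n q. \<forall>X\<in>nil_reps n q k. p X = 0}"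
  have "nil_reps n q k = zero_locus n q F"
  proof (intro Set.set_eqI iffI)
    fix X assume "X \<in> nil_reps n q k"
    then show "X \<in> zero_locus n q F" using nil_reps_mat_tuples by (auto simp: F_def zero_locus_def)
  next
    fix X assume "X \<in> zero_locus n q F"
    then have X: "X \<in> mat_tuples n q" "\<And>p. p \<in> F \<Longrightarrow> p X = 0" by (auto simp: zero_locus_def)
    have "nilpotent_rep n k X"
      unfolding nilpotent_rep_def
    proof (intro allI impI eq_matI)
      fix \<alpha> l i j assume \<alpha>: "\<alpha> < n" and l: "k \<le> l"
        and ij': "i < dim_row (0\<^sub>m (dim_col (X ((\<alpha> + l) mod n))) (dim_col (X \<alpha>)))"
        "j < dim_col (0\<^sub>m (dim_col (X ((\<alpha> + l) mod n))) (dim_col (X \<alpha>)))"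
      have b: "(\<alpha> + l) mod n < n" using \<alpha> by simp
      have ij: "i < q" "j < q" using ij' mat_tuples_dim[OF X(1)] \<alpha> b by auto
      obtain p where p: "p \<in> poly_funs n q" "\<And>Y. Y \<in> mat_tuples n q \<Longrightarrow> path_map n Y \<alpha> l $$ (i, j) = p Y"
        using poly_on_path_map[OF \<alpha> ij, of l] unfolding poly_on_def by blast
      have "p Y = 0" if "Y \<in> nil_reps n q k" for Y
      proof -
        have Y: "Y \<in> mat_tuples n q" "nilpotent_rep n k Y" using that by (auto simp: nil_reps_def)
        then have "path_map n Y \<alpha> l = 0\<^sub>m q q"
          using \<alpha> l b unfolding nilpotent_rep_def by (simp add: mat_tuples_dim[OF Y(1)])
        then show ?thesis using p(2)[OF Y(1)] ij by simp
      qed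
      then have "p \<in> F" using p(1) by (simp add: F_def)
      then show "path_map n X \<alpha> l $$ (i, j) = 0\<^sub>m (dim_col (X ((\<alpha> + l) mod n))) (dim_col (X \<alpha>)) $$ (i, j)"
        using X p(2)[OF X(1)] ij' by simp
    qed (use path_map_carrier[OF mat_tuples_wf[OF X(1)]] in auto)
    then show "X \<in> nil_reps n q k" using X(1) by (simp add: nil_reps_def)
  qed
  then show ?thesis unfolding closedin_zariski by (intro exI[of _ F]) (auto simp: F_def)
qed

lemma poly_funs_along_curve:
  assumes "f \<in> poly_funs n q"
    and "\<And>\<alpha> i j. \<alpha> < n \<Longrightarrow> i < q \<Longrightarrow> j < q \<Longrightarrow> poly_fun (\<lambda>t. X t \<alpha> $$ (i, j))"
  shows "poly_fun (\<lambda>t. f (X t))"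
  using assms by (induction rule: poly_funs.induct) auto

text \<open>A polynomial vanishing on \<open>S\<close> becomes a polynomial in \<open>t\<close> that
  is zero for all nonzero \<open>t\<close>. Its product with \<open>t\<close> vanishes identically,
  and the factor \<open>t\<close> does not.\<close>

lemma curve_limit_in_closure:
  assumes S: "S \<subseteq> mat_tuples n q" and X0: "X 0 \<in> mat_tuples n q"
    and poly: "\<And>\<alpha> i j. \<alpha> < n \<Longrightarrow> i < q \<Longrightarrow> j < q \<Longrightarrow> poly_fun (\<lambda>t. X t \<alpha> $$ (i, j))"
    and XS: "\<And>t. t \<noteq> 0 \<Longrightarrow> X t \<in> S"
  shows "X 0 \<in> zariski n q closure_of S"
  unfolding closure_of_zariski[OF S]
proof (intro conjI ballI impI)
  fix f assume f: "f \<in> poly_funs n q" "\<forall>Y\<in>S. f Y = 0"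
  have pf: "poly_fun (\<lambda>t. f (X t))" by (rule poly_funs_along_curve[OF f(1) poly])
  have "f (X t) * t = 0" for t using f(2) XS by (cases "t = 0") auto
  then have "(\<forall>t. f (X t) = 0) \<or> (\<forall>t::complex. t = 0)"
    using poly_fun_zero_prod[OF pf poly_fun_ident] by blast
  then show "f (X 0) = 0" using one_neq_zero by blast
qed (rule X0)

text \<open>Along a line of tuples \<open>c t\<close> in the group, a polynomial in \<open>c t \<cdot> M\<close> becomes a polynomial in \<open>t\<close>
  after multiplication by a power of the product \<open>\<Delta> t\<close> of the determinants.\<close>

lemma irreducible_GL_orbit:
  assumes M: "M \<in> mat_tuples n q"
  shows "irreducible_in (zariski n q) (GL_orbit n q M)"
  unfolding irreducible_in_def topspace_zariski
proof (intro conjI allI impI)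
  show sub: "GL_orbit n q M \<subseteq> mat_tuples n q" using GL_orbit_eq[OF M] by blast
  have "M \<in> GL_orbit n q M" using GL_orbit_eq[OF M] M rep_iso_refl[OF mat_tuples_wf[OF M]] by blast
  then show "GL_orbit n q M \<noteq> {}" by blast
  fix A B assume AB: "closedin (zariski n q) A \<and> closedin (zariski n q) B \<and> GL_orbit n q M \<subseteq> A \<union> B"
  show "GL_orbit n q M \<subseteq> A \<or> GL_orbit n q M \<subseteq> B"
  proof (rule ccontr)
    assume "\<not> ?thesis"
    then obtain Y Z where YZ: "Y \<in> GL_orbit n q M" "Y \<notin> A" "Z \<in> GL_orbit n q M" "Z \<notin> B" by blast
    obtain F G where F: "F \<subseteq> poly_funs n q" "A = zero_locus n q F"
      and G: "G \<subseteq> poly_funs n q" "B = zero_locus n q G"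
      using AB unfolding closedin_zariski by blast
    obtain f where f: "f \<in> F" "f Y \<noteq> 0" using YZ(1,2) sub unfolding F(2) zero_locus_def by blast
    obtain f' where f': "f' \<in> G" "f' Z \<noteq> 0" using YZ(3,4) sub unfolding G(2) zero_locus_def by blast
    obtain g k where g: "g \<in> GL_tuples n q" "Y = GL_act n g M" and k: "k \<in> GL_tuples n q" "Z = GL_act n k M"
      using YZ unfolding GL_orbit_def by blast
    have gc: "g \<gamma> \<in> carrier_mat q q" "invertible_mat (g \<gamma>)" if "\<gamma> < n" for \<gamma>
      using g(1) that by (auto simp: GL_tuples_def PiE_iff)
    have kc: "k \<gamma> \<in> carrier_mat q q" "invertible_mat (k \<gamma>)" if "\<gamma> < n" for \<gamma>
      using k(1) that by (auto simp: GL_tuples_def PiE_iff)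
    \<comment> \<open>The line from \<open>g\<close> at 0 to \<open>k\<close> at 1. It may leave the
      group, but only at zeros of the polynomial \<open>\<Delta>\<close>, and neither end is
      one.\<close>
    define c where "c t = (\<lambda>\<gamma>\<in>{..<n}. mat q q (\<lambda>ij. g \<gamma> $$ ij + t * (k \<gamma> $$ ij - g \<gamma> $$ ij)))" for t :: complex
    have cc: "c t \<gamma> \<in> carrier_mat q q" if "\<gamma> < n" for t \<gamma> using that by (simp add: c_def)
    have c_poly: "poly_fun (\<lambda>t. c t \<gamma> $$ (i, j))" if "\<gamma> < n" "i < q" "j < q" for \<gamma> i j
      using that by (auto simp: c_def intro!: poly_fun_add poly_fun_mult poly_fun_const poly_fun_ident)
    have c0: "c 0 = g"
    proof
      fix \<gamma> show "c 0 \<gamma> = g \<gamma>"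
      proof (cases "\<gamma> < n")
        case True
        then show ?thesis using gc(1)[OF True] by (intro eq_matI) (auto simp: c_def)
      next
        case False
        then show ?thesis using g(1) by (auto simp: c_def GL_tuples_def PiE_iff extensional_def)
      qed
    qed
    have c1: "c 1 = k"
    proof
      fix \<gamma> show "c 1 \<gamma> = k \<gamma>"
      proof (cases "\<gamma> < n")
        case True
        then show ?thesis using kc(1)[OF True] by (intro eq_matI) (auto simp: c_def)
      next
        case False
        then show ?thesis using k(1) by (auto simp: c_def GL_tuples_def PiE_iff extensional_def)
      qed
    qed
    define \<Delta> where "\<Delta> t = (\<Prod>\<gamma><n. det (c t \<gamma>))" for t
    have \<Delta>_poly: "poly_fun \<Delta>"
      unfolding \<Delta>_def by (intro poly_fun_prod poly_fun_det[of _ q] cc c_poly) auto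
    have det_nz: "det h \<noteq> 0" if h: "h \<in> carrier_mat q q" "invertible_mat h" for h :: "complex mat"
    proof -
      obtain h' where "h' \<in> carrier_mat q q" "h * h' = 1\<^sub>m q" using invertible_mat_inverse[OF h] by metis
      then have "det h * det h' = 1" using det_mult[OF h(1)] by (metis det_one)
      then show ?thesis by auto
    qed
    have \<Delta>01: "\<Delta> 0 \<noteq> 0" "\<Delta> 1 \<noteq> 0" using det_nz gc kc by (auto simp: \<Delta>_def c0 c1)
    have inv: "mat_inverse (c t \<gamma>) = Some (inverse (det (c t \<gamma>)) \<cdot>\<^sub>m adj_mat (c t \<gamma>))"
      if "\<Delta> t \<noteq> 0" "\<gamma> < n" for t \<gamma>
    proof (rule mat_inverse_Some[OF cc[OF that(2)]])
      have d: "det (c t \<gamma>) \<noteq> 0" using that by (auto simp: \<Delta>_def)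
      note adj = adj_mat[OF cc[OF that(2), of t]]
      show "inverse (det (c t \<gamma>)) \<cdot>\<^sub>m adj_mat (c t \<gamma>) \<in> carrier_mat q q" using adj(1) by simp
      have "c t \<gamma> * (inverse (det (c t \<gamma>)) \<cdot>\<^sub>m adj_mat (c t \<gamma>)) = inverse (det (c t \<gamma>)) \<cdot>\<^sub>m (c t \<gamma> * adj_mat (c t \<gamma>))"
        by (rule mult_smult_distrib[OF cc[OF that(2)] adj(1)])
      also have "\<dots> = 1\<^sub>m q" unfolding adj(2) using d by (intro eq_matI) auto
      finally show "c t \<gamma> * (inverse (det (c t \<gamma>)) \<cdot>\<^sub>m adj_mat (c t \<gamma>)) = 1\<^sub>m q" .
    qed
    have c_GL: "c t \<in> GL_tuples n q" if "\<Delta> t \<noteq> 0" for t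
    proof -
      have "invertible_mat (c t \<gamma>)" if \<gamma>: "\<gamma> < n" for \<gamma>
      proof -
        have "c t \<gamma> * the (mat_inverse (c t \<gamma>)) = 1\<^sub>m q" "the (mat_inverse (c t \<gamma>)) * c t \<gamma> = 1\<^sub>m q"
          "the (mat_inverse (c t \<gamma>)) \<in> carrier_mat q q"
          using mat_inverse(2)[OF cc[OF \<gamma>] inv[OF \<open>\<Delta> t \<noteq> 0\<close> \<gamma>]] inv[OF \<open>\<Delta> t \<noteq> 0\<close> \<gamma>] by auto
        then show ?thesis
          using cc[OF \<gamma>, of t] unfolding invertible_mat_def inverts_mat_def by auto
      qed
      then show ?thesis using cc by (auto simp: GL_tuples_def c_def)
    qed
    have adj_poly: "poly_fun (\<lambda>t. adj_mat (c t \<gamma>) $$ (i, j))" if "\<gamma> < n" "i < q" "j < q" for \<gamma> i j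
    proof -
      have "adj_mat (c t \<gamma>) $$ (i, j) = (-1) ^ (j + i) * det (mat_delete (c t \<gamma>) j i)" for t
        using cc[OF that(1), of t] that by (simp add: adj_mat_def cofactor_def)
      moreover have "poly_fun (\<lambda>t. det (mat_delete (c t \<gamma>) j i))"
      proof (rule poly_fun_det[of _ "q - 1"])
        show "mat_delete (c t \<gamma>) j i \<in> carrier_mat (q - 1) (q - 1)" for t
          by (rule mat_delete_carrier[OF cc[OF that(1)]])
        fix a b assume ab: "a < q - 1" "b < q - 1"
        have "mat_delete (c t \<gamma>) j i $$ (a, b) =
            c t \<gamma> $$ (if a < j then a else Suc a, if b < i then b else Suc b)" for t
          using cc[OF that(1), of t] ab unfolding mat_delete_def by auto
        then show "poly_fun (\<lambda>t. mat_delete (c t \<gamma>) j i $$ (a, b))"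
          using c_poly[OF that(1)] ab by simp
      qed
      ultimately show ?thesis by (simp add: poly_fun_mult poly_fun_const)
    qed
    have along: "\<exists>d P. poly_fun P \<and> (\<forall>t. \<Delta> t \<noteq> 0 \<longrightarrow> p (GL_act n (c t) M) * \<Delta> t ^ d = P t)"
      if "p \<in> poly_funs n q" for p
      using that
    proof (induction rule: poly_funs.induct)
      case (const a)
      show ?case by (intro exI[of _ 0] exI[of _ "\<lambda>_. a"]) auto
    next
      case (coord \<alpha> i j)
      let ?s = "Suc \<alpha> mod n"
      have s: "?s < n" using coord by simp
      \<comment> \<open>By Cramer's rule the inverse at \<open>\<alpha>\<close> is the adjugate
        divided by one determinant. Multiplying by \<open>\<Delta> t\<close> cancels this
        determinant and leaves those at the other vertices as a factor.\<close>
      define P where "P t = (c t ?s * M \<alpha> * adj_mat (c t \<alpha>)) $$ (i, j) * (\<Prod>\<gamma>\<in>{..<n} - {\<alpha>}. det (c t \<gamma>))" for t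
      note cM = mult_carrier_mat[OF cc[OF s] mat_tuplesD[OF M coord(1)]]
      have "poly_fun P"
        unfolding P_def
      proof (intro poly_fun_mult)
        show "poly_fun (\<lambda>t. (c t ?s * M \<alpha> * adj_mat (c t \<alpha>)) $$ (i, j))"
        proof (rule poly_fun_mult_entries[of _ q q _ q])
          show "poly_fun (\<lambda>t. (c t ?s * M \<alpha>) $$ (i, j))" if "i < q" "j < q" for i j
            by (rule poly_fun_mult_entries[of _ q q _ q])
              (use that cc[OF s] mat_tuplesD[OF M coord(1)] c_poly[OF s] in auto)
        qed (use cM adj_mat(1)[OF cc[OF coord(1)]] adj_poly coord in auto)
        show "poly_fun (\<lambda>t. \<Prod>\<gamma>\<in>{..<n} - {\<alpha>}. det (c t \<gamma>))"
          by (intro poly_fun_prod poly_fun_det[of _ q] cc c_poly) auto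
      qed
      moreover have "GL_act n (c t) M \<alpha> $$ (i, j) * \<Delta> t ^ 1 = P t" if t: "\<Delta> t \<noteq> 0" for t
      proof -
        have d: "det (c t \<alpha>) \<noteq> 0" using t coord(1) by (auto simp: \<Delta>_def)
        have "GL_act n (c t) M \<alpha> = c t ?s * M \<alpha> * (inverse (det (c t \<alpha>)) \<cdot>\<^sub>m adj_mat (c t \<alpha>))"
          using coord(1) inv[OF t coord(1)] by (simp add: GL_act_def)
        also have "\<dots> = inverse (det (c t \<alpha>)) \<cdot>\<^sub>m (c t ?s * M \<alpha> * adj_mat (c t \<alpha>))"
          by (rule mult_smult_distrib[OF cM adj_mat(1)[OF cc[OF coord(1)]]])
        finally have "GL_act n (c t) M \<alpha> $$ (i, j) = inverse (det (c t \<alpha>)) * (c t ?s * M \<alpha> * adj_mat (c t \<alpha>)) $$ (i, j)"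
          using coord cc[OF s, of t] adj_mat(1)[OF cc[OF coord(1), of t]] by simp
        moreover have "\<Delta> t = det (c t \<alpha>) * (\<Prod>\<gamma>\<in>{..<n} - {\<alpha>}. det (c t \<gamma>))"
          unfolding \<Delta>_def using coord(1) by (intro prod.remove) auto
        ultimately show ?thesis using d by (simp add: P_def)
      qed
      ultimately show ?case by blast
    next
      case (add p r)
      then obtain d P e R where "poly_fun P" "poly_fun R"
        "\<And>t. \<Delta> t \<noteq> 0 \<Longrightarrow> p (GL_act n (c t) M) * \<Delta> t ^ d = P t"
        "\<And>t. \<Delta> t \<noteq> 0 \<Longrightarrow> r (GL_act n (c t) M) * \<Delta> t ^ e = R t" by blast
      then show ?case
        by (intro exI[of _ "d + e"] exI[of _ "\<lambda>t. P t * \<Delta> t ^ e + R t * \<Delta> t ^ d"])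
          (auto simp: algebra_simps power_add poly_fun_power \<Delta>_poly intro!: poly_fun_add poly_fun_mult)
    next
      case (mult p r)
      then obtain d P e R where PR: "poly_fun P" "poly_fun R"
        "\<And>t. \<Delta> t \<noteq> 0 \<Longrightarrow> p (GL_act n (c t) M) * \<Delta> t ^ d = P t"
        "\<And>t. \<Delta> t \<noteq> 0 \<Longrightarrow> r (GL_act n (c t) M) * \<Delta> t ^ e = R t" by blast
      then show ?case
        by (intro exI[of _ "d + e"] exI[of _ "\<lambda>t. P t * R t"])
          (auto simp: power_add mult_ac PR(3,4)[symmetric] intro!: poly_fun_mult)
    qed
    obtain d P where P: "poly_fun P" "\<And>t. \<Delta> t \<noteq> 0 \<Longrightarrow> f (GL_act n (c t) M) * \<Delta> t ^ d = P t"
      using along f(1) F(1) by blast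
    obtain e R where R: "poly_fun R" "\<And>t. \<Delta> t \<noteq> 0 \<Longrightarrow> f' (GL_act n (c t) M) * \<Delta> t ^ e = R t"
      using along f'(1) G(1) by blast
    \<comment> \<open>For \<open>\<Delta> t \<noteq> 0\<close> the tuple lies in the orbit, hence in
      \<open>A\<close> or in \<open>B\<close>. The third factor takes care of the remaining
      \<open>t\<close>, where the point need not belong to the orbit.\<close>
    have "P t * R t * \<Delta> t = 0" for t
    proof (cases "\<Delta> t = 0")
      case False
      have "GL_act n (c t) M \<in> A \<union> B" using AB c_GL[OF False] unfolding GL_orbit_def by blast
      then have "f (GL_act n (c t) M) = 0 \<or> f' (GL_act n (c t) M) = 0"
        using f(1) f'(1) unfolding F(2) G(2) zero_locus_def by blast
      then show ?thesis using P(2)[OF False] R(2)[OF False] by auto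
    qed simp
    then have "(\<forall>t. P t = 0) \<or> (\<forall>t. R t = 0) \<or> (\<forall>t. \<Delta> t = 0)"
      using poly_fun_zero_prod[OF poly_fun_mult[OF P(1) R(1)] \<Delta>_poly] poly_fun_zero_prod[OF P(1) R(1)] by blast
    moreover have "P 0 \<noteq> 0" using P(2)[OF \<Delta>01(1)] f(2) \<Delta>01(1) by (auto simp: c0 g(2))
    moreover have "R 1 \<noteq> 0" using R(2)[OF \<Delta>01(2)] f'(2) \<Delta>01(2) by (auto simp: c1 k(2))
    ultimately show False using \<Delta>01 by blast
  qed
qed

section \<open>The rank order\<close>

lemma nil_rep_intervals:
  assumes "M \<in> nil_reps n q (n - 1)"
  obtains xs where "valid_ivls n xs" "rep_iso n M (ivl_sum n xs)"
    "\<And>\<gamma> l. \<gamma> < n \<Longrightarrow> has_rank (path_map n M \<gamma> l) (path_count n xs \<gamma> l)"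
proof -
  have wf: "wf_rep n M" and nil: "nilpotent_rep n (n - 1) M"
    using assms mat_tuples_wf by (auto simp: nil_reps_def)
  obtain xs where xs: "valid_ivls n xs" "rep_iso n M (ivl_sum n xs)"
    using interval_decomposition[OF wf nil] by blast
  have "has_rank (path_map n M \<gamma> l) (path_count n xs \<gamma> l)" if "\<gamma> < n" for \<gamma> l
    by (rule has_rank_path_map_iso[OF wf_ivl_sum wf that rep_iso_sym[OF xs(2) wf wf_ivl_sum]
          has_rank_path_map_ivl_sum[OF _ that]]) (use xs(1) in \<open>auto simp: valid_ivls_def\<close>)
  then show thesis using that xs by blast
qed

lemma has_rank_unique: "has_rank A r \<Longrightarrow> has_rank A s \<Longrightarrow> r = s"
  using has_rank_rank by metis

lemma rk_le_iff:
  assumes "\<And>\<gamma> l. \<gamma> < n \<Longrightarrow> has_rank (path_map n M \<gamma> l) (f \<gamma> l)"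
    "\<And>\<gamma> l. \<gamma> < n \<Longrightarrow> has_rank (path_map n N \<gamma> l) (g \<gamma> l)"
  shows "rk_le n M N \<longleftrightarrow> (\<forall>\<gamma><n. \<forall>l. f \<gamma> l \<le> g \<gamma> l)"
  unfolding rk_le_def using has_rank_rank[OF assms(1)] has_rank_rank[OF assms(2)] by simp

lemma rk_le_antisym:
  assumes M: "M \<in> nil_reps n q (n - 1)" and N: "N \<in> nil_reps n q (n - 1)" and "rk_le n M N" "rk_le n N M"
  shows "rep_iso n M N"
proof -
  obtain xs where xs: "valid_ivls n xs" "rep_iso n M (ivl_sum n xs)"
    "\<And>\<gamma> l. \<gamma> < n \<Longrightarrow> has_rank (path_map n M \<gamma> l) (path_count n xs \<gamma> l)"
    using nil_rep_intervals[OF M] by metis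
  obtain ys where ys: "valid_ivls n ys" "rep_iso n N (ivl_sum n ys)"
    "\<And>\<gamma> l. \<gamma> < n \<Longrightarrow> has_rank (path_map n N \<gamma> l) (path_count n ys \<gamma> l)"
    using nil_rep_intervals[OF N] by metis
  have wf: "wf_rep n M" "wf_rep n N" using M N mat_tuples_wf by (auto simp: nil_reps_def)
  have "path_count n xs \<gamma> l = path_count n ys \<gamma> l" if "\<gamma> < n" for \<gamma> l
    using assms(3,4) rk_le_iff[OF xs(3) ys(3)] rk_le_iff[OF ys(3) xs(3)] that by (simp add: le_antisym)
  then have "rep_iso n (ivl_sum n xs) (ivl_sum n ys)"
    by (intro ivl_sum_mset_cong mset_eq_if_path_count_eq[OF xs(1) ys(1)])
  then have "rep_iso n M (ivl_sum n ys)" by (rule rep_iso_trans[OF xs(2) _ wf(1) wf_ivl_sum wf_ivl_sum])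
  then show ?thesis
    by (rule rep_iso_trans[OF _ rep_iso_sym[OF ys(2) wf(2) wf_ivl_sum] wf(1) wf_ivl_sum wf(2)])
qed

text \<open>Semicontinuity of rank: \<open>P\<close> and \<open>Q\<close> compress the path map of
  \<open>N\<close> to an identity matrix of size its rank \<open>k\<close>. The determinant of the
  compression is a polynomial in the representation with value 1 at \<open>N\<close>, so it cannot
  vanish on the whole orbit of \<open>M\<close>, and at a point where it is nonzero the rank is at
  least \<open>k\<close>.\<close>

lemma deg_le_imp_rk_le:
  assumes M: "M \<in> nil_reps n q (n - 1)" and N: "N \<in> nil_reps n q (n - 1)" and deg: "deg_le n q N M"
  shows "rk_le n N M"
proof -
  have Mt: "M \<in> mat_tuples n q" and Nt: "N \<in> mat_tuples n q" using M N by (auto simp: nil_reps_def)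
  obtain xs where xs: "\<And>\<gamma> l. \<gamma> < n \<Longrightarrow> has_rank (path_map n M \<gamma> l) (path_count n xs \<gamma> l)"
    using nil_rep_intervals[OF M] by metis
  obtain ys where ys: "\<And>\<gamma> l. \<gamma> < n \<Longrightarrow> has_rank (path_map n N \<gamma> l) (path_count n ys \<gamma> l)"
    using nil_rep_intervals[OF N] by metis
  have "path_count n ys \<gamma> l \<le> path_count n xs \<gamma> l" if \<gamma>: "\<gamma> < n" for \<gamma> l
  proof -
    define k where "k = path_count n ys \<gamma> l"
    have sq: "path_map n X \<gamma> l \<in> carrier_mat q q" if "X \<in> mat_tuples n q" for X
      by (rule path_map_square[OF that \<gamma>])
    obtain P Q where PQ: "P \<in> carrier_mat k q" "Q \<in> carrier_mat q k" "P * path_map n N \<gamma> l * Q = 1\<^sub>m k"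
      using ys[OF \<gamma>, of l] unfolding has_rank_def k_def carrier_matD[OF sq[OF Nt]] by blast
    define f where "f X = det (P * path_map n X \<gamma> l * Q)" for X
    have "poly_on n q f"
      unfolding f_def
    proof (rule poly_on_det)
      show "P * path_map n X \<gamma> l * Q \<in> carrier_mat k k" if "X \<in> mat_tuples n q" for X
        using PQ(1,2) sq[OF that] by auto
      show "poly_on n q (\<lambda>X. (P * path_map n X \<gamma> l * Q) $$ (i, j))" if "i < k" "j < k" for i j
      proof (rule poly_on_mult_entries[OF _ _ _ _ that])
        show "poly_on n q (\<lambda>X. (P * path_map n X \<gamma> l) $$ (i, j))" if "i < k" "j < q" for i j
          by (rule poly_on_mult_entries[OF _ _ _ _ that])
            (use PQ sq poly_on_const poly_on_path_map[OF \<gamma>] in auto)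
      qed (use PQ sq poly_on_const in auto)
    qed
    then obtain p where p: "p \<in> poly_funs n q" "\<And>X. X \<in> mat_tuples n q \<Longrightarrow> f X = p X"
      unfolding poly_on_def by blast
    have orb: "GL_orbit n q M \<subseteq> mat_tuples n q" using GL_orbit_eq[OF Mt] by blast
    have "f N = 1" using PQ(3) by (simp add: f_def)
    then have "p N \<noteq> 0" using p(2)[OF Nt] by simp
    then obtain Y where Y: "Y \<in> GL_orbit n q M" "p Y \<noteq> 0"
      using deg p(1) unfolding deg_le_def orbit_closure_def closure_of_zariski[OF orb] by blast
    have Yt: "Y \<in> mat_tuples n q" "rep_iso n M Y" using Y(1) GL_orbit_eq[OF Mt] by auto
    have "has_rank (path_map n Y \<gamma> l) (path_count n xs \<gamma> l)"
      by (rule has_rank_path_map_iso[OF mat_tuples_wf[OF Mt] mat_tuples_wf[OF Yt(1)] \<gamma> Yt(2) xs[OF \<gamma>]])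
    moreover have "det (P * path_map n Y \<gamma> l * Q) \<noteq> 0" using Y(2) p(2)[OF Yt(1)] by (simp add: f_def)
    ultimately have "k \<le> path_count n xs \<gamma> l"
      using has_rank_det_bound[of "path_map n Y \<gamma> l" _ P k Q] PQ(1,2) sq[OF Yt(1)] by auto
    then show ?thesis by (simp add: k_def)
  qed
  then show ?thesis using rk_le_iff[OF ys xs] by blast
qed

section \<open>Gluings and shifts are degenerations\<close>

text \<open>In coordinates relative to the vertex \<open>s\<close>, a move replaces the intervals \<open>[0, B]\<close> and
  \<open>[C, D]\<close> by \<open>[0, D]\<close> and \<open>[C, B]\<close>; a gluing is the case \<open>C = B + 1\<close>, where the last
  interval is empty.\<close>

definition move_data :: "nat \<Rightarrow> nat \<Rightarrow> nat \<Rightarrow> nat \<Rightarrow> nat \<Rightarrow> bool" where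
  "move_data n s B C D \<longleftrightarrow> s < n \<and> 0 < C \<and> C \<le> Suc B \<and> B < D \<and> Suc D < n"

definition move_source :: "nat \<Rightarrow> nat \<Rightarrow> nat \<Rightarrow> nat \<Rightarrow> nat \<Rightarrow> rep" where
  "move_source n s B C D = rep_sum n (ivl n s (Suc B)) (ivl n ((s + C) mod n) (Suc D - C))"

definition move_target :: "nat \<Rightarrow> nat \<Rightarrow> nat \<Rightarrow> nat \<Rightarrow> nat \<Rightarrow> rep" where
  "move_target n s B C D = rep_sum n (ivl n s (Suc D)) (ivl n ((s + C) mod n) (Suc B - C))"

lemma offset_shifted_start:
  assumes "s < n" "C < n" "\<gamma> < n"
  shows "offset n ((s + C) mod n) \<gamma> =
    (if C \<le> offset n s \<gamma> then offset n s \<gamma> - C else offset n s \<gamma> + n - C)"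
proof -
  let ?u = "offset n s \<gamma>" and ?k = "if C \<le> offset n s \<gamma> then offset n s \<gamma> - C else offset n s \<gamma> + n - C"
  have u: "?u < n" using offset_less assms by auto
  have "((s + C) mod n + ?k) mod n = (s + C + ?k) mod n" by (rule mod_add_left_eq)
  also have "\<dots> = (s + ?u) mod n"
  proof (cases "C \<le> ?u")
    case False
    then have "s + C + ?k = s + ?u + n" using assms by simp
    then show ?thesis by (metis mod_add_self2)
  qed simp
  also have "\<dots> = \<gamma>" by (rule start_plus_offset[OF assms(1,3)])
  finally have "\<gamma> = ((s + C) mod n + ?k) mod n" by simp
  moreover have "?k < n" using u assms by auto
  ultimately show ?thesis using offset_eq_iff[of "(s + C) mod n" n \<gamma> ?k] assms by simp
qed

lemma offset_shifted_less_iff: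
  assumes "s < n" "\<gamma> < n" "0 < C" "C \<le> E" "E < n"
  shows "offset n ((s + C) mod n) \<gamma> < E - C \<longleftrightarrow> C \<le> offset n s \<gamma> \<and> offset n s \<gamma> < E"
  using offset_shifted_start[of s n C \<gamma>] assms by auto

text \<open>A 2-by-2 matrix whose rows \<open>a\<close>, \<open>b\<close> and columns
  \<open>c\<close>, \<open>d\<close> may be absent. One formula thus covers every position of an
  arrow relative to the two intervals, and by \<open>bmat_cong\<close> only the entries whose row
  and column are both present have to agree.\<close>

abbreviation bmat :: "bool \<Rightarrow> bool \<Rightarrow> bool \<Rightarrow> bool \<Rightarrow> 'a \<Rightarrow> 'a \<Rightarrow> 'a \<Rightarrow> 'a \<Rightarrow> 'a :: zero mat" where
  "bmat a b c d x y z w \<equiv> four_block_mat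
     (cmat (of_bool a) (of_bool c) x) (cmat (of_bool a) (of_bool d) y)
     (cmat (of_bool b) (of_bool c) z) (cmat (of_bool b) (of_bool d) w)"

lemma cmat_add: "cmat a b x + cmat a b y = cmat a b (x + y)"
  by (intro eq_matI) auto

lemma bmat_mult:
  fixes x y z w x' y' z' w' :: complex
  shows "bmat a b c d x y z w * bmat c d e f x' y' z' w' =
    bmat a b e f (of_bool c * x * x' + of_bool d * y * z') (of_bool c * x * y' + of_bool d * y * w')
      (of_bool c * z * x' + of_bool d * w * z') (of_bool c * z * y' + of_bool d * w * w')"
  by (subst mult_four_block_mat[of _ "of_bool a" "of_bool c" _ "of_bool d" _ "of_bool b" _ _ "of_bool e" _ "of_bool f"])
    (simp_all only: mat_carrier cmat_mult cmat_add of_nat_of_bool)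

lemma bmat_cong:
  assumes "a \<and> c \<longrightarrow> x = x'" "a \<and> d \<longrightarrow> y = y'" "b \<and> c \<longrightarrow> z = z'" "b \<and> d \<longrightarrow> w = w'"
  shows "bmat a b c d x y z w = bmat a b c d x' y' z' w'"
  using assms by (intro cong_four_block_mat cong_mat refl) (auto simp: of_bool_def split: if_splits)

lemma one_mat_bmat: "1\<^sub>m (of_bool a + of_bool b) = bmat a b a b 1 0 0 (1 :: complex)"
  by (intro eq_matI) (auto simp: of_bool_def split: if_splits)

lemma bmat_carrier: "bmat a b c d x y z w \<in> carrier_mat (of_bool a + of_bool b) (of_bool c + of_bool d)"
  by (intro carrier_matI) auto

text \<open>An extension with subrepresentation \<open>[C, D]\<close> and quotient
  \<open>[0, B]\<close>, written in block triangular form. The only new entry sits on the arrow out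
  of \<open>B\<close>, from the first interval to the second, and is scaled by \<open>t\<close>; at
  \<open>t = 0\<close> the extension splits. The entry exists because \<open>C \<le> Suc B\<close>
  and \<open>B < D\<close> put the vertex \<open>Suc B\<close> into \<open>[C, D]\<close>.\<close>

definition move_family :: "nat \<Rightarrow> nat \<Rightarrow> nat \<Rightarrow> nat \<Rightarrow> nat \<Rightarrow> complex \<Rightarrow> rep" where
  "move_family n s B C D t = (\<lambda>\<gamma>\<in>{..<n}.
     let E1 = ivl n s (Suc B) \<gamma>; E2 = ivl n ((s + C) mod n) (Suc D - C) \<gamma>
     in four_block_mat E1 (0\<^sub>m (dim_row E1) (dim_col E2))
          (cmat (dim_row E2) (dim_col E1) (t * of_bool (offset n s \<gamma> = B))) E2)"

lemma move_family_zero: "move_family n s B C D 0 = move_source n s B C D"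
  unfolding move_family_def move_source_def rep_sum_def Let_def
  by (intro restrict_ext cong_four_block_mat refl) (auto intro!: eq_matI)

lemma dim_move_family:
  assumes "\<gamma> < n"
  shows "dim_col (move_family n s B C D t \<gamma>) = dim_col (move_source n s B C D \<gamma>)"
    "dim_row (move_family n s B C D t \<gamma>) = dim_row (move_source n s B C D \<gamma>)"
  using assms by (simp_all add: move_family_def move_source_def rep_sum_def Let_def)

lemma wf_move_source: "wf_rep n (move_source n s B C D)"
  unfolding move_source_def by (intro wf_rep_sum wf_ivl)

lemma wf_move_target: "wf_rep n (move_target n s B C D)"
  unfolding move_target_def by (intro wf_rep_sum wf_ivl)

lemma wf_move_family: "wf_rep n (move_family n s B C D t)"
  using wf_move_source[of n s B C D] by (auto simp: wf_rep_def dim_move_family)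

lemma move_family_iso_target:
  assumes mv: "move_data n s B C D" and t: "t \<noteq> 0"
  shows "rep_iso n (move_target n s B C D) (move_family n s B C D t)"
proof -
  have s: "s < n" and bd: "0 < C" "C \<le> Suc B" "B < D" "Suc D < n" using mv by (auto simp: move_data_def)
  define u where "u = offset n s"
  define p1 where "p1 \<gamma> \<longleftrightarrow> u \<gamma> \<le> B" for \<gamma>
  define p2 where "p2 \<gamma> \<longleftrightarrow> C \<le> u \<gamma> \<and> u \<gamma> \<le> D" for \<gamma>
  define p3 where "p3 \<gamma> \<longleftrightarrow> u \<gamma> \<le> D" for \<gamma>
  define p4 where "p4 \<gamma> \<longleftrightarrow> C \<le> u \<gamma> \<and> u \<gamma> \<le> B" for \<gamma>
  note p = p1_def p2_def p3_def p4_def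
  have cov: "offset n s \<gamma> < Suc B \<longleftrightarrow> p1 \<gamma>" "offset n ((s + C) mod n) \<gamma> < Suc D - C \<longleftrightarrow> p2 \<gamma>"
    "offset n s \<gamma> < Suc D \<longleftrightarrow> p3 \<gamma>" "offset n ((s + C) mod n) \<gamma> < Suc B - C \<longleftrightarrow> p4 \<gamma>" if "\<gamma> < n" for \<gamma>
    using offset_shifted_less_iff[OF s that, of C "Suc D"] offset_shifted_less_iff[OF s that, of C "Suc B"] bd
    by (auto simp: p u_def)
  have X: "move_family n s B C D t \<gamma> =
      bmat (p1 (Suc \<gamma> mod n)) (p2 (Suc \<gamma> mod n)) (p1 \<gamma>) (p2 \<gamma>) 1 0 (t * of_bool (u \<gamma> = B)) 1"
    and T: "move_target n s B C D \<gamma> =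
      bmat (p3 (Suc \<gamma> mod n)) (p4 (Suc \<gamma> mod n)) (p3 \<gamma>) (p4 \<gamma>) 1 0 0 1" if "\<gamma> < n" for \<gamma>
  proof -
    have zero: "0\<^sub>m a b = cmat a b (0 :: complex)" for a b by (intro eq_matI) auto
    note s1 = Suc_mod_less[OF that]
    show "move_family n s B C D t \<gamma> =
      bmat (p1 (Suc \<gamma> mod n)) (p2 (Suc \<gamma> mod n)) (p1 \<gamma>) (p2 \<gamma>) 1 0 (t * of_bool (u \<gamma> = B)) 1"
      using that by (simp only: move_family_def Let_def restrict_apply' lessThan_iff ivl_apply dim_row_mat dim_col_mat zero
          cov[OF that] cov[OF s1] u_def)
    show "move_target n s B C D \<gamma> =
      bmat (p3 (Suc \<gamma> mod n)) (p4 (Suc \<gamma> mod n)) (p3 \<gamma>) (p4 \<gamma>) 1 0 0 1"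
      using that by (simp only: move_target_def rep_sum_apply ivl_apply dim_row_mat dim_col_mat zero
          cov[OF that] cov[OF s1])
  qed
  \<comment> \<open>Write e1, e2 for the basis vectors of the two intervals of the source. The first
    column is e1 up to \<open>B\<close> and \<open>t\<close> times e2 afterwards, which follows the
    arrows through all of \<open>[0, D]\<close>. The second is e2 - (1 / t) e1 on the overlap; the
    arrow out of \<open>B\<close> kills it, so it spans \<open>[C, B]\<close>.\<close>
  define g where "g \<gamma> = bmat (p1 \<gamma>) (p2 \<gamma>) (p3 \<gamma>) (p4 \<gamma>) 1 (- (1 / t)) (t * of_bool (B < u \<gamma>)) 1" for \<gamma>
  define h where "h \<gamma> = bmat (p3 \<gamma>) (p4 \<gamma>) (p1 \<gamma>) (p2 \<gamma>) 1 (1 / t) 0 1" for \<gamma>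
  have dX: "dim_col (move_family n s B C D t \<gamma>) = of_bool (p1 \<gamma>) + of_bool (p2 \<gamma>)"
    and dT: "dim_col (move_target n s B C D \<gamma>) = of_bool (p3 \<gamma>) + of_bool (p4 \<gamma>)" if "\<gamma> < n" for \<gamma>
    unfolding X[OF that] T[OF that] by simp_all
  have "iso_pair n (move_target n s B C D) (move_family n s B C D t) g h"
  proof (rule iso_pairI)
    fix \<gamma> assume \<gamma>: "\<gamma> < n"
    let ?s = "Suc \<gamma> mod n"
    show "g \<gamma> \<in> carrier_mat (dim_col (move_family n s B C D t \<gamma>)) (dim_col (move_target n s B C D \<gamma>))"
      "h \<gamma> \<in> carrier_mat (dim_col (move_target n s B C D \<gamma>)) (dim_col (move_family n s B C D t \<gamma>))"
      unfolding dX[OF \<gamma>] dT[OF \<gamma>] g_def h_def by (rule bmat_carrier)+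
    show "g \<gamma> * h \<gamma> = 1\<^sub>m (dim_col (move_family n s B C D t \<gamma>))"
      unfolding dX[OF \<gamma>] g_def h_def one_mat_bmat bmat_mult
      by (rule bmat_cong) (use bd t in \<open>auto simp: p\<close>)
    show "h \<gamma> * g \<gamma> = 1\<^sub>m (dim_col (move_target n s B C D \<gamma>))"
      unfolding dT[OF \<gamma>] g_def h_def one_mat_bmat bmat_mult
      by (rule bmat_cong) (use bd t in \<open>auto simp: p\<close>)
    have us: "u ?s = Suc (u \<gamma>) mod n" unfolding u_def by (rule offset_Suc[OF s])
    show "g ?s * move_target n s B C D \<gamma> = move_family n s B C D t \<gamma> * g \<gamma>"
    \<comment> \<open>Up to \<open>D\<close> the next vertex has offset one more, without wrapping
      round, since \<open>Suc D < n\<close>. Beyond \<open>D\<close> the spaces at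
      \<open>\<gamma>\<close> are zero and every entry is absent.\<close>
    proof (cases "u \<gamma> \<le> D")
      case True
      then have us: "u ?s = Suc (u \<gamma>)" using us bd by simp
      show ?thesis
        unfolding X[OF \<gamma>] T[OF \<gamma>] g_def bmat_mult
        by (rule bmat_cong) (use bd t True in \<open>auto simp: p us\<close>)
    next
      case False
      then show ?thesis
        unfolding X[OF \<gamma>] T[OF \<gamma>] g_def bmat_mult
        by (intro bmat_cong) (use bd in \<open>auto simp: p\<close>)
    qed
  qed
  then show ?thesis by (rule rep_isoI)
qed

lemma deg_le_of_move:
  assumes mv: "move_data n s B C D" and wfR: "wf_rep n R"
    and M: "M \<in> mat_tuples n q" and N: "N \<in> mat_tuples n q"
    and isoM: "rep_iso n M (rep_sum n (move_source n s B C D) R)"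
    and isoN: "rep_iso n N (rep_sum n (move_target n s B C D) R)"
  shows "deg_le n q M N"
proof -
  note wfM = mat_tuples_wf[OF M] and wfN = mat_tuples_wf[OF N]
  define Y where "Y t = rep_sum n (move_family n s B C D t) R" for t
  have wfY: "wf_rep n (Y t)" for t unfolding Y_def by (rule wf_rep_sum[OF wf_move_family wfR])
  have Y0: "Y 0 = rep_sum n (move_source n s B C D) R" by (simp add: Y_def move_family_zero)
  have iso0: "rep_iso n (Y 0) M" using rep_iso_sym[OF isoM wfM] wfY[of 0] unfolding Y0 by blast
  obtain g h where gh: "iso_pair n (Y 0) M g h" using iso0 rep_iso_iff by blast
  have dim: "dim_col (Y t \<gamma>) = q" if "\<gamma> < n" for t \<gamma>
  proof -
    have "dim_col (Y t \<gamma>) = dim_col (Y 0 \<gamma>)" using that by (simp add: Y_def dim_move_family)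
    then show ?thesis using rep_iso_dim[OF iso0 that] mat_tuples_dim[OF M that] by simp
  qed
  have Yc: "Y t \<gamma> \<in> carrier_mat q q" if "\<gamma> < n" for t \<gamma>
    using wf_rep_carrier[OF wfY that, of t] dim[OF that] dim[OF Suc_mod_less[OF that]] by simp
  have gc: "g \<gamma> \<in> carrier_mat q q" "h \<gamma> \<in> carrier_mat q q" "g \<gamma> * h \<gamma> = 1\<^sub>m q" "h \<gamma> * g \<gamma> = 1\<^sub>m q"
    if "\<gamma> < n" for \<gamma>
    using iso_pairD(1-4)[OF gh that] dim[OF that] mat_tuples_dim[OF M that] by auto
  \<comment> \<open>The isomorphism from \<open>Y 0\<close> to \<open>M\<close> is applied to the
    whole family. The limit at 0 is then \<open>M\<close> itself and not merely an isomorphic tuple,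
    while the members for nonzero \<open>t\<close> stay in the orbit of \<open>N\<close>.\<close>
  define Z where "Z t = (\<lambda>\<gamma>\<in>{..<n}. g (Suc \<gamma> mod n) * Y t \<gamma> * h \<gamma>)" for t
  have gY: "g (Suc \<gamma> mod n) * Y t \<gamma> \<in> carrier_mat q q" if "\<gamma> < n" for t \<gamma>
    by (rule mult_carrier_mat[OF gc(1)[OF Suc_mod_less[OF that]] Yc[OF that]])
  have Zc: "Z t \<gamma> \<in> carrier_mat q q" if "\<gamma> < n" for t \<gamma>
    using that mult_carrier_mat[OF gY[OF that] gc(2)[OF that]] by (simp add: Z_def)
  have Zt: "Z t \<in> mat_tuples n q" for t using Zc by (auto simp: mat_tuples_iff Z_def)
  have isoZ: "rep_iso n (Y t) (Z t)" for t
  proof (rule rep_isoI[OF iso_pairI[of n g _ _ h]])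
    fix \<gamma> assume \<gamma>: "\<gamma> < n"
    show "g \<gamma> \<in> carrier_mat (dim_col (Z t \<gamma>)) (dim_col (Y t \<gamma>))" "h \<gamma> \<in> carrier_mat (dim_col (Y t \<gamma>)) (dim_col (Z t \<gamma>))"
      "g \<gamma> * h \<gamma> = 1\<^sub>m (dim_col (Z t \<gamma>))" "h \<gamma> * g \<gamma> = 1\<^sub>m (dim_col (Y t \<gamma>))"
      unfolding dim[OF \<gamma>] mat_tuples_dim[OF Zt \<gamma>] by (fact gc[OF \<gamma>])+
    have "Z t \<gamma> * g \<gamma> = g (Suc \<gamma> mod n) * Y t \<gamma> * (h \<gamma> * g \<gamma>)"
      using \<gamma> assoc_mult_mat[OF gY[OF \<gamma>] gc(2,1)[OF \<gamma>]] by (simp add: Z_def)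
    then show "g (Suc \<gamma> mod n) * Y t \<gamma> = Z t \<gamma> * g \<gamma>"
      unfolding gc(4)[OF \<gamma>] using right_mult_one_mat[OF gY[OF \<gamma>]] by simp
  qed
  have "Z 0 = M"
  proof
    fix \<gamma>
    show "Z 0 \<gamma> = M \<gamma>"
    proof (cases "\<gamma> < n")
      case \<gamma>: True
      have "Z 0 \<gamma> = M \<gamma> * g \<gamma> * h \<gamma>" using iso_pairD(5)[OF gh \<gamma>] \<gamma> by (simp add: Z_def)
      also have "\<dots> = M \<gamma> * (g \<gamma> * h \<gamma>)" by (rule assoc_mult_mat[OF mat_tuplesD[OF M \<gamma>] gc(1,2)[OF \<gamma>]])
      also have "\<dots> = M \<gamma>" unfolding gc(3)[OF \<gamma>] by (rule right_mult_one_mat[OF mat_tuplesD[OF M \<gamma>]])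
      finally show ?thesis .
    next
      case False
      then show ?thesis using M by (simp add: Z_def mat_tuples_iff extensional_def)
    qed
  qed
  moreover have "Z 0 \<in> zariski n q closure_of GL_orbit n q N"
  proof (rule curve_limit_in_closure[OF _ Zt])
    show "GL_orbit n q N \<subseteq> mat_tuples n q" using GL_orbit_eq[OF N] by blast
    fix t :: complex assume t: "t \<noteq> 0"
    have "rep_iso n (rep_sum n (move_target n s B C D) R) (Y t)"
      unfolding Y_def
      by (intro rep_sum_cong move_family_iso_target[OF mv t] rep_iso_refl wfR wf_move_target wf_move_family)
    from rep_iso_trans[OF isoN this wfN wf_rep_sum[OF wf_move_target wfR] wfY]
    have "rep_iso n N (Y t)" .
    from rep_iso_trans[OF this isoZ wfN wfY mat_tuples_wf[OF Zt]]
    show "Z t \<in> GL_orbit n q N" using Zt GL_orbit_eq[OF N] by blast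
  next
    fix \<alpha> i j assume \<alpha>: "\<alpha> < n" and ij: "i < q" "j < q"
    have Y_poly: "poly_fun (\<lambda>t. Y t \<alpha> $$ (i, j))" if "i < q" "j < q" for i j
    proof -
      define E1 where "E1 = ivl n s (Suc B) \<alpha>"
      define E2 where "E2 = ivl n ((s + C) mod n) (Suc D - C) \<alpha>"
      define F where "F t = four_block_mat E1 (0\<^sub>m (dim_row E1) (dim_col E2))
          (cmat (dim_row E2) (dim_col E1) (t * of_bool (offset n s \<alpha> = B))) E2" for t :: complex
      have F: "move_family n s B C D t \<alpha> = F t" for t
        using \<alpha> by (simp add: move_family_def Let_def E1_def E2_def F_def)
      have dF: "dim_row (F t) = dim_row E1 + dim_row E2" "dim_col (F t) = dim_col E1 + dim_col E2" for t
        by (auto simp: F_def)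
      have Ft: "Y t \<alpha> = block_diag (F t) (R \<alpha>)" for t using \<alpha> by (simp add: Y_def rep_sum_apply F)
      have bound: "i < dim_row (F t) + dim_row (R \<alpha>)" "j < dim_col (F t) + dim_col (R \<alpha>)" for t
        using Yc[OF \<alpha>, of t] that unfolding Ft by auto
      have F_poly: "poly_fun (\<lambda>t. F t $$ (a, b))" if "a < dim_row E1 + dim_row E2" "b < dim_col E1 + dim_col E2" for a b
        using that unfolding F_def by (cases "a < dim_row E1"; cases "b < dim_col E1") auto
      show ?thesis
        unfolding Ft using bound F_poly
        by (cases "i < dim_row E1 + dim_row E2"; cases "j < dim_col E1 + dim_col E2") (auto simp: dF)
    qed
    have "poly_fun (\<lambda>t. (g (Suc \<alpha> mod n) * Y t \<alpha> * h \<alpha>) $$ (i, j))"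
    proof (rule poly_fun_mult_entries[of _ q q _ q])
      show "poly_fun (\<lambda>t. (g (Suc \<alpha> mod n) * Y t \<alpha>) $$ (i, j))" if "i < q" "j < q" for i j
        by (rule poly_fun_mult_entries[of _ q q _ q])
          (use that gc(1)[OF Suc_mod_less[OF \<alpha>]] Yc[OF \<alpha>] Y_poly in auto)
    qed (use gY[OF \<alpha>] gc(2)[OF \<alpha>] ij in auto)
    then show "poly_fun (\<lambda>t. Z t \<alpha> $$ (i, j))" using \<alpha> by (simp add: Z_def)
  qed
  ultimately show ?thesis by (simp add: deg_le_def orbit_closure_def)
qed

section \<open>Gluings and shifts expressed as moves\<close>

lemma reps_wf: "R \<in> reps n d \<Longrightarrow> wf_rep n R"
  unfolding wf_rep_def
proof (intro allI impI)
  fix \<gamma> assume "R \<in> reps n d" "\<gamma> < n"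
  then have "R \<gamma> \<in> carrier_mat (d (Suc \<gamma> mod n)) (d \<gamma>)"
    "R (Suc \<gamma> mod n) \<in> carrier_mat (d (Suc (Suc \<gamma> mod n) mod n)) (d (Suc \<gamma> mod n))"
    by (auto simp: reps_def PiE_iff)
  then show "dim_row (R \<gamma>) = dim_col (R (Suc \<gamma> mod n))" by auto
qed

lemma interval_rep_shifted:
  assumes "s < n" "C \<le> D" "D < n"
  shows "interval_rep n ((s + C) mod n) ((s + D) mod n) = ivl n ((s + C) mod n) (Suc D - C)"
proof -
  have "((s + C) mod n + (D - C)) mod n = (s + C + (D - C)) mod n" by (rule mod_add_left_eq)
  then have "(s + D) mod n = ((s + C) mod n + (D - C)) mod n" using assms by simp
  then have "offset n ((s + C) mod n) ((s + D) mod n) = D - C"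
    using offset_eq_iff[of "(s + C) mod n" n "(s + D) mod n" "D - C"] assms by simp
  then show ?thesis using interval_rep_eq_ivl[of "(s + C) mod n" n "(s + D) mod n"] assms by (simp add: Suc_diff_le)
qed

text \<open>This is an equality, because appending a block of size 0 does not change a matrix. It
  makes the target of a gluing literally the target of a move with \<open>C = Suc B\<close>.\<close>

lemma rep_sum_empty_ivl: "rep_sum n (ivl n s e) (ivl n s' 0) = ivl n s e"
proof
  fix \<gamma> show "rep_sum n (ivl n s e) (ivl n s' 0) \<gamma> = ivl n s e \<gamma>"
    by (cases "\<gamma> < n") (auto simp: rep_sum_def ivl_def intro!: eq_matI)
qed

text \<open>The excluded case is the interval that goes once round the cycle and covers all
  \<open>n\<close> vertices; its last vertex has offset \<open>n - 1\<close>.\<close>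

lemma offset_last:
  assumes "\<alpha> < n" "\<gamma> < n"
  shows "\<alpha> \<noteq> Suc \<gamma> mod n \<longleftrightarrow> Suc (offset n \<alpha> \<gamma>) < n"
proof -
  have "Suc \<gamma> mod n = \<alpha> \<longleftrightarrow> Suc (offset n \<alpha> \<gamma>) mod n = 0"
    using offset_Suc[OF assms(1), of \<gamma>] offset_pred(2)[of "Suc \<gamma> mod n" n \<alpha>] assms by auto
  then show ?thesis using offset_less[of n \<alpha> \<gamma>] assms by (auto simp: mod_Suc split: if_splits)
qed

lemma gluing_step_iff_move:
  "gluing_step n M N \<longleftrightarrow> (\<exists>s B D d. \<exists>R\<in>reps n d. move_data n s B (Suc B) D \<and>
     rep_iso n M (rep_sum n (move_source n s B (Suc B) D) R) \<and>
     rep_iso n N (rep_sum n (move_target n s B (Suc B) D) R))" (is "?L \<longleftrightarrow> ?R")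
proof
  have eqs: "rep_sum n (rep_sum n (interval_rep n s ((s + B) mod n)) (interval_rep n (Suc ((s + B) mod n) mod n) ((s + D) mod n))) R
      = rep_sum n (move_source n s B (Suc B) D) R"
    "rep_sum n (interval_rep n s ((s + D) mod n)) R = rep_sum n (move_target n s B (Suc B) D) R"
    if "move_data n s B (Suc B) D" for s B D R
  proof -
    have s: "s < n" "B < D" "Suc D < n" using that by (auto simp: move_data_def)
    have "Suc ((s + B) mod n) mod n = (s + Suc B) mod n" by (simp add: mod_Suc_eq)
    moreover have "interval_rep n s ((s + B) mod n) = ivl n s (Suc B)" "interval_rep n s ((s + D) mod n) = ivl n s (Suc D)"
      using interval_rep_shifted[of s n 0 B] interval_rep_shifted[of s n 0 D] s by auto
    moreover have "interval_rep n ((s + Suc B) mod n) ((s + D) mod n) = ivl n ((s + Suc B) mod n) (Suc D - Suc B)"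
      by (rule interval_rep_shifted) (use s in auto)
    ultimately show "rep_sum n (rep_sum n (interval_rep n s ((s + B) mod n)) (interval_rep n (Suc ((s + B) mod n) mod n) ((s + D) mod n))) R
      = rep_sum n (move_source n s B (Suc B) D) R"
    "rep_sum n (interval_rep n s ((s + D) mod n)) R = rep_sum n (move_target n s B (Suc B) D) R"
      by (simp_all only: move_source_def move_target_def rep_sum_empty_ivl diff_self_eq_0)
  qed
  {
    assume ?L
    then obtain \<alpha> \<beta> \<gamma> d R where R: "R \<in> reps n d"
      and o: "cyc_ordered n [\<alpha>, \<beta>, \<gamma>] \<or> \<beta> = \<alpha> \<and> cyc_ordered n [\<alpha>, \<gamma>]" "\<alpha> \<noteq> Suc \<gamma> mod n"
      and iso: "rep_iso n M (rep_sum n (rep_sum n (interval_rep n \<alpha> \<beta>) (interval_rep n (Suc \<beta> mod n) \<gamma>)) R)"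
        "rep_iso n N (rep_sum n (interval_rep n \<alpha> \<gamma>) R)"
      unfolding gluing_step_def by blast
    have v: "\<alpha> < n" "\<beta> < n" "\<gamma> < n" using o by (auto simp: cyc_ordered_def)
    define B where "B = offset n \<alpha> \<beta>"
    define D where "D = offset n \<alpha> \<gamma>"
    have \<beta>: "\<beta> = (\<alpha> + B) mod n" and \<gamma>: "\<gamma> = (\<alpha> + D) mod n"
      using start_plus_offset[OF v(1,2)] start_plus_offset[OF v(1,3)] by (auto simp: B_def D_def)
    have "B < D" using o(1) offset_self[of n \<alpha>] unfolding B_def D_def by (auto simp: cyc_ordered_def offset_def)
    then have mv: "move_data n \<alpha> B (Suc B) D"
      using v(1) o(2) offset_last[OF v(1,3)] by (simp add: move_data_def D_def)
    show ?R using R mv iso unfolding \<beta> \<gamma> eqs[OF mv] by blast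
  next
    assume ?R
    then obtain s B D d R where R: "R \<in> reps n d" and mv: "move_data n s B (Suc B) D"
      and iso: "rep_iso n M (rep_sum n (move_source n s B (Suc B) D) R)"
        "rep_iso n N (rep_sum n (move_target n s B (Suc B) D) R)" by blast
    have s: "s < n" "B < D" "Suc D < n" using mv by (auto simp: move_data_def)
    let ?b = "(s + B) mod n" and ?c = "(s + D) mod n"
    have off: "offset n s ?b = B" "offset n s ?c = D"
      using offset_eq_iff[OF s(1), of ?b B] offset_eq_iff[OF s(1), of ?c D] s by auto
    have "cyc_ordered n [s, ?b, ?c] \<or> ?b = s \<and> cyc_ordered n [s, ?c]"
    \<comment> \<open>\<open>B = 0\<close> is the gluing with \<open>\<beta> = \<alpha>\<close>; it
      has its own disjunct because \<open>cyc_ordered\<close> asks for distinct vertices.\<close>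
    proof (cases "B = 0")
      case True
      then show ?thesis using s off offset_self[of n s] by (simp add: cyc_ordered_def offset_def[symmetric])
    next
      case False
      then show ?thesis using s off offset_self[of n s] by (simp add: cyc_ordered_def offset_def[symmetric])
    qed
    moreover have "s \<noteq> Suc ?c mod n" using offset_last[of s n ?c] s off by simp
    ultimately show ?L using R iso unfolding gluing_step_def eqs[OF mv, symmetric] by blast
  }
qed

lemma shift_step_iff_move:
  "shift_step n M N \<longleftrightarrow> (\<exists>s B C D d. \<exists>R\<in>reps n d. C \<le> B \<and> move_data n s B C D \<and>
     rep_iso n M (rep_sum n (move_source n s B C D) R) \<and>
     rep_iso n N (rep_sum n (move_target n s B C D) R))" (is "?L \<longleftrightarrow> ?R")
proof
  have eqs: "rep_sum n (rep_sum n (interval_rep n s ((s + B) mod n)) (interval_rep n ((s + C) mod n) ((s + D) mod n))) R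
      = rep_sum n (move_source n s B C D) R"
    "rep_sum n (rep_sum n (interval_rep n s ((s + D) mod n)) (interval_rep n ((s + C) mod n) ((s + B) mod n))) R
      = rep_sum n (move_target n s B C D) R"
    if "move_data n s B C D" "C \<le> B" for s B C D R
  proof -
    have s: "s < n" "B < D" "Suc D < n" using that by (auto simp: move_data_def)
    have "interval_rep n s ((s + B) mod n) = ivl n s (Suc B)" "interval_rep n s ((s + D) mod n) = ivl n s (Suc D)"
      using interval_rep_shifted[of s n 0 B] interval_rep_shifted[of s n 0 D] s by auto
    moreover have "interval_rep n ((s + C) mod n) ((s + D) mod n) = ivl n ((s + C) mod n) (Suc D - C)"
      "interval_rep n ((s + C) mod n) ((s + B) mod n) = ivl n ((s + C) mod n) (Suc B - C)"
      by (rule interval_rep_shifted; use s that in auto)+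
    ultimately show "rep_sum n (rep_sum n (interval_rep n s ((s + B) mod n)) (interval_rep n ((s + C) mod n) ((s + D) mod n))) R
      = rep_sum n (move_source n s B C D) R"
    "rep_sum n (rep_sum n (interval_rep n s ((s + D) mod n)) (interval_rep n ((s + C) mod n) ((s + B) mod n))) R
      = rep_sum n (move_target n s B C D) R"
      by (simp_all only: move_source_def move_target_def)
  qed
  {
    assume ?L
    then obtain \<alpha> \<beta> \<gamma> \<delta> d R where R: "R \<in> reps n d"
      and o: "cyc_ordered n [\<alpha>, \<gamma>, \<beta>, \<delta>] \<or> \<beta> = \<gamma> \<and> cyc_ordered n [\<alpha>, \<gamma>, \<delta>]" "\<alpha> \<noteq> Suc \<delta> mod n"
      and iso: "rep_iso n M (rep_sum n (rep_sum n (interval_rep n \<alpha> \<beta>) (interval_rep n \<gamma> \<delta>)) R)"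
        "rep_iso n N (rep_sum n (rep_sum n (interval_rep n \<alpha> \<delta>) (interval_rep n \<gamma> \<beta>)) R)"
      unfolding shift_step_def by blast
    have v: "\<alpha> < n" "\<beta> < n" "\<gamma> < n" "\<delta> < n" using o by (auto simp: cyc_ordered_def)
    define B where "B = offset n \<alpha> \<beta>"
    define C where "C = offset n \<alpha> \<gamma>"
    define D where "D = offset n \<alpha> \<delta>"
    have eq: "\<beta> = (\<alpha> + B) mod n" "\<gamma> = (\<alpha> + C) mod n" "\<delta> = (\<alpha> + D) mod n"
      using start_plus_offset[OF v(1)] v by (auto simp: B_def C_def D_def)
    have "0 < C" "C \<le> B" "B < D" using o(1) offset_self[of n \<alpha>] unfolding B_def C_def D_def
      by (auto simp: cyc_ordered_def offset_def)
    then have mv: "move_data n \<alpha> B C D" "C \<le> B"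
      using v(1) o(2) offset_last[OF v(1,4)] by (simp_all add: move_data_def D_def)
    show ?R using R mv iso unfolding eq eqs[OF mv] by blast
  next
    assume ?R
    then obtain s B C D d R where R: "R \<in> reps n d" and mv: "move_data n s B C D" "C \<le> B"
      and iso: "rep_iso n M (rep_sum n (move_source n s B C D) R)"
        "rep_iso n N (rep_sum n (move_target n s B C D) R)" by blast
    have s: "s < n" "0 < C" "B < D" "Suc D < n" using mv by (auto simp: move_data_def)
    let ?b = "(s + B) mod n" and ?c = "(s + C) mod n" and ?d = "(s + D) mod n"
    have off: "offset n s ?b = B" "offset n s ?c = C" "offset n s ?d = D"
      using offset_eq_iff[OF s(1), of ?b B] offset_eq_iff[OF s(1), of ?c C] offset_eq_iff[OF s(1), of ?d D] s mv(2) by auto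
    have "cyc_ordered n [s, ?c, ?b, ?d] \<or> ?b = ?c \<and> cyc_ordered n [s, ?c, ?d]"
    \<comment> \<open>\<open>B = C\<close> is the shift of two intervals that overlap in a single
      vertex.\<close>
    proof (cases "B = C")
      case True
      then show ?thesis using s off offset_self[of n s] by (simp add: cyc_ordered_def offset_def[symmetric])
    next
      case False
      then show ?thesis using s mv(2) off offset_self[of n s] by (simp add: cyc_ordered_def offset_def[symmetric])
    qed
    moreover have "s \<noteq> Suc ?d mod n" using offset_last[of s n ?d] s off by simp
    ultimately show ?L using R iso unfolding shift_step_def eqs[OF mv, symmetric] by blast
  }
qed

lemma step_iff_move:
  "gluing_step n M N \<or> shift_step n M N \<longleftrightarrow> (\<exists>s B C D d. \<exists>R\<in>reps n d. move_data n s B C D \<and>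
     rep_iso n M (rep_sum n (move_source n s B C D) R) \<and>
     rep_iso n N (rep_sum n (move_target n s B C D) R))" (is "_ \<longleftrightarrow> ?R")
proof
  assume "gluing_step n M N \<or> shift_step n M N"
  then show ?R unfolding gluing_step_iff_move shift_step_iff_move by blast
next
  assume ?R
  then obtain s B C D d R where *: "R \<in> reps n d" "move_data n s B C D"
    "rep_iso n M (rep_sum n (move_source n s B C D) R)" "rep_iso n N (rep_sum n (move_target n s B C D) R)"
    by blast
  then consider "C = Suc B" | "C \<le> B" by (force simp: move_data_def)
  then show "gluing_step n M N \<or> shift_step n M N"
    unfolding gluing_step_iff_move shift_step_iff_move using * by cases blast+
qed

section \<open>Maximal elements\<close>

text \<open>Induction along the chain shows that every member is isomorphic to \<open>M\<close>: the
  next step is then a degeneration with \<open>M\<close> itself as the smaller end, and maximality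
  brings its larger end back to the class of \<open>M\<close>.\<close>

lemma maximal_deg_subset_ad: "maximal_reps n q (deg_le n q) \<subseteq> maximal_reps n q (ad_le n q)"
proof
  fix M assume "M \<in> maximal_reps n q (deg_le n q)"
  then have M: "M \<in> nil_reps n q (n - 1)"
    and max: "\<And>N. N \<in> nil_reps n q (n - 1) \<Longrightarrow> deg_le n q M N \<Longrightarrow> rep_iso n M N"
    by (auto simp: maximal_reps_def)
  have Mt: "M \<in> mat_tuples n q" using M nil_reps_mat_tuples by blast
  have "rep_iso n M N" if N: "N \<in> nil_reps n q (n - 1)" and ad: "ad_le n q M N" for N
  proof -
    obtain v L where L: "rep_iso n M (L 0)" "rep_iso n (L v) N" "\<And>j. j \<le> v \<Longrightarrow> L j \<in> nil_reps n q (n - 1)"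
      "\<And>j. j < v \<Longrightarrow> gluing_step n (L j) (L (Suc j)) \<or> shift_step n (L j) (L (Suc j))"
      using ad unfolding ad_le_def by blast
    have Lt: "L j \<in> mat_tuples n q" if "j \<le> v" for j using L(3)[OF that] nil_reps_mat_tuples by blast
    have "rep_iso n M (L j)" if "j \<le> v" for j
      using that
    proof (induction j)
      case (Suc j)
      obtain s B C D d R where R: "R \<in> reps n d" "move_data n s B C D"
        "rep_iso n (L j) (rep_sum n (move_source n s B C D) R)"
        "rep_iso n (L (Suc j)) (rep_sum n (move_target n s B C D) R)"
        using L(4)[of j] Suc.prems unfolding step_iff_move by auto
      note wfR = reps_wf[OF R(1)]
      have "rep_iso n M (rep_sum n (move_source n s B C D) R)"
        by (rule rep_iso_trans[OF Suc.IH R(3) mat_tuples_wf[OF Mt] mat_tuples_wf[OF Lt] wf_rep_sum[OF wf_move_source wfR]])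
          (use Suc.prems in auto)
      then have "deg_le n q M (L (Suc j))"
        using deg_le_of_move[OF R(2) wfR Mt Lt _ R(4)] Suc.prems by blast
      then show ?case using max L(3) Suc.prems by blast
    qed (rule L(1))
    from rep_iso_trans[OF this[OF order_refl] L(2) mat_tuples_wf[OF Mt] mat_tuples_wf[OF Lt[OF order_refl]]]
    show ?thesis using N mat_tuples_wf nil_reps_mat_tuples by blast
  qed
  then show "M \<in> maximal_reps n q (ad_le n q)" using M by (simp add: maximal_reps_def)
qed

lemma maximal_rk_subset_deg: "maximal_reps n q (rk_le n) \<subseteq> maximal_reps n q (deg_le n q)"
  using deg_le_imp_rk_le unfolding maximal_reps_def by blast

lemma path_count_mset: "mset xs = mset ys \<Longrightarrow> path_count n xs \<gamma> l = path_count n ys \<gamma> l"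
  unfolding path_count_def by (metis mset_filter size_mset)

lemma path_count_length_zero:
  assumes "M \<in> mat_tuples n q" "\<gamma> < n" "has_rank (path_map n M \<gamma> 0) r"
  shows "r = q"
proof -
  have "path_map n M \<gamma> 0 = 1\<^sub>m q" by (simp add: mat_tuples_dim[OF assms(1,2)])
  then have "has_rank (path_map n M \<gamma> 0) q" using has_rank_one[of q, where 'a = complex] by simp
  then show ?thesis by (rule has_rank_unique[OF assms(3)])
qed

lemma has_rank_0_imp_zero:
  assumes "has_rank A 0" shows "A = 0\<^sub>m (dim_row A) (dim_col A)"
proof -
  obtain B C where BC: "B \<in> carrier_mat (dim_row A) 0" "C \<in> carrier_mat 0 (dim_col A)" "A = B * C"
    using assms unfolding has_rank_def by blast
  have "B * C = 0\<^sub>m (dim_row A) (dim_col A)"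
    using BC(1,2) by (intro eq_matI) (auto simp: scalar_prod_def)
  then show ?thesis by (rule trans[OF BC(3)])
qed

lemma rep_sum_extensional: "rep_sum n M N \<in> extensional {..<n}"
  by (auto simp: rep_sum_def)

lemma ivl_sum_reps: "ivl_sum n xs \<in> reps n (\<lambda>\<gamma>. dim_col (ivl_sum n xs \<gamma>))"
proof -
  have "ivl_sum n xs \<in> extensional {..<n}"
    by (cases "(n, xs)" rule: ivl_sum.cases) (auto simp: zero_rep_def rep_sum_def)
  then show ?thesis using wf_rep_carrier[OF wf_ivl_sum, of _ n xs] by (auto simp: reps_def PiE_iff)
qed

text \<open>Below a nonisomorphic representation of larger rank, a move can be made. Maximality
  forces its result to be isomorphic to \<open>M\<close>, which is refuted by one path whose rank
  grows.\<close>

lemma maximal_ad_subset_rk: "maximal_reps n q (ad_le n q) \<subseteq> maximal_reps n q (rk_le n)"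
proof
  fix M assume "M \<in> maximal_reps n q (ad_le n q)"
  then have M: "M \<in> nil_reps n q (n - 1)"
    and max: "\<And>N. N \<in> nil_reps n q (n - 1) \<Longrightarrow> ad_le n q M N \<Longrightarrow> rep_iso n M N"
    by (auto simp: maximal_reps_def)
  have Mt: "M \<in> mat_tuples n q" using M nil_reps_mat_tuples by blast
  note wfM = mat_tuples_wf[OF Mt]
  have "rep_iso n M N" if N: "N \<in> nil_reps n q (n - 1)" and rk: "rk_le n M N" for N
  proof (rule ccontr)
    assume not_iso: "\<not> rep_iso n M N"
    have Nt: "N \<in> mat_tuples n q" using N nil_reps_mat_tuples by blast
    obtain xs where xs: "valid_ivls n xs" "rep_iso n M (ivl_sum n xs)"
      "\<And>\<gamma> l. \<gamma> < n \<Longrightarrow> has_rank (path_map n M \<gamma> l) (path_count n xs \<gamma> l)"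
      using nil_rep_intervals[OF M] by metis
    obtain ys where ys: "valid_ivls n ys"
      "\<And>\<gamma> l. \<gamma> < n \<Longrightarrow> has_rank (path_map n N \<gamma> l) (path_count n ys \<gamma> l)"
      using nil_rep_intervals[OF N] by metis
    have le: "path_count n xs \<gamma> l \<le> path_count n ys \<gamma> l" if "\<gamma> < n" for \<gamma> l
      using rk rk_le_iff[OF xs(3) ys(2)] that by blast
    have eq0: "path_count n xs \<gamma> 0 = path_count n ys \<gamma> 0" if "\<gamma> < n" for \<gamma>
      using path_count_length_zero[OF Mt that xs(3)[OF that]] path_count_length_zero[OF Nt that ys(2)[OF that]] by simp
    have "\<exists>\<gamma><n. \<exists>l. path_count n xs \<gamma> l \<noteq> path_count n ys \<gamma> l"
    proof (rule ccontr)
      assume "\<not> ?thesis"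
      then have "rk_le n N M" using rk_le_iff[OF ys(2) xs(3)] by simp
      then show False using rk_le_antisym[OF M N rk] not_iso by blast
    qed
    then obtain s B C D where mv: "move_data n s B C D"
      and mem: "(s, Suc B) \<in> set xs" "((s + C) mod n, Suc D - C) \<in> set xs"
      using exists_move[OF xs(1) ys(1) le eq0] unfolding move_data_def by blast
    have bd: "s < n" "0 < C" "C \<le> Suc B" "B < D" "Suc D < n" using mv by (auto simp: move_data_def)
    let ?s = "(s + C) mod n"
    \<comment> \<open>The two intervals start at different vertices, so they are distinct members of
      the list and both can be removed from it.\<close>
    have "s \<noteq> ?s" using offset_eq_iff[of s n s C] offset_self[of n s] bd by auto
    then obtain zs where zs: "mset xs = mset ((s, Suc B) # (?s, Suc D - C) # zs)"
    proof -
      have rem: "mset us = add_mset a (mset (remove1 a us))" if "a \<in> set us" for a :: "nat \<times> nat" and us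
        using that by simp
      have "(?s, Suc D - C) \<in> set (remove1 (s, Suc B) xs)" using mem \<open>s \<noteq> ?s\<close> by (simp add: in_set_remove1)
      from rem[OF mem(1)] rem[OF this]
      have "mset xs = mset ((s, Suc B) # (?s, Suc D - C) # remove1 (?s, Suc D - C) (remove1 (s, Suc B) xs))"
        by (simp only: mset.simps)
      then show thesis using that by blast
    qed
    define K where "K = (s, Suc D) # (?s, Suc B - C) # zs"
    define M' where "M' = ivl_sum n K"
    have M'_eq: "M' = rep_sum n (move_target n s B C D) (ivl_sum n zs)"
      by (simp add: M'_def K_def move_target_def rep_sum_assoc)
    have src: "ivl_sum n ((s, Suc B) # (?s, Suc D - C) # zs) = rep_sum n (move_source n s B C D) (ivl_sum n zs)"
      by (simp add: move_source_def rep_sum_assoc)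
    have isoM: "rep_iso n M (rep_sum n (move_source n s B C D) (ivl_sum n zs))"
      using rep_iso_trans[OF xs(2) ivl_sum_mset_cong[OF zs] wfM wf_ivl_sum wf_ivl_sum] unfolding src .
    have set_zs: "set zs \<subseteq> set xs" using mset_eq_setD[OF zs] by auto
    then have K_bd: "\<forall>(s, e)\<in>set K. s < n \<and> e < n"
      using xs(1) bd unfolding K_def valid_ivls_def by auto
    have M'_dim: "dim_col (M' \<gamma>) = q" if "\<gamma> < n" for \<gamma>
    proof -
      \<comment> \<open>Dimensions along the family do not depend on the parameter: at 1 they are
        those of the target, at 0 those of the source. So the move preserves the dimension
        vector.\<close>
      have "dim_col (move_family n s B C D 1 \<gamma>) = dim_col (move_target n s B C D \<gamma>)"
        by (rule rep_iso_dim[OF move_family_iso_target[OF mv one_neq_zero] that])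
      then have "dim_col (M' \<gamma>) = dim_col (rep_sum n (move_source n s B C D) (ivl_sum n zs) \<gamma>)"
        using that by (simp add: M'_eq dim_move_family)
      also have "\<dots> = q" using rep_iso_dim[OF isoM that] mat_tuples_dim[OF Mt that] by simp
      finally show ?thesis .
    qed
    have wfM': "wf_rep n M'" unfolding M'_def by (rule wf_ivl_sum)
    have M't: "M' \<in> mat_tuples n q"
      unfolding mat_tuples_iff
    proof (intro conjI allI impI)
      show "M' \<in> extensional {..<n}" unfolding M'_eq by (rule rep_sum_extensional)
      show "M' \<gamma> \<in> carrier_mat q q" if "\<gamma> < n" for \<gamma>
        using wf_rep_carrier[OF wfM' that] M'_dim[OF that] M'_dim[OF Suc_mod_less[OF that]] by simp
    qed
    have rank': "has_rank (path_map n M' \<gamma> l) (path_count n K \<gamma> l)" if "\<gamma> < n" for \<gamma> l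
      unfolding M'_def by (rule has_rank_path_map_ivl_sum[OF K_bd that])
    have "nilpotent_rep n (n - 1) M'"
      unfolding nilpotent_rep_def
    proof (intro allI impI)
      fix \<alpha> l assume \<alpha>: "\<alpha> < n" and l: "n - 1 \<le> l"
      have "path_count n K \<alpha> l = 0" using K_bd l by (auto simp: path_count_def filter_empty_conv)
      then have "has_rank (path_map n M' \<alpha> l) 0" using rank'[OF \<alpha>, of l] by simp
      then show "path_map n M' \<alpha> l = 0\<^sub>m (dim_col (M' ((\<alpha> + l) mod n))) (dim_col (M' \<alpha>))"
        using has_rank_0_imp_zero path_map_carrier[OF wfM' \<alpha>, of l] by (metis carrier_matD)
    qed
    then have M'nil: "M' \<in> nil_reps n q (n - 1)" using M't by (simp add: nil_reps_def)
    have "rep_iso n M' (rep_sum n (move_target n s B C D) (ivl_sum n zs))"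
      using rep_iso_refl[OF wfM'] unfolding M'_eq .
    then have "gluing_step n M M' \<or> shift_step n M M'"
      unfolding step_iff_move using ivl_sum_reps[of n zs] mv isoM by blast
    then have "ad_le n q M M'"
      unfolding ad_le_def using rep_iso_refl[OF wfM] rep_iso_refl[OF wfM'] M M'nil
      by (intro exI[of _ 1] exI[of _ "\<lambda>j. if j = 0 then M else M'"]) auto
    then have iso': "rep_iso n M M'" using max M'nil by blast
    \<comment> \<open>The path from \<open>C - 1\<close> to \<open>B + 1\<close>, of length
      \<open>B + 2 - C\<close>, lies in \<open>[0, D]\<close> but in none of \<open>[0, B]\<close>,
      \<open>[C, D]\<close> and \<open>[C, B]\<close>. Its rank goes up by exactly one.\<close>
    define \<gamma> where "\<gamma> = (s + (C - 1)) mod n"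
    have \<gamma>: "\<gamma> < n" using bd by (simp add: \<gamma>_def)
    have os: "offset n s \<gamma> = C - 1" using offset_eq_iff[OF bd(1) \<gamma>, of "C - 1"] bd by (simp add: \<gamma>_def)
    have os2: "offset n ?s \<gamma> = n - 1" using offset_shifted_start[OF bd(1) _ \<gamma>, of C] os bd by auto
    have "has_rank (path_map n M' \<gamma> (B + 2 - C)) (path_count n xs \<gamma> (B + 2 - C))"
      by (rule has_rank_path_map_iso[OF wfM wfM' \<gamma> iso' xs(3)[OF \<gamma>]])
    then have "path_count n K \<gamma> (B + 2 - C) = path_count n ((s, Suc B) # (?s, Suc D - C) # zs) \<gamma> (B + 2 - C)"
      using has_rank_unique[OF rank'[OF \<gamma>]] path_count_mset[OF zs] by simp
    moreover have "\<not> n - 1 + (B + 2 - C) < Suc D - C" "\<not> C - 1 + (B + 2 - C) < Suc B"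
      "C - 1 + (B + 2 - C) < Suc D" using bd by auto
    ultimately show False
      unfolding K_def path_count_Cons os os2 by simp
  qed
  then show "M \<in> maximal_reps n q (rk_le n)" using M by (simp add: maximal_reps_def)
qed

lemma maximal_reps_eq:
  "maximal_reps n q (rk_le n) = maximal_reps n q (ad_le n q)"
  "maximal_reps n q (rk_le n) = maximal_reps n q (deg_le n q)"
  using maximal_rk_subset_deg[of n q] maximal_deg_subset_ad[of n q] maximal_ad_subset_rk[of n q] by auto

section \<open>Irreducible components\<close>

lemma poly_on_GL_act:
  assumes g: "g \<in> GL_tuples n q" and f: "f \<in> poly_funs n q"
  shows "poly_on n q (\<lambda>X. f (GL_act n g X))"
  using f
proof (induction rule: poly_funs.induct)
  case (coord \<alpha> i j)
  have gc: "g \<gamma> \<in> carrier_mat q q" "invertible_mat (g \<gamma>)" if "\<gamma> < n" for \<gamma>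
    using g that by (auto simp: GL_tuples_def PiE_iff)
  obtain h where h: "h \<in> carrier_mat q q" "mat_inverse (g \<alpha>) = Some h"
    using invertible_mat_inverse[OF gc[OF coord(1)]] by metis
  have "poly_on n q (\<lambda>X. (g (Suc \<alpha> mod n) * X \<alpha> * h) $$ (i, j))"
  proof (rule poly_on_mult_entries[OF _ _ _ _ coord(2,3)])
    show "g (Suc \<alpha> mod n) * X \<alpha> \<in> carrier_mat q q" if "X \<in> mat_tuples n q" for X
      by (rule mult_carrier_mat[OF gc(1)[OF Suc_mod_less[OF coord(1)]] mat_tuplesD[OF that coord(1)]])
    show "poly_on n q (\<lambda>X. (g (Suc \<alpha> mod n) * X \<alpha>) $$ (i, j))" if ij: "i < q" "j < q" for i j
    proof (rule poly_on_mult_entries[OF _ _ _ _ ij])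
      show "g (Suc \<alpha> mod n) \<in> carrier_mat q q" by (rule gc(1)[OF Suc_mod_less[OF coord(1)]])
      show "X \<alpha> \<in> carrier_mat q q" if "X \<in> mat_tuples n q" for X by (rule mat_tuplesD[OF that coord(1)])
      show "poly_on n q (\<lambda>X. X \<alpha> $$ (i, j))" if "i < q" "j < q" for i j
        unfolding poly_on_def by (intro bexI[OF _ poly_funs.coord[OF coord(1) that]]) simp
    qed (rule poly_on_const)
  qed (use h(1) poly_on_const in auto)
  then show ?case using coord(1) h(2) by (simp add: GL_act_def)
qed (auto intro: poly_on_const poly_on_add poly_on_mult)

text \<open>Orbit closures are stable under the group: for a fixed \<open>g\<close>, a polynomial
  precomposed with the action of \<open>g\<close> is again polynomial on tuples and still vanishes
  on the orbit of \<open>N\<close>, hence at \<open>M\<close>.\<close>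

lemma orbit_subset_closure:
  assumes M: "M \<in> mat_tuples n q" and N: "N \<in> mat_tuples n q" and "M \<in> orbit_closure n q N"
  shows "GL_orbit n q M \<subseteq> orbit_closure n q N"
proof
  fix X assume X: "X \<in> GL_orbit n q M"
  then obtain g where g: "g \<in> GL_tuples n q" "X = GL_act n g M" by (auto simp: GL_orbit_def)
  have sub: "GL_orbit n q N \<subseteq> mat_tuples n q" using GL_orbit_eq[OF N] by blast
  have Xt: "X \<in> mat_tuples n q" using X GL_orbit_eq[OF M] by blast
  show "X \<in> orbit_closure n q N"
    unfolding orbit_closure_def closure_of_zariski[OF sub]
  proof (intro conjI ballI impI Xt)
    fix f assume f: "f \<in> poly_funs n q" "\<forall>Y\<in>GL_orbit n q N. f Y = 0"
    obtain p where p: "p \<in> poly_funs n q" "\<And>Y. Y \<in> mat_tuples n q \<Longrightarrow> f (GL_act n g Y) = p Y"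
      using poly_on_GL_act[OF g(1) f(1)] unfolding poly_on_def by blast
    have "p Y = 0" if Y: "Y \<in> GL_orbit n q N" for Y
    proof -
      have Yt: "Y \<in> mat_tuples n q" "rep_iso n N Y" using Y GL_orbit_eq[OF N] by auto
      have "GL_act n g Y \<in> GL_orbit n q Y" using g(1) by (auto simp: GL_orbit_def)
      then have "GL_act n g Y \<in> mat_tuples n q" "rep_iso n Y (GL_act n g Y)" using GL_orbit_eq[OF Yt(1)] by auto
      then have "GL_act n g Y \<in> GL_orbit n q N"
        using GL_orbit_eq[OF N] rep_iso_trans[OF Yt(2)] mat_tuples_wf N Yt(1) by blast
      then show ?thesis using f(2) p(2)[OF Yt(1)] by simp
    qed
    then have "p M = 0"
      using assms(3) p(1) unfolding orbit_closure_def closure_of_zariski[OF sub] by blast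
    then show "f X = 0" using p(2)[OF M] g(2) by simp
  qed
qed

lemma GL_orbit_cong:
  assumes M: "M \<in> mat_tuples n q" and N: "N \<in> mat_tuples n q" and iso: "rep_iso n M N"
  shows "GL_orbit n q M = GL_orbit n q N"
  unfolding GL_orbit_eq[OF M] GL_orbit_eq[OF N]
  using rep_iso_trans[OF iso] rep_iso_trans[OF rep_iso_sym[OF iso]] mat_tuples_wf M N by blast

lemma self_in_orbit_closure: "M \<in> mat_tuples n q \<Longrightarrow> M \<in> orbit_closure n q M"
proof -
  assume M: "M \<in> mat_tuples n q"
  have "GL_orbit n q M \<subseteq> orbit_closure n q M"
    unfolding orbit_closure_def using GL_orbit_eq[OF M]
    by (intro closure_of_subset) (auto simp: topspace_zariski)
  then show ?thesis using GL_orbit_eq[OF M] M rep_iso_refl[OF mat_tuples_wf[OF M]] by blast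
qed

lemma orbit_closure_subset_nil_reps:
  assumes M: "M \<in> nil_reps n q k"
  shows "orbit_closure n q M \<subseteq> nil_reps n q k"
proof -
  have Mt: "M \<in> mat_tuples n q" "nilpotent_rep n k M" using M by (auto simp: nil_reps_def)
  have "GL_orbit n q M \<subseteq> nil_reps n q k"
    unfolding GL_orbit_eq[OF Mt(1)] nil_reps_def
    using nilpotent_rep_iso[OF mat_tuples_wf[OF Mt(1)] mat_tuples_wf _ Mt(2)] by blast
  then show ?thesis unfolding orbit_closure_def by (rule closure_of_minimal[OF _ closedin_nil_reps])
qed

section \<open>Finiteness of the number of orbits\<close>

lemma length_le_sum_path_count:
  assumes "valid_ivls n xs"
  shows "length xs \<le> (\<Sum>\<gamma><n. path_count n xs \<gamma> 0)"
  using assms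
proof (induction xs)
  case (Cons x xs)
  obtain s e where x: "x = (s, e)" by fastforce
  have v: "s < n" "0 < e" "valid_ivls n xs" using Cons.prems by (auto simp: valid_ivls_def x)
  have "of_bool (offset n s s + 0 < e) \<le> (\<Sum>\<gamma><n. of_bool (offset n s \<gamma> + 0 < e) :: nat)"
    using v(1) by (intro member_le_sum) auto
  then have "1 \<le> (\<Sum>\<gamma><n. of_bool (offset n s \<gamma> + 0 < e) :: nat)" using v(2) offset_self[of n s] by simp
  then show ?case using Cons.IH[OF v(3)] by (simp add: x path_count_Cons sum.distrib)
qed simp

lemma finite_nil_orbits: "finite (GL_orbit n q ` nil_reps n q (n - 1))"
proof -
  \<comment> \<open>\<open>n * q\<close> is the total dimension, of which every interval takes up at
    least one.\<close>
  define LS where "LS = {xs. set xs \<subseteq> {..<n} \<times> {..<n} \<and> length xs \<le> n * q}"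
  have "finite LS" unfolding LS_def by (intro finite_lists_length_le) auto
  moreover have "GL_orbit n q ` nil_reps n q (n - 1) \<subseteq> (\<lambda>xs. {N \<in> mat_tuples n q. rep_iso n (ivl_sum n xs) N}) ` LS"
  proof
    fix S assume "S \<in> GL_orbit n q ` nil_reps n q (n - 1)"
    then obtain M where M: "M \<in> nil_reps n q (n - 1)" "S = GL_orbit n q M" by blast
    have Mt: "M \<in> mat_tuples n q" using M nil_reps_mat_tuples by blast
    note wfM = mat_tuples_wf[OF Mt]
    obtain xs where xs: "valid_ivls n xs" "rep_iso n M (ivl_sum n xs)"
      "\<And>\<gamma> l. \<gamma> < n \<Longrightarrow> has_rank (path_map n M \<gamma> l) (path_count n xs \<gamma> l)"
      using nil_rep_intervals[OF M(1)] by metis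
    have "length xs \<le> (\<Sum>\<gamma><n. path_count n xs \<gamma> 0)" by (rule length_le_sum_path_count[OF xs(1)])
    also have "\<dots> = (\<Sum>\<gamma><n. q)"
      by (intro sum.cong refl) (use path_count_length_zero[OF Mt _ xs(3)] in auto)
    finally have "xs \<in> LS" using xs(1) by (auto simp: LS_def valid_ivls_def)
    moreover have "S = {N \<in> mat_tuples n q. rep_iso n (ivl_sum n xs) N}"
      unfolding M(2) GL_orbit_eq[OF Mt]
      using rep_iso_trans[OF xs(2) _ wfM wf_ivl_sum] rep_iso_trans[OF rep_iso_sym[OF xs(2) wfM wf_ivl_sum] _ wf_ivl_sum wfM]
        mat_tuples_wf by blast
    ultimately show "S \<in> (\<lambda>xs. {N \<in> mat_tuples n q. rep_iso n (ivl_sum n xs) N}) ` LS" by blast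
  qed
  ultimately show ?thesis using finite_surj by blast
qed

lemma irreducible_in_finite_Union:
  assumes "irreducible_in T S" "finite K" "\<And>C. C \<in> K \<Longrightarrow> closedin T C" "S \<subseteq> \<Union>K"
  shows "\<exists>C\<in>K. S \<subseteq> C"
  using assms(2-4)
proof (induction K rule: finite_induct)
  case empty
  then show ?case using assms(1) by (auto simp: irreducible_in_def)
next
  case (insert C K)
  have "closedin T (\<Union>K)" using insert by (intro closedin_Union) auto
  then have "S \<subseteq> C \<or> S \<subseteq> \<Union>K"
    using assms(1) insert.prems unfolding irreducible_in_def by (metis Union_insert insertI1)
  then show ?case using insert by blast
qed

text \<open>The nilpotent locus is covered by the closures of its finitely many orbits, and an
  irreducible set covered by finitely many closed sets lies in one of them.\<close>

lemma irreducible_subset_orbit_closure: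
  assumes "irreducible_in (zariski n q) S" "S \<subseteq> nil_reps n q (n - 1)"
  shows "\<exists>M\<in>nil_reps n q (n - 1). S \<subseteq> orbit_closure n q M"
proof -
  let ?K = "(\<lambda>Q. zariski n q closure_of Q) ` GL_orbit n q ` nil_reps n q (n - 1)"
  have "\<exists>C\<in>?K. S \<subseteq> C"
  proof (rule irreducible_in_finite_Union[OF assms(1)])
    show "finite ?K" using finite_nil_orbits by blast
    show "closedin (zariski n q) C" if "C \<in> ?K" for C using that by auto
    show "S \<subseteq> \<Union>?K"
    proof
      fix X assume "X \<in> S"
      then have X: "X \<in> nil_reps n q (n - 1)" "X \<in> mat_tuples n q" using assms(2) nil_reps_mat_tuples by blast+
      then show "X \<in> \<Union>?K" using self_in_orbit_closure[OF X(2)] unfolding orbit_closure_def by blast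
    qed
  qed
  then show ?thesis unfolding orbit_closure_def by blast
qed

lemma irreducible_orbit_closure:
  "M \<in> mat_tuples n q \<Longrightarrow> irreducible_in (zariski n q) (orbit_closure n q M)"
  unfolding orbit_closure_def by (intro irreducible_in_closure_of irreducible_GL_orbit)

lemma maximal_orbit_closure_component:
  assumes M: "M \<in> maximal_reps n q (deg_le n q)"
  shows "orbit_closure n q M \<in> irreducible_components (zariski n q) (nil_reps n q (n - 1))"
proof -
  have Mn: "M \<in> nil_reps n q (n - 1)"
    and max: "\<And>N. N \<in> nil_reps n q (n - 1) \<Longrightarrow> deg_le n q M N \<Longrightarrow> rep_iso n M N"
    using M by (auto simp: maximal_reps_def)
  have Mt: "M \<in> mat_tuples n q" using Mn nil_reps_mat_tuples by blast
  have "D = orbit_closure n q M"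
    if D: "D \<subseteq> nil_reps n q (n - 1)" "irreducible_in (zariski n q) D" "orbit_closure n q M \<subseteq> D" for D
  proof -
    obtain N where N: "N \<in> nil_reps n q (n - 1)" "D \<subseteq> orbit_closure n q N"
      using irreducible_subset_orbit_closure[OF D(2,1)] by blast
    have Nt: "N \<in> mat_tuples n q" using N nil_reps_mat_tuples by blast
    have "deg_le n q M N" using self_in_orbit_closure[OF Mt] D(3) N(2) unfolding deg_le_def by blast
    then have "GL_orbit n q M = GL_orbit n q N" using max[OF N(1)] GL_orbit_cong[OF Mt Nt] by blast
    then show ?thesis using D(3) N(2) unfolding orbit_closure_def by auto
  qed
  then show ?thesis
    unfolding irreducible_components_def
    using orbit_closure_subset_nil_reps[OF Mn] irreducible_orbit_closure[OF Mt] by blast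
qed

lemma component_is_maximal_orbit_closure:
  assumes C: "C \<in> irreducible_components (zariski n q) (nil_reps n q (n - 1))"
  shows "\<exists>M\<in>maximal_reps n q (deg_le n q). C = orbit_closure n q M"
proof -
  have C': "C \<subseteq> nil_reps n q (n - 1)" "irreducible_in (zariski n q) C"
    and max: "\<And>D. D \<subseteq> nil_reps n q (n - 1) \<Longrightarrow> irreducible_in (zariski n q) D \<Longrightarrow> C \<subseteq> D \<Longrightarrow> D = C"
    using C by (auto simp: irreducible_components_def)
  obtain M where M: "M \<in> nil_reps n q (n - 1)" "C \<subseteq> orbit_closure n q M"
    using irreducible_subset_orbit_closure[OF C'(2,1)] by blast
  have Mt: "M \<in> mat_tuples n q" using M nil_reps_mat_tuples by blast
  have CM: "orbit_closure n q M = C"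
    by (rule max[OF orbit_closure_subset_nil_reps[OF M(1)] irreducible_orbit_closure[OF Mt] M(2)])
  have "rep_iso n M N" if N: "N \<in> nil_reps n q (n - 1)" and deg: "deg_le n q M N" for N
  proof -
    have Nt: "N \<in> mat_tuples n q" using N nil_reps_mat_tuples by blast
    have "GL_orbit n q M \<subseteq> orbit_closure n q N"
      using orbit_subset_closure[OF Mt Nt] deg unfolding deg_le_def by blast
    then have "orbit_closure n q M \<subseteq> orbit_closure n q N"
      unfolding orbit_closure_def by (rule closure_of_minimal) simp
    then have "orbit_closure n q N = C"
      using max[OF orbit_closure_subset_nil_reps[OF N] irreducible_orbit_closure[OF Nt]] CM by blast
    \<comment> \<open>Equal closures give degenerations in both directions. These give equal ranks
      of all paths, and ranks determine the isomorphism class.\<close>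
    then have "deg_le n q N M" using self_in_orbit_closure[OF Nt] CM unfolding deg_le_def by simp
    then show ?thesis
      using rk_le_antisym[OF M(1) N deg_le_imp_rk_le[OF N M(1) deg] deg_le_imp_rk_le[OF M(1) N]] by blast
  qed
  then have "M \<in> maximal_reps n q (deg_le n q)" using M(1) by (simp add: maximal_reps_def)
  then show ?thesis using CM by blast
qed

lemma maximal_orbit_closure_inj:
  assumes M: "M \<in> maximal_reps n q (deg_le n q)" and N: "N \<in> nil_reps n q (n - 1)"
    and eq: "orbit_closure n q M = orbit_closure n q N"
  shows "rep_iso n M N"
proof -
  have "M \<in> mat_tuples n q" using M by (simp add: maximal_reps_def nil_reps_def)
  then have "deg_le n q M N" using self_in_orbit_closure eq unfolding deg_le_def by blast
  then show ?thesis using M N by (auto simp: maximal_reps_def)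
qed

section \<open>The singular locus\<close>

lemma mat_trace_mult:
  assumes "A \<in> carrier_mat a b" "B \<in> carrier_mat b a"
  shows "mat_trace (A * B) = (\<Sum>i<a. \<Sum>k<b. A $$ (i, k) * B $$ (k, i))"
  using assms by (auto simp: mat_trace_def scalar_prod_def atLeast0LessThan intro!: sum.cong)

lemma mat_trace_comm:
  assumes "A \<in> carrier_mat a b" "B \<in> carrier_mat b a"
  shows "mat_trace (A * B) = mat_trace (B * A)"
  unfolding mat_trace_mult[OF assms] mat_trace_mult[OF assms(2,1)]
  by (subst sum.swap) (simp add: mult.commute)

text \<open>The cyclic product is rotated so that the factor at \<open>\<alpha>\<close> stands at
  the right end; what precedes it is a path that avoids the arrow \<open>\<alpha>\<close>.\<close>

lemma IMM_eq_trace_path: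
  assumes X: "X \<in> mat_tuples n q" and \<alpha>: "\<alpha> < n"
  shows "IMM n q X = mat_trace (path_map n X (Suc \<alpha> mod n) (n - 1) * X \<alpha>)"
proof -
  note wf = mat_tuples_wf[OF X]
  have n0: "0 < n" using \<alpha> by simp
  have "fold (\<lambda>\<alpha> A. X \<alpha> * A) [0..<k] (1\<^sub>m q) = path_map n X 0 k" if "k \<le> n" for k
    using that
  proof (induction k)
    case 0
    then show ?case using mat_tuples_dim[OF X n0] by simp
  next
    case (Suc k)
    then show ?case by simp
  qed
  then have "IMM n q X = mat_trace (path_map n X 0 n)" by (simp add: IMM_def)
  also have "path_map n X 0 n = path_map n X \<alpha> (n - \<alpha>) * path_map n X 0 \<alpha>"
    using path_map_add[OF wf n0, of \<alpha> "n - \<alpha>"] \<alpha> by simp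
  also have "mat_trace \<dots> = mat_trace (path_map n X 0 \<alpha> * path_map n X \<alpha> (n - \<alpha>))"
    by (rule mat_trace_comm[OF path_map_square[OF X \<alpha>] path_map_square[OF X n0]])
  also have "path_map n X 0 \<alpha> * path_map n X \<alpha> (n - \<alpha>) = path_map n X \<alpha> n"
    using path_map_add[OF wf \<alpha>, of "n - \<alpha>" \<alpha>] \<alpha> by simp
  also have "path_map n X \<alpha> n = path_map n X (Suc \<alpha> mod n) (n - 1) * X \<alpha>"
    using path_map_Suc_start[OF wf \<alpha>, of "n - 1"] n0 by simp
  finally show ?thesis .
qed

text \<open>A path of length less than \<open>n\<close> starting right after the arrow
  \<open>\<alpha>\<close> stops before it would use that arrow, so it is constant in the variables
  of this arrow.\<close>

lemma path_map_update_other: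
  assumes \<alpha>: "\<alpha> < n" and l: "l < n" and dim: "dim_col A = dim_col (X \<alpha>)"
  shows "path_map n (X(\<alpha> := A)) (Suc \<alpha> mod n) l = path_map n X (Suc \<alpha> mod n) l"
  using l
proof (induction l)
  case 0
  \<comment> \<open>For \<open>n = 1\<close> the path starts at \<open>\<alpha>\<close> itself, and
    the size of its identity matrix is read off from the updated matrix.\<close>
  then show ?case using dim by simp
next
  case (Suc l)
  have "(Suc \<alpha> mod n + l) mod n \<noteq> \<alpha>"
  proof
    assume "(Suc \<alpha> mod n + l) mod n = \<alpha>"
    then have "(\<alpha> + Suc l) mod n = \<alpha>" by (metis add_Suc_right add_Suc mod_add_left_eq)
    then have "offset n \<alpha> \<alpha> = Suc l" using offset_eq_iff[of \<alpha> n \<alpha> "Suc l"] \<alpha> Suc.prems by simp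
    then show False by (simp add: offset_self)
  qed
  then show ?case using Suc by simp
qed

text \<open>As a function of one entry of \<open>X \<alpha>\<close> the trace is affine. The trace
  form pairs the entry \<open>(i, j)\<close> with the entry \<open>(j, i)\<close> of the other
  factor, which is the slope; hence the transposed indices.\<close>

lemma partial_deriv_IMM:
  assumes X: "X \<in> mat_tuples n q" and \<alpha>: "\<alpha> < n" and ij: "i < q" "j < q"
  shows "partial_deriv \<alpha> i j (IMM n q) X = path_map n X (Suc \<alpha> mod n) (n - 1) $$ (j, i)"
proof -
  define P where "P = path_map n X (Suc \<alpha> mod n) (n - 1)"
  have Pc: "P \<in> carrier_mat q q" unfolding P_def using path_map_square[OF X] \<alpha> by simp
  have Xc: "X \<alpha> \<in> carrier_mat q q" by (rule mat_tuplesD[OF X \<alpha>])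
  have "IMM n q (X(\<alpha> := update_mat (X \<alpha>) (i, j) t)) =
      P $$ (j, i) * t + (\<Sum>k<q. \<Sum>m<q. if m = i \<and> k = j then 0 else P $$ (k, m) * X \<alpha> $$ (m, k))" for t
  proof -
    let ?A = "update_mat (X \<alpha>) (i, j) t" and ?X = "X(\<alpha> := update_mat (X \<alpha>) (i, j) t)"
    have Ac: "?A \<in> carrier_mat q q" using Xc by (intro carrier_matI) auto
    have Xt: "?X \<in> mat_tuples n q" using X \<alpha> Ac by (auto simp: mat_tuples_iff extensional_def)
    have "path_map n ?X (Suc \<alpha> mod n) (n - 1) = P"
      unfolding P_def by (rule path_map_update_other[OF \<alpha>]) (use \<alpha> in auto)
    then have "IMM n q ?X = mat_trace (P * ?A)" using IMM_eq_trace_path[OF Xt \<alpha>] by simp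
    also have "\<dots> = (\<Sum>k<q. \<Sum>m<q. P $$ (k, m) * ?A $$ (m, k))"
      by (rule mat_trace_mult[OF Pc Ac])
    also have "\<dots> = (\<Sum>k<q. \<Sum>m<q. (if k = j then if m = i then P $$ (j, i) * t else 0 else 0) +
        (if m = i \<and> k = j then 0 else P $$ (k, m) * X \<alpha> $$ (m, k)))"
      using Xc ij by (intro sum.cong refl) (auto simp: update_mat_def)
    also have "\<dots> = (\<Sum>k<q. \<Sum>m<q. if k = j then if m = i then P $$ (j, i) * t else 0 else 0) +
        (\<Sum>k<q. \<Sum>m<q. if m = i \<and> k = j then 0 else P $$ (k, m) * X \<alpha> $$ (m, k))"
      by (simp only: sum.distrib)
    also have "(\<Sum>k<q. \<Sum>m<q. if k = j then if m = i then P $$ (j, i) * t else 0 else 0) =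
        (\<Sum>k<q. if k = j then (\<Sum>m<q. if m = i then P $$ (j, i) * t else 0) else 0)"
      by (intro sum.cong refl) auto
    also have "\<dots> = P $$ (j, i) * t" using ij by simp
    finally show ?thesis .
  qed
  then show ?thesis
    unfolding partial_deriv_def P_def[symmetric]
    by (intro DERIV_imp_deriv) (auto intro!: derivative_eq_intros)
qed

text \<open>The derivatives control the paths of length exactly \<open>n - 1\<close>, and longer
  paths factor through these. For \<open>n = 1\<close> the paths in question have length 0 and are
  identities, so for positive \<open>q\<close> both sides are empty.\<close>

lemma Sing_eq_nil_reps:
  assumes "n \<ge> 1"
  shows "Sing n q = nil_reps n q (n - 1)"
proof (intro Set.set_eqI iffI)
  fix X assume "X \<in> Sing n q"
  then have X: "X \<in> mat_tuples n q"
    and sing: "\<And>\<alpha> i j. \<alpha> < n \<Longrightarrow> i < q \<Longrightarrow> j < q \<Longrightarrow> partial_deriv \<alpha> i j (IMM n q) X = 0"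
    by (auto simp: Sing_def)
  note wf = mat_tuples_wf[OF X]
  have zero: "path_map n X \<beta> (n - 1) = 0\<^sub>m q q" if \<beta>: "\<beta> < n" for \<beta>
  proof -
    \<comment> \<open>The predecessor of \<open>\<beta>\<close>: the derivatives with respect to the
      arrow ending at \<open>\<beta>\<close> are the entries of the path that starts there.\<close>
    define \<alpha> where "\<alpha> = (\<beta> + (n - 1)) mod n"
    have \<alpha>: "\<alpha> < n" using \<beta> by (simp add: \<alpha>_def)
    have "Suc \<alpha> mod n = (\<beta> + n) mod n" using assms by (simp add: \<alpha>_def mod_Suc_eq)
    then have "Suc \<alpha> mod n = \<beta>" using \<beta> by simp
    then show ?thesis
      using path_map_square[OF X \<beta>, of "n - 1"] sing[OF \<alpha>] partial_deriv_IMM[OF X \<alpha>]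
      by (intro eq_matI) auto
  qed
  have "path_map n X \<beta> l = 0\<^sub>m q q" if \<beta>: "\<beta> < n" and l: "n - 1 \<le> l" for \<beta> l
  proof -
    have b: "(\<beta> + (n - 1)) mod n < n" using \<beta> by simp
    have "path_map n X \<beta> l = path_map n X ((\<beta> + (n - 1)) mod n) (l - (n - 1)) * 0\<^sub>m q q"
      using path_map_add[OF wf \<beta>, of "n - 1" "l - (n - 1)"] l zero[OF \<beta>] by simp
    then show ?thesis using right_mult_zero_mat[OF path_map_square[OF X b]] by simp
  qed
  then have "nilpotent_rep n (n - 1) X"
    unfolding nilpotent_rep_def using mat_tuples_dim[OF X] assms by auto
  then show "X \<in> nil_reps n q (n - 1)" using X by (simp add: nil_reps_def)
next
  fix X assume "X \<in> nil_reps n q (n - 1)"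
  then have X: "X \<in> mat_tuples n q" and nil: "nilpotent_rep n (n - 1) X" by (auto simp: nil_reps_def)
  have "partial_deriv \<alpha> i j (IMM n q) X = 0" if \<alpha>: "\<alpha> < n" and ij: "i < q" "j < q" for \<alpha> i j
  proof -
    have s: "Suc \<alpha> mod n < n" and e: "(Suc \<alpha> mod n + (n - 1)) mod n < n" using \<alpha> by auto
    have "path_map n X (Suc \<alpha> mod n) (n - 1) = 0\<^sub>m q q"
      using nil s mat_tuples_dim[OF X s] mat_tuples_dim[OF X e] unfolding nilpotent_rep_def by simp
    then show ?thesis using partial_deriv_IMM[OF X \<alpha> ij] ij by simp
  qed
  then show "X \<in> Sing n q" using X by (simp add: Sing_def)
qed

theorem theorem4p3:
  fixes n q :: nat
  assumes "n \<ge> 1" and "q \<ge> 1"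
  shows "(Sing n q = nil_reps n q (n - 1)) \<and>
    (closedin (zariski n q) (nil_reps n q (n - 1))) \<and>
    (maximal_reps n q (rk_le n) = maximal_reps n q (ad_le n q)) \<and>
    (maximal_reps n q (rk_le n) = maximal_reps n q (deg_le n q)) \<and>
    (bij_betw (\<lambda>Q. zariski n q closure_of Q)
           (GL_orbit n q ` maximal_reps n q (rk_le n))
           (irreducible_components (zariski n q) (Sing n q))) \<and>
    (\<forall>M \<in> maximal_reps n q (rk_le n).
           orbit_closure n q M \<in> irreducible_components (zariski n q) (Sing n q)) \<and>
    (\<forall>C \<in> irreducible_components (zariski n q) (Sing n q).
           \<exists>M \<in> maximal_reps n q (rk_le n). C = orbit_closure n q M) \<and>
    (\<forall>M \<in> maximal_reps n q (rk_le n). \<forall>N \<in> maximal_reps n q (rk_le n).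
           \<not> rep_iso n M N \<longrightarrow> orbit_closure n q M \<noteq> orbit_closure n q N)"
proof -
  let ?max = "maximal_reps n q (rk_le n)"
  let ?comp = "irreducible_components (zariski n q) (nil_reps n q (n - 1))"
  note max_eq = maximal_reps_eq[of n q]
  have max_sub: "?max \<subseteq> nil_reps n q (n - 1)" by (auto simp: maximal_reps_def)
  have comp: "\<forall>M\<in>?max. orbit_closure n q M \<in> ?comp"
    using maximal_orbit_closure_component unfolding max_eq(2) by blast
  have all: "\<forall>C\<in>?comp. \<exists>M\<in>?max. C = orbit_closure n q M"
    using component_is_maximal_orbit_closure unfolding max_eq(2) by blast
  have inj: "rep_iso n M N" if "M \<in> ?max" "N \<in> ?max" "orbit_closure n q M = orbit_closure n q N" for M N
    using maximal_orbit_closure_inj[of M n q N] that max_sub unfolding max_eq(2) by blast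
  have "bij_betw (\<lambda>Q. zariski n q closure_of Q) (GL_orbit n q ` ?max) ?comp"
    unfolding bij_betw_def
  proof
    \<comment> \<open>Orbits represent isomorphism classes, so isomorphic maximal elements are one
      point of the domain, and injectivity reduces to equal closures implying isomorphism.\<close>
    show "inj_on (\<lambda>Q. zariski n q closure_of Q) (GL_orbit n q ` ?max)"
    proof (rule inj_onI)
      fix S T assume "S \<in> GL_orbit n q ` ?max" "T \<in> GL_orbit n q ` ?max"
        and eq: "zariski n q closure_of S = zariski n q closure_of T"
      then obtain M N where MN: "M \<in> ?max" "N \<in> ?max" "S = GL_orbit n q M" "T = GL_orbit n q N" by blast
      then have "rep_iso n M N" using inj eq unfolding orbit_closure_def by blast
      moreover have "M \<in> mat_tuples n q" "N \<in> mat_tuples n q" using MN max_sub nil_reps_mat_tuples by blast+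
      ultimately show "S = T" using GL_orbit_cong MN(3,4) by blast
    qed
    show "(\<lambda>Q. zariski n q closure_of Q) ` GL_orbit n q ` ?max = ?comp"
      using comp all unfolding orbit_closure_def by blast
  qed
  then show ?thesis
    using Sing_eq_nil_reps[OF assms(1), of q] closedin_nil_reps max_eq comp all inj by auto
qed

end
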